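(* Let $p>1$ and $m\ge 2$. (i) Let $w\in\mathcal H_0$ be a stationary solution of the self-similar wave equation, i.e. a solution $w:(-1,1)\to\mathbb R^m$, $w\in\mathcal{H}_0$, of $$\frac1\rho\big(\rho(1-y^2)w'\big)'-\frac{2(p+1)}{(p-1)^2}w+|w|^{p-1}w=0 \quad\text{on } (-1,1).$$ Then either $w\equiv 0$, or there exist $d\in(-1,1)$ and $\Omega\in\mathbb S^{m-1}$ such that $w(y)=\Omega\,\kappa(d,y)$ for all $y\in(-1,1)$. (ii) It holds that $E(0,0)=0$ and, for all $d\in(-1,1)$ and all $\Omega\in\mathbb S^{m-1}$, $$E(\kappa(d,\cdot)\Omega,0)=E(\kappa_0,0)>0.$$
   Context: $|\cdot|$ is the Euclidean norm in $\mathbb R^m$, and $\mathbb S^{m-1}$ is the unit sphere of $\mathbb R^m$. The weight is $\rho(y)=(1-y^2)^{\frac{2}{p-1}}$. The space $\mathcal H_0$ is $$\mathcal H_0=\Big\{r\in H^1_{loc}((-1,1),\mathbb R^m)\ :\ \int_{-1}^1\big(|r'|^2(1-y^2)+|r|^2\big)\rho\,dy<+\infty\Big\}.$$ For $(d,y)\in(-1,1)^2$, $$\kappa(d,y)=\kappa_0\frac{(1-d^2)^{\frac1{p-1}}}{(1+dy)^{\frac2{p-1}}},\qquad \kappa_0=\Big(\frac{2(p+1)}{(p-1)^2}\Big)^{\frac1{p-1}}.$$ The functional $E$ is $$E(w,v)=\int_{-1}^1\Big(\tfrac12|v|^2+\tfrac12|\partial_yw|^2(1-y^2)+\tfrac{p+1}{(p-1)^2}|w|^2-\tfrac1{p+1}|w|^{p+1}\Big)\rho\,dy.$$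 The same formula is used for real-valued functions; in $E(\kappa_0,0)$ the symbol $\kappa_0$ denotes the corresponding constant function. *)

theory Defs
  imports "HOL-Analysis.Analysis"
begin

abbreviation ivl :: "real set"
  where "ivl \<equiv> {-1<..<1}"

definition test_function :: "(real \<Rightarrow> real) \<Rightarrow> bool"
  where "test_function \<phi> \<longleftrightarrow>
    (\<forall>n. (deriv ^^ n) \<phi> differentiable_on UNIV) \<and>
    (\<exists>K. compact K \<and> K \<subseteq> ivl \<and> (\<forall>y. y \<notin> K \<longrightarrow> \<phi> y = 0))"

definition L1_loc :: "(real \<Rightarrow> 'a::euclidean_space) \<Rightarrow> bool"
  where "L1_loc u \<longleftrightarrow> (\<forall>K. compact K \<and> K \<subseteq> ivl \<longrightarrow> set_integrable lebesgue K u)"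

definition L2_loc :: "(real \<Rightarrow> 'a::euclidean_space) \<Rightarrow> bool"
  where "L2_loc u \<longleftrightarrow> u \<in> borel_measurable (lebesgue_on ivl) \<and>
    (\<forall>K. compact K \<and> K \<subseteq> ivl \<longrightarrow> set_integrable lebesgue K (\<lambda>y. (norm (u y))\<^sup>2))"

definition has_weak_deriv :: "(real \<Rightarrow> 'a::euclidean_space) \<Rightarrow> (real \<Rightarrow> 'a) \<Rightarrow> bool"
  where "has_weak_deriv u g \<longleftrightarrow> L1_loc u \<and> L1_loc g \<and>
    (\<forall>\<phi>. test_function \<phi> \<longrightarrow>
      (LINT y:ivl|lebesgue. deriv \<phi> y *\<^sub>R u y) = - (LINT y:ivl|lebesgue. \<phi> y *\<^sub>R g y))"

text \<open>Weak derivatives are unique up to null sets, so nothing below depends on the choice made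
  here.\<close>

definition weak_deriv :: "(real \<Rightarrow> 'a::euclidean_space) \<Rightarrow> real \<Rightarrow> 'a"
  where "weak_deriv u = (SOME g. has_weak_deriv u g)"

definition H1_loc :: "(real \<Rightarrow> 'a::euclidean_space) set"
  where "H1_loc = {r. L2_loc r \<and> (\<exists>g. has_weak_deriv r g \<and> L2_loc g)}"

definition rho :: "real \<Rightarrow> real \<Rightarrow> real"
  where "rho p y = (1 - y\<^sup>2) powr (2 / (p - 1))"

definition H0 :: "real \<Rightarrow> (real \<Rightarrow> 'a::euclidean_space) set"
  where "H0 p = {r \<in> H1_loc.
    (\<integral>\<^sup>+ y \<in> ivl. ennreal (((norm (weak_deriv r y))\<^sup>2 * (1 - y\<^sup>2) + (norm (r y))\<^sup>2) * rho p y) \<partial>lebesgue)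
      < \<infinity>}"

text \<open>Elements of \<^const>\<open>H1_loc\<close> and \<^const>\<open>H0\<close> are functions rather than classes modulo null sets;
  pointwise assertions about them concern the continuous representative.\<close>

definition continuous_representative ::
    "(real \<Rightarrow> 'a::euclidean_space) \<Rightarrow> (real \<Rightarrow> 'a) \<Rightarrow> bool"
  where "continuous_representative w u \<longleftrightarrow>
    continuous_on ivl u \<and> (AE y in lebesgue_on ivl. w y = u y)"

text \<open>Both derivatives in the equation are weak derivatives: \<open>g\<close> is \<open>w'\<close> and \<open>h\<close> is
  \<open>(\<rho> (1 - y\<^sup>2) w')'\<close>. Since the remaining terms are locally integrable for \<open>w\<close> in \<^const>\<open>H1_loc\<close>,
  this is the equation in the sense of distributions.\<close>

definition stationary_solution :: "real \<Rightarrow> (real \<Rightarrow> 'a::euclidean_space) \<Rightarrow> bool"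
  where "stationary_solution p w \<longleftrightarrow>
    (\<exists>g h. has_weak_deriv w g \<and>
      has_weak_deriv (\<lambda>y. (rho p y * (1 - y\<^sup>2)) *\<^sub>R g y) h \<and>
      (AE y in lebesgue_on ivl.
        (1 / rho p y) *\<^sub>R h y - (2 * (p + 1) / (p - 1)\<^sup>2) *\<^sub>R w y
          + (norm (w y) powr (p - 1)) *\<^sub>R w y = 0))"

definition kappa0 :: "real \<Rightarrow> real"
  where "kappa0 p = (2 * (p + 1) / (p - 1)\<^sup>2) powr (1 / (p - 1))"

definition kappa :: "real \<Rightarrow> real \<Rightarrow> real \<Rightarrow> real"
  where "kappa p d y =
    kappa0 p * ((1 - d\<^sup>2) powr (1 / (p - 1)) / (1 + d * y) powr (2 / (p - 1)))"

definition E :: "real \<Rightarrow> (real \<Rightarrow> 'a::euclidean_space) \<Rightarrow> (real \<Rightarrow> 'a) \<Rightarrow> real"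
  where "E p w v =
    (LINT y:ivl|lebesgue.
      (1 / 2 * (norm (v y))\<^sup>2 + 1 / 2 * (norm (weak_deriv w y))\<^sup>2 * (1 - y\<^sup>2)
        + (p + 1) / (p - 1)\<^sup>2 * (norm (w y))\<^sup>2
        - 1 / (p + 1) * norm (w y) powr (p + 1)) * rho p y)"

end

theory Submission
  imports Defs "HOL-Computational_Algebra.Polynomial"
begin

text \<open>
  Write \<open>a = 2 / (p - 1)\<close>. Testing against smooth functions of compact support shows that \<open>w\<close>
  agrees almost everywhere with a \<open>C\<^sup>2\<close> function \<open>u\<close> solving the equation classically. In the
  variables \<open>y = tanh \<xi>\<close> and \<open>W = (1 - y\<^sup>2)\<^bsup>a/2\<^esup> u\<close> the equation is the autonomous system
  \<open>W'' = a\<^sup>2 W - |W|\<^bsup>p-1\<^esup> W\<close>, whose energy and angular momentum are conserved. Membership in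
  \<open>\<H>\<^sub>0\<close> says that \<open>Z = W' + a y W\<close> is square integrable in \<open>\<xi>\<close>, so \<open>W\<close> tends to \<open>0\<close> and
  \<open>Z\<close> is small at points arbitrarily far out; hence both conserved quantities vanish.
  Vanishing energy gives \<open>|W'| \<le> a |W|\<close>, so \<open>u\<close> vanishes identically or nowhere. In the second
  case vanishing angular momentum makes the direction of \<open>u\<close> constant, and then
  \<open>|u|\<^bsup>-1/a\<^esup>\<close> has second derivative \<open>0\<close>, which forces \<open>u = \<kappa>(d, \<cdot>) \<Omega>\<close>.
\<close>

section \<open>Smooth functions and test functions\<close>

text \<open>Square integrability of \<open>Z\<close> gives no limit of \<open>Z\<close>, only points
  arbitrarily far out at which it is small. This suffices because both conserved quantities are
  constant and need to be evaluated along one sequence only, at the end \<open>y = 1\<close>. The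
  bound on \<open>W'\<close> rests on the sign of the power term in the energy. Division by
  \<open>|u|\<close> has to wait until \<open>u\<close> is known to have no zeros; until then
  everything is expressed by inner products of \<open>u\<close> and \<open>v = u'\<close>, as
  functions of \<open>y\<close> itself. The power \<open>-1/a\<close> is dictated by the answer:
  \<open>\<kappa>(d, \<cdot>)\<close> is a constant times \<open>(1 + d y)\<close> to the power
  \<open>-a\<close>, so this power of it is affine. For an unknown profile its second derivative is
  a multiple of the energy identity, and the same identity at \<open>y = 0\<close> forces the affine
  function to have value there above the modulus of its slope, which is why \<open>|d| < 1\<close>.
  For the second claim, multiplying the equation by \<open>\<kappa>\<close> reduces the energy to
  the integral of \<open>\<rho>\<close> times the power \<open>p + 1\<close> of
  \<open>\<kappa>\<close>. The substitution \<open>(y + d) / (1 + d y)\<close>, a translation of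
  \<open>\<xi>\<close>, then removes \<open>d\<close>.\<close>

definition smooth :: "(real \<Rightarrow> real) \<Rightarrow> bool"
  where "smooth f \<longleftrightarrow> (\<forall>n. (deriv ^^ n) f differentiable_on UNIV)"

text \<open>All iterated derivatives of \<open>f\<close> stay in \<open>F\<close>. Closure
  properties of smoothness are thus proved by exhibiting a class closed under differentiation,
  without formulas for higher derivatives.\<close>

lemma smooth_coinduct:
  assumes "f \<in> F"
    and step: "\<And>f. f \<in> F \<Longrightarrow> \<exists>f'\<in>F. \<forall>x. (f has_real_derivative f' x) (at x)"
  shows "smooth f"
proof -
  have deriv_in: "deriv f \<in> F" if f: "f \<in> F" for f
  proof -
    obtain f' where "f' \<in> F" and D: "\<forall>x. (f has_real_derivative f' x) (at x)"
      using step[OF f] by blast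
    moreover have "deriv f = f'"
      using D by (auto intro: DERIV_imp_deriv)
    ultimately show ?thesis by simp
  qed
  have "(deriv ^^ n) f \<in> F" for n
    by (induction n) (auto simp: assms(1) deriv_in)
  then show ?thesis
    unfolding smooth_def differentiable_on_def
    by (metis step real_differentiable_def)
qed

lemma smooth_has_deriv:
  assumes "smooth f"
  shows "(f has_real_derivative deriv f x) (at x)"
  using assms unfolding smooth_def
  by (metis DERIV_deriv_iff_real_differentiable UNIV_I differentiable_on_def funpow_0)

lemma smooth_deriv:
  assumes "smooth f"
  shows "smooth (deriv f)"
  unfolding smooth_def
proof
  fix n
  have "(deriv ^^ Suc n) f differentiable_on UNIV"
    using assms unfolding smooth_def by blast
  then show "(deriv ^^ n) (deriv f) differentiable_on UNIV"
    by (simp only: funpow_Suc_right o_apply)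
qed

lemma smooth_continuous: "smooth f \<Longrightarrow> continuous_on S f"
  by (meson DERIV_isCont continuous_at_imp_continuous_on smooth_has_deriv)

lemma smooth_antiderivative:
  assumes "smooth f" "\<And>x. (F has_real_derivative f x) (at x)"
  shows "smooth F"
proof (rule smooth_coinduct[where F = "insert F (Collect smooth)"])
  fix h assume "h \<in> insert F (Collect smooth)"
  then show "\<exists>h'\<in>insert F (Collect smooth). \<forall>x. (h has_real_derivative h' x) (at x)"
  proof
    assume "h = F"
    then show ?thesis using assms by blast
  next
    assume "h \<in> Collect smooth"
    then show ?thesis
      by (intro bexI[of _ "deriv h"]) (auto simp: smooth_deriv smooth_has_deriv)
  qed
qed simp

lemma smooth_linear_combination:
  assumes "smooth f" "smooth g"
  shows "smooth (\<lambda>x. a * f x + b * g x)"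
proof (rule smooth_coinduct[where F = "{\<lambda>x. a * f x + b * g x | f g. smooth f \<and> smooth g}"])
  fix h assume "h \<in> {\<lambda>x. a * f x + b * g x | f g. smooth f \<and> smooth g}"
  then obtain f g where h: "h = (\<lambda>x. a * f x + b * g x)" and fg: "smooth f" "smooth g"
    by blast
  have "(h has_real_derivative a * deriv f x + b * deriv g x) (at x)" for x
    unfolding h using fg by (auto intro!: derivative_eq_intros smooth_has_deriv)
  moreover have "(\<lambda>x. a * deriv f x + b * deriv g x)
      \<in> {\<lambda>x. a * f x + b * g x | f g. smooth f \<and> smooth g}"
    using fg by (blast intro: smooth_deriv)
  ultimately show "\<exists>h'\<in>{\<lambda>x. a * f x + b * g x | f g. smooth f \<and> smooth g}.
      \<forall>x. (h has_real_derivative h' x) (at x)"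
    by (intro bexI[of _ "\<lambda>x. a * deriv f x + b * deriv g x"]) auto
qed (use assms in blast)

lemma smooth_affine:
  assumes "smooth f"
  shows "smooth (\<lambda>x. f (a * x + b))"
proof (rule smooth_coinduct[where F = "{\<lambda>x. c * f (a * x + b) | c f. smooth f}"])
  fix h assume "h \<in> {\<lambda>x. c * f (a * x + b) | c f. smooth f}"
  then obtain c f where h: "h = (\<lambda>x. c * f (a * x + b))" and f: "smooth f"
    by blast
  have "(h has_real_derivative c * a * deriv f (a * x + b)) (at x)" for x
    unfolding h
    by (rule derivative_eq_intros DERIV_chain2[OF smooth_has_deriv[OF f]] refl)+ simp
  moreover have "(\<lambda>x. c * a * deriv f (a * x + b)) \<in> {\<lambda>x. c * f (a * x + b) | c f. smooth f}"
    using f by (blast intro: smooth_deriv)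
  ultimately show "\<exists>h'\<in>{\<lambda>x. c * f (a * x + b) | c f. smooth f}.
      \<forall>x. (h has_real_derivative h' x) (at x)"
    by (intro bexI[of _ "\<lambda>x. c * a * deriv f (a * x + b)"]) auto
qed (use assms in \<open>auto intro!: exI[of _ 1] exI[of _ f]\<close>)

text \<open>The Leibniz rule turns a product into a sum of two products, so the class has to contain
  sums in order to be closed under differentiation.\<close>

inductive_set smooth_products :: "(real \<Rightarrow> real) set" where
  mult: "smooth f \<Longrightarrow> smooth g \<Longrightarrow> (\<lambda>x. f x * g x) \<in> smooth_products"
| add: "u \<in> smooth_products \<Longrightarrow> v \<in> smooth_products \<Longrightarrow> (\<lambda>x. u x + v x) \<in> smooth_products"

lemma smooth_mult:
  assumes "smooth f" "smooth g"
  shows "smooth (\<lambda>x. f x * g x)"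
proof (rule smooth_coinduct[where F = smooth_products])
  fix h assume "h \<in> smooth_products"
  then show "\<exists>h'\<in>smooth_products. \<forall>x. (h has_real_derivative h' x) (at x)"
  proof induction
    case (mult f g)
    have "((\<lambda>x. f x * g x) has_real_derivative deriv f x * g x + deriv g x * f x) (at x)" for x
      by (rule DERIV_mult) (auto intro: smooth_has_deriv mult)
    moreover have "(\<lambda>x. deriv f x * g x + deriv g x * f x) \<in> smooth_products"
      by (intro smooth_products.intros smooth_deriv mult)
    ultimately show ?case
      by (intro bexI[of _ "\<lambda>x. deriv f x * g x + deriv g x * f x"]) auto
  next
    case (add u v)
    then obtain u' v' where "u' \<in> smooth_products" "v' \<in> smooth_products"
      "\<forall>x. (u has_real_derivative u' x) (at x)" "\<forall>x. (v has_real_derivative v' x) (at x)"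
      by blast
    then show ?case
      by (intro bexI[of _ "\<lambda>x. u' x + v' x"]) (auto intro: smooth_products.add DERIV_add)
  qed
qed (use assms in \<open>auto intro: smooth_products.mult\<close>)

section \<open>Flat functions, a smooth step and compact supports\<close>

definition flat :: "real poly \<Rightarrow> real \<Rightarrow> real"
  where "flat P x = (if x > 0 then poly P (1 / x) * exp (- (1 / x)) else 0)"

lemma poly_times_exp_minus_tendsto_0:
  fixes P :: "real poly"
  shows "((\<lambda>t. poly P t * exp (- t)) \<longlongrightarrow> 0) at_top"
proof -
  have "((\<lambda>t. \<Sum>i\<le>degree P. coeff P i * (t ^ i / exp t)) \<longlongrightarrow> (\<Sum>i\<le>degree P. coeff P i * 0)) at_top"
    by (intro tendsto_sum tendsto_mult tendsto_const tendsto_power_div_exp_0)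
  moreover have "(\<Sum>i\<le>degree P. coeff P i * (t ^ i / exp t)) = poly P t * exp (- t)" for t
    by (simp add: poly_altdef sum_distrib_right exp_minus divide_inverse mult.assoc)
  ultimately show ?thesis by simp
qed

text \<open>In the variable \<open>t = 1 / x\<close> the operator \<open>d/dx\<close> is
  \<open>- t\<^sup>2 d/dt\<close>, which sends \<open>P e\<^sup>-\<^sup>t\<close> to
  \<open>t\<^sup>2 (P - P') e\<^sup>-\<^sup>t\<close>. The polynomial factor is carried along so
  that the class \<open>range flat\<close> is closed under differentiation, also at
  \<open>0\<close>.\<close>

lemma flat_has_deriv:
  "(flat P has_real_derivative flat ([:0, 0, 1:] * (P - pderiv P)) x) (at x)"
proof -
  consider "x > 0" | "x < 0" | "x = 0" by linarith
  then show ?thesis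
  proof cases
    case 1
    have "((\<lambda>x. poly P (1 / x) * exp (- (1 / x))) has_real_derivative
        flat ([:0, 0, 1:] * (P - pderiv P)) x) (at x)"
      using 1 by (auto intro!: derivative_eq_intros DERIV_chain2[OF poly_DERIV]
          simp: flat_def power2_eq_square field_simps)
    then show ?thesis
      by (rule DERIV_cong_ev[OF refl _ refl, THEN iffD1, rotated])
        (use 1 in \<open>auto simp: flat_def eventually_nhds intro!: exI[of _ "{0<..}"]\<close>)
  next
    case 2
    have "((\<lambda>x. 0) has_real_derivative flat ([:0, 0, 1:] * (P - pderiv P)) x) (at x)"
      using 2 by (auto simp: flat_def)
    then show ?thesis
      by (rule DERIV_cong_ev[OF refl _ refl, THEN iffD1, rotated])
        (use 2 in \<open>auto simp: flat_def eventually_nhds intro!: exI[of _ "{..<0}"]\<close>)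
  next
    case 3
    \<comment> \<open>Dividing by \<open>h\<close> is multiplying by \<open>t = 1 / h\<close>, and
      \<open>pCons 0 P\<close> is the polynomial \<open>t P(t)\<close>; so the difference quotient
      at \<open>0\<close> is again of the form just treated.\<close>
    have "((\<lambda>h. poly (pCons 0 P) (inverse h) * exp (- inverse h)) \<longlongrightarrow> 0) (at_right 0)"
      by (rule filterlim_compose[OF poly_times_exp_minus_tendsto_0 filterlim_inverse_at_top_right])
    then have "((\<lambda>h. flat P h / h) \<longlongrightarrow> 0) (at_right 0)"
      by (rule Lim_transform_eventually)
        (auto simp: flat_def eventually_at_filter divide_inverse)
    moreover have "((\<lambda>h. flat P h / h) \<longlongrightarrow> 0) (at_left 0)"
      by (rule Lim_transform_eventually[OF tendsto_const])
        (auto simp: flat_def eventually_at_filter)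
    ultimately have "((\<lambda>h. flat P h / h) \<longlongrightarrow> 0) (at 0)"
      by (simp add: filterlim_split_at)
    then show ?thesis
      using 3 by (simp add: DERIV_def flat_def)
  qed
qed

lemma smooth_flat: "smooth (flat P)"
  by (rule smooth_coinduct[where F = "range flat"]) (auto intro: flat_has_deriv)

lemma antiderivative_exists:
  fixes f :: "real \<Rightarrow> real"
  assumes "continuous_on UNIV f"
  obtains F where "\<And>x. (F has_real_derivative f x) (at x)"
proof
  fix x :: real
  \<comment> \<open>The radius \<open>\<bar>x\<bar> + 1\<close> puts both the base point
    \<open>0\<close> and \<open>x\<close> into the interior of one interval.\<close>
  have "((\<lambda>u. LBINT y=0..u. f y) has_vector_derivative f x) (at x within {- \<bar>x\<bar> - 1..\<bar>x\<bar> + 1})"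
    by (rule interval_integral_FTC2[of _ 0, unfolded zero_ereal_def[symmetric]]) (auto intro: continuous_on_subset[OF assms])
  moreover have "at x within {- \<bar>x\<bar> - 1..\<bar>x\<bar> + 1} = at x"
    by (rule at_within_interior) auto
  ultimately show "((\<lambda>u. LBINT y=0..u. f y) has_real_derivative f x) (at x)"
    by (simp add: has_real_derivative_iff_has_vector_derivative)
qed

text \<open>The step is the normalised antiderivative of a bump that is positive exactly on the open
  unit interval.\<close>

lemma smooth_step_exists:
  obtains S where "smooth S" "\<And>x. x \<le> 0 \<Longrightarrow> S x = 0" "\<And>x. 1 \<le> x \<Longrightarrow> S x = 1"
    "\<And>x. 0 \<le> S x" "\<And>x. S x \<le> 1"
proof -
  define B where "B x = flat 1 x * flat 1 (-1 * x + 1)" for x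
  have B: "smooth B"
    unfolding B_def by (intro smooth_mult smooth_affine smooth_flat)
  obtain T where T: "\<And>x. (T has_real_derivative B x) (at x)"
    using antiderivative_exists smooth_continuous[OF B] by blast
  have B_nonneg: "0 \<le> B x" for x
    by (simp add: B_def flat_def)
  have mono: "T x \<le> T y" if "x \<le> y" for x y
    by (rule DERIV_nonneg_imp_nondecreasing[OF that]) (use T B_nonneg in blast)
  have const: "T x = T y" if "x \<le> y" "\<And>z. x \<le> z \<Longrightarrow> z \<le> y \<Longrightarrow> B z = 0" for x y
    using mono[OF that(1)] T that(2)
    by (intro antisym DERIV_nonpos_imp_nonincreasing[OF that(1)]) (metis order_refl)+
  have le_0: "T x = T 0" if "x \<le> 0" for x
    using that by (intro const) (auto simp: B_def flat_def)
  have ge_1: "T x = T 1" if "1 \<le> x" for x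
    using that by (intro const[symmetric]) (auto simp: B_def flat_def)
  have "T 0 < T 1"
  proof (rule DERIV_pos_imp_increasing_open[where f = T])
    fix x :: real assume "0 < x" "x < 1"
    then have "B x > 0" by (simp add: B_def flat_def)
    then show "\<exists>y. (T has_real_derivative y) (at x) \<and> 0 < y" using T by blast
  next
    show "continuous_on {0..1} T"
      using T by (intro continuous_at_imp_continuous_on ballI DERIV_isCont)
  qed simp
  then have pos: "T 1 - T 0 > 0" by simp
  show ?thesis
  proof (rule that[of "\<lambda>x. (T x - T 0) / (T 1 - T 0)"])
    show "smooth (\<lambda>x. (T x - T 0) / (T 1 - T 0))"
    proof (rule smooth_antiderivative)
      show "smooth (\<lambda>x. 1 / (T 1 - T 0) * B x + 0 * B x)"
        by (intro smooth_linear_combination B)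
      show "((\<lambda>x. (T x - T 0) / (T 1 - T 0)) has_real_derivative 1 / (T 1 - T 0) * B x + 0 * B x) (at x)" for x
        by (rule derivative_eq_intros T refl)+ (use pos in auto)
    qed
    show "(T x - T 0) / (T 1 - T 0) = 0" if "x \<le> 0" for x
      using le_0[OF that] by simp
    show "(T x - T 0) / (T 1 - T 0) = 1" if "1 \<le> x" for x
      using ge_1[OF that] pos by simp
    show "0 \<le> (T x - T 0) / (T 1 - T 0)" for x
      using mono[of 0 x] le_0[of x] pos by (cases "0 \<le> x") auto
    show "(T x - T 0) / (T 1 - T 0) \<le> 1" for x
      using mono[of x 1] ge_1[of x] pos by (cases "x \<le> 1") auto
  qed
qed

lemma compact_subset_ivl:
  assumes "compact K" "K \<subseteq> ivl"
  obtains c d where "-1 < c" "c < d" "d < 1" "K \<subseteq> {c<..<d}"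
proof (cases "K = {}")
  case True
  then show ?thesis by (intro that[of 0 "1/2"]) auto
next
  case False
  obtain s where s: "s \<in> K" "\<forall>t\<in>K. s \<le> t"
    using compact_attains_inf[OF assms(1) False] by blast
  obtain t where t: "t \<in> K" "\<forall>s\<in>K. s \<le> t"
    using compact_attains_sup[OF assms(1) False] by blast
  have "-1 < s" "t < 1" "s \<le> t"
    using s t assms by auto
  then show ?thesis
    using s t by (intro that[of "(s - 1) / 2" "(t + 1) / 2"]) (fastforce simp: subset_iff)+
qed

lemma test_functionE:
  assumes "test_function \<phi>"
  obtains c d where "-1 < c" "c < d" "d < 1" "\<And>y. y \<notin> {c<..<d} \<Longrightarrow> \<phi> y = 0" "smooth \<phi>"
proof -
  obtain K where K: "compact K" "K \<subseteq> ivl" "\<And>y. y \<notin> K \<Longrightarrow> \<phi> y = 0"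
    using assms unfolding test_function_def by blast
  obtain c d where "-1 < c" "c < d" "d < 1" "K \<subseteq> {c<..<d}"
    using compact_subset_ivl[OF K(1,2)] .
  moreover from this have "\<phi> y = 0" if "y \<notin> {c<..<d}" for y
    using K(3) that by blast
  ultimately show ?thesis
    using assms by (intro that[of c d]) (auto simp: smooth_def test_function_def)
qed

lemma test_functionI:
  assumes "smooth \<phi>" "-1 < c" "d < 1" "\<And>y. y \<notin> {c..d} \<Longrightarrow> \<phi> y = 0"
  shows "test_function \<phi>"
  unfolding test_function_def
proof (intro conjI exI[of _ "{c..d}"])
  show "\<forall>n. (deriv ^^ n) \<phi> differentiable_on UNIV" using assms(1) by (simp add: smooth_def)
qed (use assms in auto)

section \<open>Weak derivatives on the interval\<close>

lemma L1_loc_interval: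
  assumes "L1_loc f" "-1 < c" "d < 1"
  shows "set_integrable lebesgue {c..d} f"
proof -
  have "compact {c..d}" "{c..d} \<subseteq> ivl" using assms by auto
  then show ?thesis using assms(1) unfolding L1_loc_def by blast
qed

section \<open>Localised integrals and the fundamental lemma of the calculus of variations\<close>

lemma continuous_scaleR_integrable:
  fixes f :: "real \<Rightarrow> 'a::euclidean_space"
  assumes "continuous_on {c..d} \<phi>" "set_integrable lebesgue {c..d} f"
  shows "set_integrable lebesgue {c..d} (\<lambda>y. \<phi> y *\<^sub>R f y)"
proof (rule absolutely_integrable_bounded_measurable_product[where h = "(*\<^sub>R)"])
  show "bilinear ((*\<^sub>R) :: real \<Rightarrow> 'a \<Rightarrow> 'a)"
    using bounded_bilinear_scaleR by (simp only: bilinear_conv_bounded_bilinear)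
  show "\<phi> \<in> borel_measurable (lebesgue_on {c..d})"
    using assms by (simp add: continuous_imp_measurable_on_sets_lebesgue)
  show "bounded (\<phi> ` {c..d})"
    using assms by (intro compact_imp_bounded compact_continuous_image) auto
qed (use assms in auto)

lemma supported_integral:
  fixes f :: "real \<Rightarrow> 'a::euclidean_space"
  assumes "\<And>y. y \<notin> {c..d} \<Longrightarrow> \<phi> y = 0" "-1 < c" "d < 1"
  shows "(LINT y:ivl|lebesgue. \<phi> y *\<^sub>R f y) = (LINT y:{c..d}|lebesgue. \<phi> y *\<^sub>R f y)"
    and "set_integrable lebesgue ivl (\<lambda>y. \<phi> y *\<^sub>R f y) \<longleftrightarrow>
      set_integrable lebesgue {c..d} (\<lambda>y. \<phi> y *\<^sub>R f y)"
proof -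
  have "(\<lambda>y. indicator ivl y *\<^sub>R \<phi> y *\<^sub>R f y) = (\<lambda>y. indicator {c..d} y *\<^sub>R \<phi> y *\<^sub>R f y)"
    using assms by (force simp: indicator_def)
  then show "(LINT y:ivl|lebesgue. \<phi> y *\<^sub>R f y) = (LINT y:{c..d}|lebesgue. \<phi> y *\<^sub>R f y)"
    "set_integrable lebesgue ivl (\<lambda>y. \<phi> y *\<^sub>R f y) \<longleftrightarrow>
      set_integrable lebesgue {c..d} (\<lambda>y. \<phi> y *\<^sub>R f y)"
    unfolding set_lebesgue_integral_def set_integrable_def by simp_all
qed

lemma test_function_times_L1_loc_integrable:
  assumes "test_function \<phi>" "L1_loc f"
  shows "set_integrable lebesgue ivl (\<lambda>y. \<phi> y *\<^sub>R f y)"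
proof -
  obtain c d where cd: "-1 < c" "d < 1" "\<And>y. y \<notin> {c<..<d} \<Longrightarrow> \<phi> y = 0" and \<phi>: "smooth \<phi>"
    using test_functionE[OF assms(1)] by metis
  have "set_integrable lebesgue {c..d} (\<lambda>y. \<phi> y *\<^sub>R f y)"
    by (intro continuous_scaleR_integrable smooth_continuous L1_loc_interval cd assms(2) \<phi>)
  then show ?thesis
    using supported_integral(2)[of c d \<phi> f] cd by force
qed

lemma deriv_eq_0_outside:
  fixes \<phi> :: "real \<Rightarrow> real"
  assumes "\<And>y. y \<notin> {c..d} \<Longrightarrow> \<phi> y = 0" "y \<notin> {c..d}"
  shows "deriv \<phi> y = 0"
proof -
  have "((\<lambda>_. 0) has_real_derivative 0) (at y)" by simp
  then have "(\<phi> has_real_derivative 0) (at y)"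
    by (rule has_field_derivative_transform_within_open[where S = "- {c..d}"]) (use assms in auto)
  then show ?thesis by (rule DERIV_imp_deriv)
qed

lemma test_function_deriv:
  assumes "test_function \<phi>"
  shows "test_function (deriv \<phi>)"
proof -
  obtain c d where cd: "-1 < c" "c < d" "d < 1" "\<And>y. y \<notin> {c<..<d} \<Longrightarrow> \<phi> y = 0" and \<phi>: "smooth \<phi>"
    using test_functionE[OF assms] by metis
  have "\<phi> y = 0" if "y \<notin> {c..d}" for y
    using cd(4)[of y] that by auto
  from deriv_eq_0_outside[OF this] show ?thesis
    using cd by (intro test_functionI[of _ c d] smooth_deriv[OF \<phi>]) auto
qed

text \<open>The indicator of an interval is the pointwise limit of test functions, namely
  differences of two steps of increasing steepness placed at \<open>\<alpha>\<close> and
  \<open>\<beta>\<close>. Dominated convergence passes the vanishing integrals to the limit.\<close>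

lemma integral_eq_0_if_test_integrals_eq_0:
  fixes f :: "real \<Rightarrow> 'a::euclidean_space"
  assumes f: "L1_loc f"
    and zero: "\<And>\<phi>. test_function \<phi> \<Longrightarrow> (LINT y:ivl|lebesgue. \<phi> y *\<^sub>R f y) = 0"
    and ab: "-1 < \<alpha>" "\<alpha> < \<beta>" "\<beta> < 1"
  shows "integral {\<alpha>..\<beta>} f = 0"
proof -
  obtain S where S: "smooth S" "\<And>x. x \<le> 0 \<Longrightarrow> S x = 0" "\<And>x. 1 \<le> x \<Longrightarrow> S x = 1"
    "\<And>x. 0 \<le> S x" "\<And>x. S x \<le> 1"
    using smooth_step_exists by blast
  define d where "d = (\<beta> + 1) / 2"
  have d: "\<beta> < d" "d < 1" using ab by (auto simp: d_def)
  \<comment> \<open>The offset makes even the least steep descending ramp finish before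
    \<open>d\<close>. All supports then lie in the one compact interval
    \<open>{\<alpha>..d}\<close>, which also supplies the dominating function.\<close>
  define N where "N i = 1 / (d - \<beta>) + real i" for i :: nat
  have N: "N i > 0" "N i * (d - \<beta>) \<ge> 1" for i
  proof -
    show "N i > 0" using d by (simp add: N_def add_pos_nonneg)
    have "N i * (d - \<beta>) = 1 + real i * (d - \<beta>)" using d by (simp add: N_def distrib_right)
    then show "N i * (d - \<beta>) \<ge> 1" using d by simp
  qed
  define \<phi> where "\<phi> i y = 1 * S (N i * y + - N i * \<alpha>) + (-1) * S (N i * y + - N i * \<beta>)" for i y
  have \<phi>_eq: "\<phi> i y = S (N i * (y - \<alpha>)) - S (N i * (y - \<beta>))" for i y
    by (simp add: \<phi>_def algebra_simps)
  have \<phi>_supp: "\<phi> i y = 0" if "y \<notin> {\<alpha>..d}" for i y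
  proof (cases "y < \<alpha>")
    case True
    then have "N i * (y - \<alpha>) \<le> 0" "N i * (y - \<beta>) \<le> 0"
      using N(1)[of i] ab by (auto simp: mult_le_0_iff)
    then show ?thesis by (simp add: \<phi>_eq S)
  next
    case False
    then have "d < y" using that by auto
    then have "N i * (d - \<beta>) \<le> N i * (y - \<beta>)" "N i * (y - \<beta>) \<le> N i * (y - \<alpha>)"
      using N(1)[of i] ab by (auto intro!: mult_left_mono)
    then have "1 \<le> N i * (y - \<beta>)" "1 \<le> N i * (y - \<alpha>)"
      using N(2)[of i] by linarith+
    then show ?thesis by (simp add: \<phi>_eq S)
  qed
  have \<phi>_abs: "\<bar>\<phi> i y\<bar> \<le> 1" for i y
    using S(4,5)[of "N i * (y - \<alpha>)"] S(4,5)[of "N i * (y - \<beta>)"] by (simp add: \<phi>_eq abs_le_iff)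
  have \<phi>_smooth: "smooth (\<phi> i)" for i
    unfolding \<phi>_def[abs_def] by (intro smooth_linear_combination smooth_affine S)
  have \<phi>_test: "test_function (\<phi> i)" for i
    using \<phi>_smooth ab(1) d(2) \<phi>_supp by (rule test_functionI)
  have eventually_1: "\<forall>\<^sub>F i in sequentially. S (N i * t) = 1" if "t > 0" for t
  proof -
    have "filterlim N at_top sequentially"
      unfolding N_def by (intro filterlim_tendsto_add_at_top[OF tendsto_const] filterlim_real_sequentially)
    then have "\<forall>\<^sub>F i in sequentially. 1 / t \<le> N i"
      by (simp add: filterlim_at_top)
    then show ?thesis
      by eventually_elim (use that S(3) in \<open>simp add: field_simps\<close>)
  qed
  \<comment> \<open>The interval is half-open because the step is \<open>0\<close> at
    \<open>0\<close>: at \<open>\<alpha>\<close> the rise has not begun, and at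
    \<open>\<beta>\<close> the descent has not.\<close>
  have lim: "(\<lambda>i. \<phi> i y) \<longlonglongrightarrow> indicator {\<alpha><..\<beta>} y" for y
  proof -
    consider "y \<le> \<alpha>" | "\<alpha> < y" "y \<le> \<beta>" | "\<beta> < y" by linarith
    then have "\<forall>\<^sub>F i in sequentially. \<phi> i y = indicator {\<alpha><..\<beta>} y"
    proof cases
      case 1
      then have "N i * (y - \<alpha>) \<le> 0" "N i * (y - \<beta>) \<le> 0" for i
        using N(1)[of i] ab by (auto simp: mult_le_0_iff)
      then show ?thesis using 1 by (simp add: \<phi>_eq S)
    next
      case 2
      then have "N i * (y - \<beta>) \<le> 0" for i
        using N(1)[of i] ab by (auto simp: mult_le_0_iff)
      then have "S (N i * (y - \<beta>)) = 0" for i by (rule S(2))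
      then show ?thesis
        using eventually_1[of "y - \<alpha>"] 2 by (simp add: \<phi>_eq)
    next
      case 3
      then have "y - \<alpha> > 0" "y - \<beta> > 0" using ab by auto
      from eventually_1[OF this(1)] eventually_1[OF this(2)] show ?thesis
        by eventually_elim (use 3 in \<open>simp add: \<phi>_eq\<close>)
    qed
    then show ?thesis by (rule tendsto_eventually)
  qed
  have int: "integrable lebesgue (\<lambda>y. indicator {\<alpha>..d} y *\<^sub>R f y)"
    using L1_loc_interval[OF f, of \<alpha> d] ab d by (simp add: set_integrable_def)
  have meas: "(\<lambda>y. indicator {\<alpha>..d} y *\<^sub>R f y) \<in> borel_measurable lebesgue"
    using int by (rule borel_measurable_integrable)
  have \<phi>_meas: "\<phi> i \<in> borel_measurable lebesgue" for i
    using borel_measurable_continuous_onI[OF smooth_continuous[OF \<phi>_smooth]]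
    by (simp add: measurable_completion)
  have "(\<lambda>i. LINT y|lebesgue. \<phi> i y *\<^sub>R indicator {\<alpha>..d} y *\<^sub>R f y)
      \<longlonglongrightarrow> (LINT y|lebesgue. indicator {\<alpha><..\<beta>} y *\<^sub>R indicator {\<alpha>..d} y *\<^sub>R f y)"
  proof (rule integral_dominated_convergence[where w = "\<lambda>y. norm (indicator {\<alpha>..d} y *\<^sub>R f y)"])
    show "AE y in lebesgue. (\<lambda>i. \<phi> i y *\<^sub>R indicator {\<alpha>..d} y *\<^sub>R f y)
        \<longlonglongrightarrow> indicator {\<alpha><..\<beta>} y *\<^sub>R indicator {\<alpha>..d} y *\<^sub>R f y"
      by (intro AE_I2 tendsto_scaleR lim tendsto_const)
    show "AE y in lebesgue. norm (\<phi> i y *\<^sub>R indicator {\<alpha>..d} y *\<^sub>R f y) \<le> norm (indicator {\<alpha>..d} y *\<^sub>R f y)" for i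
      using \<phi>_abs by (intro AE_I2) (subst norm_scaleR, rule mult_left_le_one_le, auto)
    show "(\<lambda>y. \<phi> i y *\<^sub>R indicator {\<alpha>..d} y *\<^sub>R f y) \<in> borel_measurable lebesgue" for i
      by (intro borel_measurable_scaleR \<phi>_meas meas)
    show "(\<lambda>y. indicator {\<alpha><..\<beta>} y *\<^sub>R indicator {\<alpha>..d} y *\<^sub>R f y) \<in> borel_measurable lebesgue"
      by (rule borel_measurable_scaleR[OF _ meas]) (auto intro!: borel_measurable_indicator)
    show "integrable lebesgue (\<lambda>y. norm (indicator {\<alpha>..d} y *\<^sub>R f y))"
      using int by (rule integrable_norm)
  qed
  moreover have "(LINT y|lebesgue. \<phi> i y *\<^sub>R indicator {\<alpha>..d} y *\<^sub>R f y) = 0" for i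
  proof -
    have "(LINT y|lebesgue. \<phi> i y *\<^sub>R indicator {\<alpha>..d} y *\<^sub>R f y) = (LINT y:{\<alpha>..d}|lebesgue. \<phi> i y *\<^sub>R f y)"
      unfolding set_lebesgue_integral_def by (simp add: mult.commute)
    also have "\<dots> = (LINT y:ivl|lebesgue. \<phi> i y *\<^sub>R f y)"
      using supported_integral(1)[of \<alpha> d "\<phi> i" f, OF \<phi>_supp] ab d by simp
    finally show ?thesis using zero[OF \<phi>_test] by simp
  qed
  ultimately have "(LINT y|lebesgue. indicator {\<alpha><..\<beta>} y *\<^sub>R indicator {\<alpha>..d} y *\<^sub>R f y) = 0"
    by (simp add: LIMSEQ_const_iff)
  moreover have "(\<lambda>y. indicator {\<alpha><..\<beta>} y *\<^sub>R indicator {\<alpha>..d} y *\<^sub>R f y) = (\<lambda>y. indicator {\<alpha><..\<beta>} y *\<^sub>R f y)"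
    using d by (auto simp: indicator_def fun_eq_iff)
  ultimately have "(LINT y:{\<alpha><..\<beta>}|lebesgue. f y) = 0"
    unfolding set_lebesgue_integral_def by simp
  moreover have "set_integrable lebesgue {\<alpha><..\<beta>} f"
    using L1_loc_interval[OF f, of \<alpha> \<beta>] ab by (rule_tac set_integrable_subset) auto
  ultimately have "integral {\<alpha><..\<beta>} f = 0"
    by (simp add: set_lebesgue_integral_eq_integral)
  moreover have "integral {\<alpha><..\<beta>} f = integral {\<alpha>..\<beta>} f"
    by (rule integral_subset_negligible) (auto intro: negligible_subset[of "{\<alpha>}"])
  ultimately show ?thesis by simp
qed

text \<open>All averages of \<open>f\<close> over small intervals vanish, so \<open>f\<close>
  vanishes at almost every point by Lebesgue differentiation. Since \<open>f\<close> is only locally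
  integrable, this is done on each interval of an exhaustion, and the exceptional sets are
  united.\<close>

lemma fundamental_lemma:
  fixes f :: "real \<Rightarrow> 'a::euclidean_space"
  assumes f: "L1_loc f"
    and zero: "\<And>\<phi>. test_function \<phi> \<Longrightarrow> (LINT y:ivl|lebesgue. \<phi> y *\<^sub>R f y) = 0"
  shows "AE y in lebesgue_on ivl. f y = 0"
proof -
  define r where "r k = 1 - 1 / (real k + 2)" for k :: nat
  have r: "0 < r k" "r k < 1" for k by (auto simp: r_def field_simps)
  have "\<exists>N. negligible N \<and> (\<forall>x\<in>{- r k<..<r k} - N. f x = 0)" for k
  proof -
    \<comment> \<open>The differentiation theorem asks for integrability over every bounded box,
      hence the extension by zero.\<close>
    define fk where "fk y = (if y \<in> {- r k..r k} then f y else 0)" for y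
    have "f integrable_on {- r k..r k}"
      using L1_loc_interval[OF f, of "- r k" "r k"] r[of k] by (simp add: set_lebesgue_integral_eq_integral(1))
    then have "fk integrable_on UNIV"
      unfolding fk_def[abs_def] by (simp only: integrable_restrict_UNIV)
    then have "fk integrable_on cbox c d" for c d
      by (rule integrable_on_subcbox) simp
    then obtain N where N: "negligible N" and lim: "\<And>x e. x \<notin> N \<Longrightarrow> 0 < e \<Longrightarrow>
        \<exists>d>0. \<forall>h. 0 < h \<and> h < d \<longrightarrow> norm (integral (cbox x (x + h *\<^sub>R One)) fk /\<^sub>R h ^ DIM(real) - fk x) < e"
      using integrable_ccontinuous_explicit[of fk] by blast
    have "f x = 0" if x: "x \<in> {- r k<..<r k} - N" for x
    proof (rule ccontr)
      assume "f x \<noteq> 0"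
      then obtain d where d: "d > 0" "\<And>h. 0 < h \<Longrightarrow> h < d \<Longrightarrow>
          norm (integral (cbox x (x + h *\<^sub>R One)) fk /\<^sub>R h ^ DIM(real) - fk x) < norm (f x)"
        using lim[of x "norm (f x)"] x by auto
      \<comment> \<open>Small enough for the differentiation estimate and for
        \<open>{x..x + h}\<close> to stay where \<open>fk\<close> coincides with
        \<open>f\<close>.\<close>
      define h where "h = min d (r k - x) / 2"
      have h: "0 < h" "h < d" "x + h < r k" using d x by (auto simp: h_def min_def field_simps)
      have "integral {x..x + h} fk = integral {x..x + h} f"
        using x h by (intro integral_cong) (auto simp: fk_def)
      also have "\<dots> = 0"
        using x h r[of k] by (intro integral_eq_0_if_test_integrals_eq_0[OF f zero]) auto
      finally have "integral {x..x + h} fk = 0" .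
      then show False using d(2)[OF h(1,2)] x by (simp add: fk_def)
    qed
    then show ?thesis using N by blast
  qed
  then obtain N where N: "\<And>k. negligible (N k)" "\<And>k x. x \<in> {- r k<..<r k} - N k \<Longrightarrow> f x = 0"
    by metis
  have "negligible (\<Union>k. N k)"
    using N(1) by (intro negligible_countable_Union) auto
  moreover have "f x = 0" if x: "x \<in> ivl" "x \<notin> (\<Union>k. N k)" for x
  proof -
    obtain k :: nat where k: "1 / (1 - \<bar>x\<bar>) < real k" using reals_Archimedean2 by blast
    have "0 < 1 - \<bar>x\<bar>" using x by auto
    moreover have "1 / (1 - \<bar>x\<bar>) < real k + 2" using k by simp
    ultimately have "1 / (real k + 2) < 1 - \<bar>x\<bar>" by (simp add: field_simps)
    then have "\<bar>x\<bar> < r k" by (simp add: r_def)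
    then have "x \<in> {- r k<..<r k} - N k" using x by auto
    then show ?thesis by (rule N(2))
  qed
  ultimately have "AE x in lebesgue. x \<in> ivl \<longrightarrow> f x = 0"
    by (intro AE_I'[of "\<Union>k. N k"]) (auto simp: negligible_iff_null_sets)
  then show ?thesis
    by (simp add: AE_restrict_space_iff)
qed

section \<open>Integration by parts and primitives of locally integrable functions\<close>

lemma sigma_finite_lebesgue: "sigma_finite_measure (lebesgue :: 'a::euclidean_space measure)"
proof
  obtain A :: "'a set set" where A: "countable A" "A \<subseteq> sets lborel" "\<Union>A = space lborel"
    "\<forall>a\<in>A. emeasure lborel a \<noteq> \<infinity>"
    using lborel.sigma_finite_countable by blast
  then show "\<exists>A::'a set set. countable A \<and> A \<subseteq> sets lebesgue \<and> \<Union>A = space lebesgue \<and>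
      (\<forall>a\<in>A. emeasure lebesgue a \<noteq> \<infinity>)"
    by (intro exI[of _ A]) (auto simp: subset_iff)
qed

text \<open>Fubini's theorem on the triangle \<open>c \<le> s \<le> y \<le> d\<close>, since \<open>g\<close> is merely integrable.\<close>

lemma integral_deriv_scaleR_indefinite_integral:
  fixes g :: "real \<Rightarrow> 'a::euclidean_space"
  assumes g: "set_integrable lebesgue {c..d} g"
    and \<phi>: "\<And>y. (\<phi> has_real_derivative \<phi>' y) (at y)" and \<phi>': "continuous_on UNIV \<phi>'"
  shows "integral {c..d} (\<lambda>y. \<phi>' y *\<^sub>R integral {c..y} g)
    = \<phi> d *\<^sub>R integral {c..d} g - integral {c..d} (\<lambda>y. \<phi> y *\<^sub>R g y)"
proof -
  interpret sigma_finite_measure "lebesgue :: real measure" by (rule sigma_finite_lebesgue)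
  interpret L: pair_sigma_finite "lebesgue :: real measure" "lebesgue :: real measure" ..
  have \<phi>_cont: "continuous_on S \<phi>" for S
    using \<phi> by (meson DERIV_isCont continuous_at_imp_continuous_on)
  define \<psi> where "\<psi> y = indicator {c..d} y * \<phi>' y" for y
  define \<gamma> where "\<gamma> s = indicator {c..d} s *\<^sub>R g s" for s
  have "set_integrable lebesgue {a..b} \<phi>'" for a b
    using continuous_on_subset[OF \<phi>'] by (intro absolutely_integrable_continuous_real) auto
  then have \<phi>'_int: "integrable lebesgue (\<lambda>y. indicator {a..b} y * \<phi>' y)" for a b
    by (simp add: set_integrable_def)
  then have \<psi>_int: "integrable lebesgue \<psi>" unfolding \<psi>_def .
  have \<gamma>_int: "integrable lebesgue \<gamma>"
    using g unfolding \<gamma>_def set_integrable_def .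
  have [measurable]: "\<psi> \<in> borel_measurable lebesgue" "\<gamma> \<in> borel_measurable lebesgue"
    using \<psi>_int \<gamma>_int by auto
  have [measurable]: "(\<lambda>y::real. y) \<in> borel_measurable lebesgue"
    by (simp add: measurable_completion)
  have prod_int: "integrable (lebesgue \<Otimes>\<^sub>M lebesgue) (\<lambda>(y, s). \<psi> y *\<^sub>R \<gamma> s)"
  proof (rule L.Fubini_integrable)
    show "(\<lambda>(y, s). \<psi> y *\<^sub>R \<gamma> s) \<in> borel_measurable (lebesgue \<Otimes>\<^sub>M lebesgue)"
      by measurable
    show "integrable lebesgue (\<lambda>y. \<integral>s. norm (case (y, s) of (y, s) \<Rightarrow> \<psi> y *\<^sub>R \<gamma> s) \<partial>lebesgue)"
      using \<psi>_int by simp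
    show "AE y in lebesgue. integrable lebesgue (\<lambda>s. case (y, s) of (y, s) \<Rightarrow> \<psi> y *\<^sub>R \<gamma> s)"
      using \<gamma>_int by simp
  qed
  \<comment> \<open>The integrand restricted to the triangle, dominated by the product on the
    square. Integrating out \<open>y\<close> produces \<open>\<phi> d - \<phi> s\<close>;
    integrating out \<open>s\<close> produces the indefinite integral of \<open>g\<close>.\<close>
  define F where "F y s = (\<psi> y * (if s \<le> y then 1 else 0)) *\<^sub>R \<gamma> s" for y s
  have F_int: "integrable (lebesgue \<Otimes>\<^sub>M lebesgue) (case_prod F)"
  proof (rule Bochner_Integration.integrable_bound[OF prod_int])
    show "case_prod F \<in> borel_measurable (lebesgue \<Otimes>\<^sub>M lebesgue)"
      unfolding F_def by measurable
    show "AE x in lebesgue \<Otimes>\<^sub>M lebesgue. norm (case_prod F x) \<le> norm (case x of (y, s) \<Rightarrow> \<psi> y *\<^sub>R \<gamma> s)"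
      by (intro AE_I2) (auto simp: F_def)
  qed
  have inner_y: "(\<integral>y. F y s \<partial>lebesgue) = indicator {c..d} s *\<^sub>R (\<phi> d - \<phi> s) *\<^sub>R g s" for s
  proof (cases "s \<in> {c..d}")
    case True
    have "(\<integral>y. F y s \<partial>lebesgue) = (\<integral>y. (indicator {s..d} y * \<phi>' y) *\<^sub>R \<gamma> s \<partial>lebesgue)"
      using True by (intro Bochner_Integration.integral_cong) (auto simp: F_def \<psi>_def indicator_def)
    also have "\<dots> = (\<integral>y. indicator {s..d} y * \<phi>' y \<partial>lebesgue) *\<^sub>R \<gamma> s"
      using \<phi>'_int by simp
    also have "(\<integral>y. indicator {s..d} y * \<phi>' y \<partial>lebesgue) = integral {s..d} \<phi>'"
      using set_lebesgue_integral_eq_integral(2)[of "{s..d}" \<phi>'] \<phi>'_int[of s d]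
      by (simp add: set_integrable_def set_lebesgue_integral_def)
    also have "\<dots> = \<phi> d - \<phi> s"
      using True \<phi> by (intro integral_unique fundamental_theorem_of_calculus)
        (auto simp: has_real_derivative_iff_has_vector_derivative intro: has_vector_derivative_at_within)
    finally show ?thesis using True by (simp add: \<gamma>_def)
  next
    case False
    then show ?thesis by (simp add: F_def \<gamma>_def)
  qed
  have inner_s: "(\<integral>s. F y s \<partial>lebesgue) = indicator {c..d} y *\<^sub>R \<phi>' y *\<^sub>R integral {c..y} g" for y
  proof (cases "y \<in> {c..d}")
    case True
    have g_sub: "set_integrable lebesgue {c..y} g"
      using g True by (rule_tac set_integrable_subset) auto
    have "(\<integral>s. F y s \<partial>lebesgue) = (\<integral>s. \<phi>' y *\<^sub>R (indicator {c..y} s *\<^sub>R g s) \<partial>lebesgue)"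
      using True by (intro Bochner_Integration.integral_cong) (auto simp: F_def \<psi>_def \<gamma>_def indicator_def)
    also have "\<dots> = \<phi>' y *\<^sub>R (LINT s:{c..y}|lebesgue. g s)"
      unfolding set_lebesgue_integral_def by (rule integral_scaleR_right)
    finally show ?thesis
      using True set_lebesgue_integral_eq_integral(2)[OF g_sub] by simp
  next
    case False
    then show ?thesis by (simp add: F_def \<psi>_def)
  qed
  have "(\<integral>s. indicator {c..d} s *\<^sub>R (\<phi> d - \<phi> s) *\<^sub>R g s \<partial>lebesgue)
      = (\<integral>y. indicator {c..d} y *\<^sub>R \<phi>' y *\<^sub>R integral {c..y} g \<partial>lebesgue)"
    using L.Fubini_integral[OF F_int] unfolding inner_y inner_s .
  moreover have "set_integrable lebesgue {c..d} (\<lambda>s. (\<phi> d - \<phi> s) *\<^sub>R g s)"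
    by (intro continuous_scaleR_integrable g continuous_intros \<phi>_cont)
  moreover have "set_integrable lebesgue {c..d} (\<lambda>y. \<phi>' y *\<^sub>R integral {c..y} g)"
    using set_lebesgue_integral_eq_integral(1)[OF g]
    by (intro absolutely_integrable_continuous_real continuous_intros indefinite_integral_continuous_1
        continuous_on_subset[OF \<phi>']) auto
  ultimately have "integral {c..d} (\<lambda>y. \<phi>' y *\<^sub>R integral {c..y} g)
      = integral {c..d} (\<lambda>s. (\<phi> d - \<phi> s) *\<^sub>R g s)"
    by (simp add: set_lebesgue_integral_eq_integral(2)[symmetric] set_lebesgue_integral_def)
  also have "\<dots> = integral {c..d} (\<lambda>s. \<phi> d *\<^sub>R g s - \<phi> s *\<^sub>R g s)"
    by (simp add: scaleR_left_diff_distrib)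
  also have "\<dots> = \<phi> d *\<^sub>R integral {c..d} g - integral {c..d} (\<lambda>y. \<phi> y *\<^sub>R g y)"
    using set_lebesgue_integral_eq_integral(1)[OF g]
      set_lebesgue_integral_eq_integral(1)[OF continuous_scaleR_integrable[OF \<phi>_cont g]]
    by (simp add: Henstock_Kurzweil_Integration.integral_diff integrable_cmul)
  finally show ?thesis .
qed

text \<open>The oriented integral from \<open>0\<close>. An interior base point is required because
  \<open>g\<close> need not be integrable up to the ends of the interval.\<close>

definition primitive :: "(real \<Rightarrow> 'a::euclidean_space) \<Rightarrow> real \<Rightarrow> 'a"
  where "primitive g y = (if 0 \<le> y then integral {0..y} g else - integral {y..0} g)"

lemma primitive_diff:
  assumes g: "\<And>c d. -1 < c \<Longrightarrow> d < 1 \<Longrightarrow> g integrable_on {c..d}"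
    and "-1 < x" "x \<le> y" "y < 1"
  shows "primitive g y = primitive g x + integral {x..y} g"
proof -
  note combine = Henstock_Kurzweil_Integration.integral_combine[where f = g]
  consider "0 \<le> x" | "x < 0" "0 \<le> y" | "y < 0" by linarith
  then show ?thesis
  proof cases
    case 1
    then show ?thesis using combine[of 0 x y] g[of 0 y] assms by (simp add: primitive_def)
  next
    case 2
    then show ?thesis using combine[of x 0 y] g[of x y] assms
      by (simp add: primitive_def algebra_simps)
  next
    case 3
    then show ?thesis using combine[of x y 0] g[of x 0] assms by (simp add: primitive_def algebra_simps)
  qed
qed

lemma L1_loc_integrable_on:
  assumes "L1_loc g" "-1 < c" "d < 1"
  shows "g integrable_on {c..d}"
  using set_lebesgue_integral_eq_integral(1)[OF L1_loc_interval[OF assms]] .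

lemma continuous_on_primitive:
  assumes "L1_loc g"
  shows "continuous_on ivl (primitive g)"
proof (rule continuous_at_imp_continuous_on, intro ballI)
  fix x assume x: "x \<in> ivl"
  define c where "c = (x - 1) / 2"
  define d where "d = (x + 1) / 2"
  have cd: "-1 < c" "c < x" "x < d" "d < 1" using x by (auto simp: c_def d_def)
  have "continuous_on {c..d} (\<lambda>y. primitive g c + integral {c..y} g)"
    using cd by (intro continuous_intros indefinite_integral_continuous_1 L1_loc_integrable_on[OF assms]) auto
  moreover have "primitive g c + integral {c..y} g = primitive g y" if "y \<in> {c..d}" for y
    using that cd by (intro primitive_diff[symmetric] L1_loc_integrable_on[OF assms]) auto
  ultimately have "continuous_on {c..d} (primitive g)"
    by (rule continuous_on_eq)
  then show "isCont (primitive g) x"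
    using cd by (intro continuous_on_interior[of "{c..d}"]) auto
qed

lemma primitive_has_vector_derivative:
  fixes g :: "real \<Rightarrow> 'a::euclidean_space"
  assumes g: "continuous_on ivl g" and x: "x \<in> ivl"
  shows "(primitive g has_vector_derivative g x) (at x)"
proof -
  define c where "c = (x - 1) / 2"
  define d where "d = (x + 1) / 2"
  have cd: "-1 < c" "c < x" "x < d" "d < 1" using x by (auto simp: c_def d_def)
  have cont: "continuous_on {a..b} g" if "-1 < a" "b < 1" for a b
    using that by (intro continuous_on_subset[OF g]) auto
  have "((\<lambda>y. integral {c..y} g) has_vector_derivative g x) (at x within {c..d})"
    using cd by (intro integral_has_vector_derivative cont) auto
  then have "((\<lambda>y. primitive g c + integral {c..y} g) has_vector_derivative g x) (at x within {c..d})"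
    by (auto intro!: derivative_eq_intros)
  then have "(primitive g has_vector_derivative g x) (at x within {c..d})"
  proof (rule has_vector_derivative_transform[rotated -1])
    show "primitive g y = primitive g c + integral {c..y} g" if "y \<in> {c..d}" for y
      using that cd by (intro primitive_diff integrable_continuous_real cont) auto
  qed (use cd in auto)
  moreover have "at x within {c..d} = at x"
    using cd by (intro at_within_interior) auto
  ultimately show ?thesis by simp
qed

text \<open>Allows a weak derivative to be replaced by a continuous representative under the
  primitive; this is how classical differentiability is gained.\<close>

lemma primitive_cong_AE:
  assumes "AE y in lebesgue_on ivl. f y = g y" "x \<in> ivl"
  shows "primitive f x = primitive g x"
proof -
  have "AE y in lebesgue. y \<in> ivl \<longrightarrow> f y = g y"
    using assms(1) by (simp add: AE_restrict_space_iff)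
  then obtain N where N: "N \<in> null_sets lebesgue" "{y. \<not> (y \<in> ivl \<longrightarrow> f y = g y)} \<subseteq> N"
    by (auto simp: eventually_ae_filter)
  then have neg: "negligible N" by (simp add: negligible_iff_null_sets)
  have "integral {c..d} f = integral {c..d} g" if "-1 < c" "d < 1" for c d
  proof (rule integral_spike[OF neg])
    fix y assume "y \<in> {c..d} - N"
    then have "y \<in> ivl" "y \<notin> N" using that by auto
    then show "g y = f y" using N(2) by auto
  qed
  then show ?thesis using assms(2) by (simp add: primitive_def)
qed

lemma continuous_imp_L1_loc:
  fixes f :: "real \<Rightarrow> 'a::euclidean_space"
  assumes "continuous_on ivl f"
  shows "L1_loc f"
  unfolding L1_loc_def
proof (intro allI impI)
  fix K assume K: "compact K \<and> K \<subseteq> ivl"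
  then obtain c d where cd: "-1 < c" "c < d" "d < 1" "K \<subseteq> {c<..<d}"
    using compact_subset_ivl by metis
  have "set_integrable lebesgue {c..d} f"
    using cd by (intro absolutely_integrable_continuous_real continuous_on_subset[OF assms]) auto
  then show "set_integrable lebesgue K f"
  proof (rule set_integrable_subset)
    show "K \<in> sets lebesgue" using K by (simp add: lmeasurable_compact fmeasurableD)
    show "K \<subseteq> {c..d}" using cd(4) by force
  qed
qed

text \<open>Translates the Lebesgue integrals in the definition of weak derivatives into gauge
  integrals over a compact interval, for which the fundamental theorem of calculus is
  available.\<close>

lemma test_function_integral:
  fixes f :: "real \<Rightarrow> 'a::euclidean_space"
  assumes "-1 < c" "d < 1" "\<And>y. y \<notin> {c..d} \<Longrightarrow> \<phi> y = 0" "smooth \<phi>" "L1_loc f"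
  shows "(LINT y:ivl|lebesgue. \<phi> y *\<^sub>R f y) = integral {c..d} (\<lambda>y. \<phi> y *\<^sub>R f y)"
    and "(\<lambda>y. \<phi> y *\<^sub>R f y) integrable_on {c..d}"
proof -
  have int: "set_integrable lebesgue {c..d} (\<lambda>y. \<phi> y *\<^sub>R f y)"
    by (intro continuous_scaleR_integrable smooth_continuous L1_loc_interval assms)
  show "(LINT y:ivl|lebesgue. \<phi> y *\<^sub>R f y) = integral {c..d} (\<lambda>y. \<phi> y *\<^sub>R f y)"
    using supported_integral(1)[of c d \<phi> f] assms set_lebesgue_integral_eq_integral(2)[OF int] by simp
  show "(\<lambda>y. \<phi> y *\<^sub>R f y) integrable_on {c..d}"
    using set_lebesgue_integral_eq_integral(1)[OF int] .
qed

lemma C1_has_weak_deriv: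
  fixes f :: "real \<Rightarrow> 'a::euclidean_space"
  assumes f: "\<And>y. y \<in> ivl \<Longrightarrow> (f has_vector_derivative f' y) (at y)" and f': "continuous_on ivl f'"
  shows "has_weak_deriv f f'"
  unfolding has_weak_deriv_def
proof (intro conjI allI impI)
  have "continuous_on ivl f"
    using f by (intro continuous_at_imp_continuous_on ballI has_vector_derivative_continuous) auto
  then show L1: "L1_loc f" "L1_loc f'"
    using f' by (auto intro: continuous_imp_L1_loc)
  fix \<phi> assume "test_function \<phi>"
  then obtain c d where cd: "-1 < c" "c < d" "d < 1" "\<And>y. y \<notin> {c<..<d} \<Longrightarrow> \<phi> y = 0" and \<phi>: "smooth \<phi>"
    using test_functionE by metis
  have \<phi>_supp: "\<phi> y = 0" if "y \<notin> {c..d}" for y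
    using cd(4)[of y] that by auto
  note I1 = test_function_integral[OF cd(1,3) deriv_eq_0_outside[OF \<phi>_supp] smooth_deriv[OF \<phi>] L1(1)]
  note I2 = test_function_integral[OF cd(1,3) \<phi>_supp \<phi> L1(2)]
  have "((\<lambda>y. \<phi> y *\<^sub>R f' y + deriv \<phi> y *\<^sub>R f y) has_integral \<phi> d *\<^sub>R f d - \<phi> c *\<^sub>R f c) {c..d}"
  proof (rule fundamental_theorem_of_calculus)
    fix y assume "y \<in> {c..d}"
    then have "y \<in> ivl" using cd by auto
    then show "((\<lambda>y. \<phi> y *\<^sub>R f y) has_vector_derivative \<phi> y *\<^sub>R f' y + deriv \<phi> y *\<^sub>R f y) (at y within {c..d})"
      using smooth_has_deriv[OF \<phi>] f
      by (intro has_vector_derivative_at_within[OF has_vector_derivative_scaleR])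
  qed (use cd in auto)
  then have "integral {c..d} (\<lambda>y. \<phi> y *\<^sub>R f' y + deriv \<phi> y *\<^sub>R f y) = 0"
    using cd(4)[of c] cd(4)[of d] by (simp add: integral_unique)
  then show "(LINT y:ivl|lebesgue. deriv \<phi> y *\<^sub>R f y) = - (LINT y:ivl|lebesgue. \<phi> y *\<^sub>R f' y)"
    using I1 I2 by (simp add: Henstock_Kurzweil_Integration.integral_add eq_neg_iff_add_eq_0 add.commute)
qed

lemma L1_loc_diff:
  assumes "L1_loc f" "L1_loc g"
  shows "L1_loc (\<lambda>y. f y - g y)"
  using assms unfolding L1_loc_def by (auto intro: set_integral_diff)

text \<open>On the support of \<open>\<phi>\<close> the primitive is a constant plus the integral
  from \<open>c\<close>. The constant is annihilated because \<open>deriv \<phi>\<close> has mean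
  zero, and the rest is the integration by parts obtained from Fubini's theorem.\<close>

lemma primitive_has_weak_deriv:
  fixes g :: "real \<Rightarrow> 'a::euclidean_space"
  assumes g: "L1_loc g"
  shows "has_weak_deriv (primitive g) g"
  unfolding has_weak_deriv_def
proof (intro conjI allI impI g)
  show L1: "L1_loc (primitive g)"
    by (intro continuous_imp_L1_loc continuous_on_primitive g)
  fix \<phi> assume "test_function \<phi>"
  then obtain c d where cd: "-1 < c" "c < d" "d < 1" "\<And>y. y \<notin> {c<..<d} \<Longrightarrow> \<phi> y = 0" and \<phi>: "smooth \<phi>"
    using test_functionE by metis
  have \<phi>_supp: "\<phi> y = 0" if "y \<notin> {c..d}" for y
    using cd(4)[of y] that by auto
  have \<phi>_ends: "\<phi> c = 0" "\<phi> d = 0" using cd(4) by auto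
  note I1 = test_function_integral[OF cd(1,3) deriv_eq_0_outside[OF \<phi>_supp] smooth_deriv[OF \<phi>] L1]
  note I2 = test_function_integral[OF cd(1,3) \<phi>_supp \<phi> g]
  have prim: "primitive g y = primitive g c + integral {c..y} g" if "y \<in> {c..d}" for y
    using that cd by (intro primitive_diff L1_loc_integrable_on[OF g]) auto
  have deriv_int: "(deriv \<phi> has_integral \<phi> d - \<phi> c) {c..d}"
    using cd smooth_has_deriv[OF \<phi>] by (intro fundamental_theorem_of_calculus)
      (auto simp: has_real_derivative_iff_has_vector_derivative intro: has_vector_derivative_at_within)
  have const: "((\<lambda>y. deriv \<phi> y *\<^sub>R primitive g c) has_integral 0) {c..d}"
    using has_integral_scaleR_left[OF deriv_int, of "primitive g c"] by (simp add: \<phi>_ends)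
  have cont: "(\<lambda>y. deriv \<phi> y *\<^sub>R integral {c..y} g) integrable_on {c..d}"
    using cd by (intro integrable_continuous_real continuous_intros smooth_continuous smooth_deriv \<phi>
        indefinite_integral_continuous_1 L1_loc_integrable_on[OF g])
  have "integral {c..d} (\<lambda>y. deriv \<phi> y *\<^sub>R primitive g y)
      = integral {c..d} (\<lambda>y. deriv \<phi> y *\<^sub>R primitive g c + deriv \<phi> y *\<^sub>R integral {c..y} g)"
  proof (rule integral_cong)
    fix y assume y: "y \<in> {c..d}"
    show "deriv \<phi> y *\<^sub>R primitive g y = deriv \<phi> y *\<^sub>R primitive g c + deriv \<phi> y *\<^sub>R integral {c..y} g"
      unfolding prim[OF y] by (rule scaleR_add_right)
  qed
  also have "\<dots> = integral {c..d} (\<lambda>y. deriv \<phi> y *\<^sub>R integral {c..y} g)"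
    using const cont by (simp add: Henstock_Kurzweil_Integration.integral_add has_integral_integrable integral_unique)
  also have "\<dots> = - integral {c..d} (\<lambda>y. \<phi> y *\<^sub>R g y)"
    using integral_deriv_scaleR_indefinite_integral[OF L1_loc_interval[OF g cd(1,3)] smooth_has_deriv[OF \<phi>]
        smooth_continuous[OF smooth_deriv[OF \<phi>]]]
    by (simp add: \<phi>_ends)
  finally show "(LINT y:ivl|lebesgue. deriv \<phi> y *\<^sub>R primitive g y) = - (LINT y:ivl|lebesgue. \<phi> y *\<^sub>R g y)"
    using I1 I2 by simp
qed

section \<open>Uniqueness of weak derivatives and recovery of a function from its weak
  derivative\<close>

lemma weak_deriv_unique:
  fixes w :: "real \<Rightarrow> 'a::euclidean_space"
  assumes "has_weak_deriv w g" "has_weak_deriv w h"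
  shows "AE y in lebesgue_on ivl. g y = h y"
proof -
  have L1: "L1_loc g" "L1_loc h" using assms unfolding has_weak_deriv_def by auto
  have "AE y in lebesgue_on ivl. g y - h y = 0"
  proof (rule fundamental_lemma)
    show "L1_loc (\<lambda>y. g y - h y)" by (intro L1_loc_diff L1)
    fix \<phi> assume \<phi>: "test_function \<phi>"
    have "(LINT y:ivl|lebesgue. deriv \<phi> y *\<^sub>R w y) = - (LINT y:ivl|lebesgue. \<phi> y *\<^sub>R g y)"
      "(LINT y:ivl|lebesgue. deriv \<phi> y *\<^sub>R w y) = - (LINT y:ivl|lebesgue. \<phi> y *\<^sub>R h y)"
      using assms \<phi> unfolding has_weak_deriv_def by blast+
    then show "(LINT y:ivl|lebesgue. \<phi> y *\<^sub>R (g y - h y)) = 0"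
      using test_function_times_L1_loc_integrable[OF \<phi> L1(1)] test_function_times_L1_loc_integrable[OF \<phi> L1(2)]
      by (simp add: scaleR_diff_right)
  qed
  then show ?thesis by simp
qed

text \<open>The operator \<open>weak_deriv\<close> merely picks some weak derivative; under an
  integral it may now be replaced by any explicit one.\<close>

lemma weak_deriv_AE_eq:
  assumes "has_weak_deriv w g"
  shows "AE y in lebesgue_on ivl. weak_deriv w y = g y"
  using weak_deriv_unique[OF _ assms] someI[of "has_weak_deriv w", OF assms]
  unfolding weak_deriv_def by blast

text \<open>A test function of mean zero has a compactly supported antiderivative. Subtracting the
  right multiple of a fixed function of mass one makes the mean of any \<open>\<phi>\<close>
  vanish.\<close>

lemma test_function_minus_multiple_eq_deriv:
  obtains \<theta> where "test_function \<theta>"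
    "\<And>\<phi>. test_function \<phi> \<Longrightarrow> \<exists>\<psi>. test_function \<psi> \<and>
      deriv \<psi> = (\<lambda>y. \<phi> y - (LINT y:ivl|lebesgue. \<phi> y) * \<theta> y)"
proof -
  obtain S where S: "smooth S" "\<And>x. x \<le> 0 \<Longrightarrow> S x = 0" "\<And>x. 1 \<le> x \<Longrightarrow> S x = 1"
    "\<And>x. 0 \<le> S x" "\<And>x. S x \<le> 1"
    using smooth_step_exists by blast
  \<comment> \<open>Compressed so that the step rises between \<open>0\<close> and
    \<open>1/2\<close>; its derivative then has compact support in the interval and total mass
    one.\<close>
  define \<sigma> where "\<sigma> y = S (2 * y + 0)" for y
  have \<sigma>: "smooth \<sigma>" unfolding \<sigma>_def by (intro smooth_affine S)
  have \<sigma>_vals: "\<sigma> y = 0" "1/2 \<le> z \<Longrightarrow> \<sigma> z = 1" if "y \<le> 0" for y z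
    using that S by (auto simp: \<sigma>_def)
  show ?thesis
  proof (rule that[of "deriv \<sigma>"])
    have "(\<sigma> has_real_derivative 0) (at y)" if "y \<notin> {0..1/2}" for y
    proof (cases "y < 0")
      case True
      show ?thesis
        by (rule has_field_derivative_transform_within_open[where S = "{..<0}" and f = "\<lambda>_. 0"])
          (use True \<sigma>_vals in auto)
    next
      case False
      show ?thesis
        by (rule has_field_derivative_transform_within_open[where S = "{1/2<..}" and f = "\<lambda>_. 1"])
          (use False that \<sigma>_vals(2)[of 0] in auto)
    qed
    then show "test_function (deriv \<sigma>)"
      using DERIV_imp_deriv by (intro test_functionI[of _ 0 "1/2"] smooth_deriv \<sigma>) auto
    fix \<phi> assume "test_function \<phi>"
    then obtain c d where cd: "-1 < c" "c < d" "d < 1" "\<And>y. y \<notin> {c<..<d} \<Longrightarrow> \<phi> y = 0" and \<phi>: "smooth \<phi>"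
      using test_functionE by metis
    obtain F where F: "\<And>x. (F has_real_derivative \<phi> x) (at x)"
      using antiderivative_exists smooth_continuous[OF \<phi>] by blast
    define m where "m = F d - F c"
    \<comment> \<open>Far to the left all terms cancel; far to the right \<open>F\<close> has gained
      exactly \<open>m\<close>, which \<open>m * \<sigma> y\<close> removes.\<close>
    define \<psi> where "\<psi> y = F y - F c - m * \<sigma> y" for y
    have \<psi>_deriv: "(\<psi> has_real_derivative \<phi> y - m * deriv \<sigma> y) (at y)" for y
      unfolding \<psi>_def[abs_def]
      by (rule derivative_eq_intros F smooth_has_deriv[OF \<sigma>] refl)+ simp
    have F_const: "F x = F y" if "x \<le> y" "\<And>z. x \<le> z \<Longrightarrow> z \<le> y \<Longrightarrow> \<phi> z = 0" for x y
      using F that(2)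
      by (intro antisym DERIV_nonpos_imp_nonincreasing[OF that(1)] DERIV_nonneg_imp_nondecreasing[OF that(1)])
        (metis order_refl)+
    have "test_function \<psi>"
    proof (rule test_functionI[of _ "min c 0" "max d (1/2)"])
      have "smooth (\<lambda>y. 1 * \<phi> y + (- m) * deriv \<sigma> y)"
        by (intro smooth_linear_combination \<phi> smooth_deriv \<sigma>)
      then show "smooth \<psi>"
        using \<psi>_deriv by (auto intro: smooth_antiderivative)
      show "\<psi> y = 0" if "y \<notin> {min c 0..max d (1/2)}" for y
      proof (cases "y < min c 0")
        case True
        then have "F y = F c" using cd by (intro F_const) auto
        then show ?thesis using True \<sigma>_vals(1)[of y] by (simp add: \<psi>_def)
      next
        case False
        then have "y > d" "y > 1/2" using that by auto
        then have "F d = F y" using cd by (intro F_const) auto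
        then show ?thesis using \<open>y > 1/2\<close> \<sigma>_vals(2)[of 0 y] by (simp add: \<psi>_def m_def)
      qed
    qed (use cd in auto)
    moreover have "deriv \<psi> = (\<lambda>y. \<phi> y - m * deriv \<sigma> y)"
      using \<psi>_deriv by (auto intro: DERIV_imp_deriv)
    moreover have "m = (LINT y:ivl|lebesgue. \<phi> y)"
    proof -
      have "(\<phi> has_integral m) {c..d}"
        unfolding m_def using cd F by (intro fundamental_theorem_of_calculus)
          (auto simp: has_real_derivative_iff_has_vector_derivative intro: has_vector_derivative_at_within)
      moreover have "(LINT y:ivl|lebesgue. \<phi> y *\<^sub>R (1::real)) = integral {c..d} (\<lambda>y. \<phi> y *\<^sub>R 1)"
        by (rule test_function_integral(1)[OF cd(1,3) _ \<phi>])
          (use cd(4) in \<open>auto intro!: continuous_imp_L1_loc\<close>)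
      ultimately show ?thesis by (simp add: integral_unique)
    qed
    ultimately show "\<exists>\<psi>. test_function \<psi> \<and>
        deriv \<psi> = (\<lambda>y. \<phi> y - (LINT y:ivl|lebesgue. \<phi> y) * deriv \<sigma> y)"
      by blast
  qed
qed

text \<open>Testing with the antiderivative of \<open>\<phi> - m \<theta>\<close> turns the integral
  of \<open>\<phi> f\<close> into \<open>m\<close> times that of \<open>\<theta> f\<close>. So
  \<open>f\<close> minus the latter integral is orthogonal to every test function.\<close>

lemma du_Bois_Reymond:
  fixes f :: "real \<Rightarrow> 'a::euclidean_space"
  assumes f: "L1_loc f"
    and zero: "\<And>\<psi>. test_function \<psi> \<Longrightarrow> (LINT y:ivl|lebesgue. deriv \<psi> y *\<^sub>R f y) = 0"
  obtains k where "AE y in lebesgue_on ivl. f y = k"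
proof -
  obtain \<theta> where \<theta>: "test_function \<theta>"
    "\<And>\<phi>. test_function \<phi> \<Longrightarrow> \<exists>\<psi>. test_function \<psi> \<and>
      deriv \<psi> = (\<lambda>y. \<phi> y - (LINT y:ivl|lebesgue. \<phi> y) * \<theta> y)"
    using test_function_minus_multiple_eq_deriv by blast
  define k where "k = (LINT y:ivl|lebesgue. \<theta> y *\<^sub>R f y)"
  have const: "L1_loc (\<lambda>_. k)" by (intro continuous_imp_L1_loc) simp
  have "AE y in lebesgue_on ivl. f y - k = 0"
  proof (rule fundamental_lemma)
    show "L1_loc (\<lambda>y. f y - k)" by (intro L1_loc_diff f const)
    fix \<phi> assume \<phi>: "test_function \<phi>"
    define m where "m = (LINT y:ivl|lebesgue. \<phi> y)"
    obtain \<psi> where \<psi>: "test_function \<psi>" "deriv \<psi> = (\<lambda>y. \<phi> y - m * \<theta> y)"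
      using \<theta>(2)[OF \<phi>] unfolding m_def by blast
    have int: "set_integrable lebesgue ivl (\<lambda>y. \<phi> y *\<^sub>R f y)" "set_integrable lebesgue ivl (\<lambda>y. \<theta> y *\<^sub>R f y)"
      "set_integrable lebesgue ivl (\<lambda>y. \<phi> y *\<^sub>R k)"
      by (intro test_function_times_L1_loc_integrable \<phi> \<theta>(1) f const)+
    have int_\<phi>: "set_integrable lebesgue ivl \<phi>"
      using test_function_times_L1_loc_integrable[OF \<phi>, of "\<lambda>_. 1 :: real"]
      by (simp add: continuous_imp_L1_loc)
    have "0 = (LINT y:ivl|lebesgue. \<phi> y *\<^sub>R f y - m *\<^sub>R \<theta> y *\<^sub>R f y)"
      using zero[OF \<psi>(1)] by (simp add: \<psi>(2) scaleR_left_diff_distrib)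
    also have "\<dots> = (LINT y:ivl|lebesgue. \<phi> y *\<^sub>R f y) - m *\<^sub>R k"
      using int by (simp only: set_integral_diff set_integrable_scaleR_right set_integral_scaleR_right k_def)
    also have "m *\<^sub>R k = (LINT y:ivl|lebesgue. \<phi> y *\<^sub>R k)"
    proof -
      have "(LINT y:ivl|lebesgue. \<phi> y *\<^sub>R k) = (LINT y|lebesgue. (indicator ivl y *\<^sub>R \<phi> y) *\<^sub>R k)"
        by (simp add: set_lebesgue_integral_def)
      also have "\<dots> = m *\<^sub>R k"
        using int_\<phi> unfolding m_def set_lebesgue_integral_def set_integrable_def
        by (intro integral_scaleR_left)
      finally show ?thesis by simp
    qed
    also have "(LINT y:ivl|lebesgue. \<phi> y *\<^sub>R f y) - (LINT y:ivl|lebesgue. \<phi> y *\<^sub>R k)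
        = (LINT y:ivl|lebesgue. \<phi> y *\<^sub>R (f y - k))"
      using int by (simp add: scaleR_diff_right)
    finally show "(LINT y:ivl|lebesgue. \<phi> y *\<^sub>R (f y - k)) = 0" by simp
  qed
  then show ?thesis by (intro that[of k]) simp
qed

text \<open>The difference between \<open>w\<close> and the primitive of \<open>g\<close> has weak
  derivative zero, hence is constant.\<close>

lemma has_weak_deriv_imp_primitive:
  fixes w :: "real \<Rightarrow> 'a::euclidean_space"
  assumes "has_weak_deriv w g"
  obtains k where "AE y in lebesgue_on ivl. w y = k + primitive g y"
proof -
  have L1: "L1_loc w" "L1_loc g" using assms unfolding has_weak_deriv_def by auto
  have prim: "has_weak_deriv (primitive g) g" by (rule primitive_has_weak_deriv[OF L1(2)])
  then have L1p: "L1_loc (primitive g)" unfolding has_weak_deriv_def by auto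
  obtain k where "AE y in lebesgue_on ivl. w y - primitive g y = k"
  proof (rule du_Bois_Reymond)
    show "L1_loc (\<lambda>y. w y - primitive g y)" by (intro L1_loc_diff L1 L1p)
    fix \<psi> assume \<psi>: "test_function \<psi>"
    then have \<psi>': "test_function (deriv \<psi>)"
      by (rule test_function_deriv)
    have "(LINT y:ivl|lebesgue. deriv \<psi> y *\<^sub>R (w y - primitive g y))
        = (LINT y:ivl|lebesgue. deriv \<psi> y *\<^sub>R w y) - (LINT y:ivl|lebesgue. deriv \<psi> y *\<^sub>R primitive g y)"
      using test_function_times_L1_loc_integrable[OF \<psi>' L1(1)] test_function_times_L1_loc_integrable[OF \<psi>' L1p]
      by (simp add: scaleR_diff_right)
    also have "\<dots> = 0"
      using assms prim \<psi> unfolding has_weak_deriv_def by simp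
    finally show "(LINT y:ivl|lebesgue. deriv \<psi> y *\<^sub>R (w y - primitive g y)) = 0" .
  qed
  then have "AE y in lebesgue_on ivl. w y = k + primitive g y"
    by eventually_elim (auto simp: algebra_simps)
  then show ?thesis by (rule that)
qed

section \<open>Stationary profiles\<close>

lemma abs_powr_has_real_derivative:
  fixes b t :: real
  assumes "b > 1"
  shows "((\<lambda>t. \<bar>t\<bar> powr b) has_real_derivative b * \<bar>t\<bar> powr (b - 1) * sgn t) (at t)"
proof -
  consider "t > 0" | "t < 0" | "t = 0" by linarith
  then show ?thesis
  proof cases
    case 1
    have "((\<lambda>t. t powr b) has_real_derivative b * \<bar>t\<bar> powr (b - 1) * sgn t) (at t)"
      using 1 by (auto intro!: derivative_eq_intros)
    then show ?thesis
      by (rule DERIV_cong_ev[OF refl _ refl, THEN iffD1, rotated])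
        (use 1 in \<open>auto simp: eventually_nhds intro!: exI[of _ "{0<..}"]\<close>)
  next
    case 2
    have "((\<lambda>t. (- t) powr b) has_real_derivative b * \<bar>t\<bar> powr (b - 1) * sgn t) (at t)"
      using 2 by (auto intro!: derivative_eq_intros)
    then show ?thesis
      by (rule DERIV_cong_ev[OF refl _ refl, THEN iffD1, rotated])
        (use 2 in \<open>auto simp: eventually_nhds intro!: exI[of _ "{..<0}"]\<close>)
  next
    case 3
    have "((\<lambda>h::real. \<bar>h\<bar> powr (b - 1)) \<longlongrightarrow> \<bar>0\<bar> powr (b - 1)) (at 0)"
      by (rule tendsto_powr') (use assms in \<open>auto intro!: tendsto_rabs_zero tendsto_ident_at\<close>)
    then have "((\<lambda>h::real. \<bar>\<bar>h\<bar> powr b / h\<bar>) \<longlongrightarrow> \<bar>0\<bar> powr (b - 1)) (at 0)"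
      by (rule Lim_transform_eventually)
        (use assms in \<open>auto simp: eventually_at_filter powr_diff\<close>)
    then have "((\<lambda>h::real. \<bar>h\<bar> powr b / h) \<longlongrightarrow> 0) (at 0)"
      using tendsto_rabs_zero_iff[of "\<lambda>h::real. \<bar>h\<bar> powr b / h"] by simp
    then show ?thesis
      using 3 assms by (simp add: DERIV_def)
  qed
qed

text \<open>As a power of \<open>u \<bullet> u\<close> with exponent \<open>(r + 1) / 2 > 1\<close>,
  the expression is differentiable at zeros of \<open>u\<close> too. The energy can therefore be
  differentiated before zeros are excluded.\<close>

lemma norm_powr_has_real_derivative:
  fixes u :: "real \<Rightarrow> 'a::euclidean_space"
  assumes "r > 1" and u: "(u has_vector_derivative v) (at y)"
  shows "((\<lambda>y. norm (u y) powr (r + 1)) has_real_derivative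
      (r + 1) * norm (u y) powr (r - 1) * (u y \<bullet> v)) (at y)"
proof -
  have eq: "norm x powr s = \<bar>x \<bullet> x\<bar> powr (s / 2)" for x :: 'a and s
    by (simp add: norm_eq_sqrt_inner powr_half_sqrt[symmetric] powr_powr)
  have "((\<lambda>y. u y \<bullet> u y) has_real_derivative 2 * (u y \<bullet> v)) (at y)"
    unfolding has_real_derivative_iff_has_vector_derivative
    by (rule has_vector_derivative_eq_rhs[OF bounded_bilinear.has_vector_derivative[OF bounded_bilinear_inner u u]])
      (simp add: inner_commute)
  then have "((\<lambda>y. \<bar>u y \<bullet> u y\<bar> powr ((r + 1) / 2)) has_real_derivative
      (r + 1) / 2 * \<bar>u y \<bullet> u y\<bar> powr ((r + 1) / 2 - 1) * sgn (u y \<bullet> u y) * (2 * (u y \<bullet> v))) (at y)"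
    by (rule DERIV_chain2[OF abs_powr_has_real_derivative, rotated]) (use assms in simp)
  moreover have "(r + 1) / 2 * \<bar>u y \<bullet> u y\<bar> powr ((r + 1) / 2 - 1) * sgn (u y \<bullet> u y) * (2 * (u y \<bullet> v))
      = (r + 1) * norm (u y) powr (r - 1) * (u y \<bullet> v)"
    by (cases "u y = 0") (auto simp: eq diff_divide_distrib add_divide_distrib)
  ultimately show ?thesis
    unfolding eq by metis
qed

lemma one_minus_sq_pos: "y \<in> ivl \<Longrightarrow> 0 < 1 - (y::real)\<^sup>2"
  by (simp add: abs_square_less_1 abs_less_iff)

lemma one_minus_sq_powr_has_real_derivative:
  assumes "y \<in> ivl"
  shows "((\<lambda>y. (1 - y\<^sup>2) powr b) has_real_derivative - (2 * b * y) * (1 - y\<^sup>2) powr (b - 1)) (at y)"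
  using one_minus_sq_pos[OF assms] by (auto intro!: derivative_eq_intros)

lemma continuous_on_ivl_one_minus_sq_powr: "continuous_on ivl (\<lambda>y. (1 - y\<^sup>2) powr b)"
  using one_minus_sq_powr_has_real_derivative
  by (intro continuous_at_imp_continuous_on ballI DERIV_isCont)

lemma constant_on_ivl:
  fixes f :: "real \<Rightarrow> 'a::real_normed_vector"
  assumes "\<And>y. y \<in> ivl \<Longrightarrow> (f has_vector_derivative 0) (at y)" "x \<in> ivl" "y \<in> ivl"
  shows "f x = f y"
proof -
  obtain c where "\<And>x. x \<in> ivl \<Longrightarrow> f x = c"
    by (rule has_vector_derivative_zero_constant[of ivl f])
      (auto intro: has_vector_derivative_at_within[OF assms(1)])
  then show ?thesis using assms(2,3) by metis
qed

text \<open>The equation solved for \<open>u''\<close>, with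
  \<open>a (a + 1) = 2 (p + 1) / (p - 1)\<^sup>2\<close>, as a first-order system. Finiteness of the
  weighted integral of \<open>|v|\<^sup>2\<close> enters through the bounded antiderivative
  \<open>P\<close>, so that the analysis inside the locale is pure calculus. In the variable
  \<open>\<xi>\<close> the derivative of \<open>P\<close> is \<open>|Z|\<^sup>2\<close>.\<close>

locale stationary_profile =
  fixes p a :: real and u v :: "real \<Rightarrow> 'a::euclidean_space" and P :: "real \<Rightarrow> real" and M :: real
  assumes p_gt_1: "p > 1" and a_def: "a = 2 / (p - 1)"
    and u_deriv: "\<And>y. y \<in> ivl \<Longrightarrow> (u has_vector_derivative v y) (at y)"
    and v_deriv: "\<And>y. y \<in> ivl \<Longrightarrow> (v has_vector_derivative
      (1 / (1 - y\<^sup>2)) *\<^sub>R ((2 * (a + 1) * y) *\<^sub>R v y + (a * (a + 1) - norm (u y) powr (p - 1)) *\<^sub>R u y)) (at y)"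
    and P_deriv: "\<And>y. y \<in> ivl \<Longrightarrow>
      (P has_real_derivative (norm (v y))\<^sup>2 * (1 - y\<^sup>2) powr (a + 1)) (at y)"
    and P_le: "\<And>y. y \<in> ivl \<Longrightarrow> P y \<le> M"
begin

lemma a_pos: "a > 0"
  using p_gt_1 by (simp add: a_def)

lemma p_eq: "p = 1 + 2 / a"
  using p_gt_1 by (simp add: a_def field_simps)

definition W :: "real \<Rightarrow> 'a" where "W y = (1 - y\<^sup>2) powr (a / 2) *\<^sub>R u y"
text \<open>Since \<open>d/d\<xi>\<close> is \<open>(1 - y\<^sup>2) d/dy\<close>, the product rule
  shows that \<open>W' + a y W\<close> contains no \<open>u\<close> term and equals this
  expression.\<close>

definition Z :: "real \<Rightarrow> 'a" where "Z y = (1 - y\<^sup>2) powr (a / 2 + 1) *\<^sub>R v y"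

lemma u_inner_v_deriv:
  assumes "y \<in> ivl"
  shows "((\<lambda>y. u y \<bullet> c) has_real_derivative v y \<bullet> c) (at y)"
    and "((\<lambda>y. v y \<bullet> c) has_real_derivative
      (2 * (a + 1) * y * (v y \<bullet> c) + (a * (a + 1) - norm (u y) powr (p - 1)) * (u y \<bullet> c)) / (1 - y\<^sup>2)) (at y)"
  using bounded_linear.has_vector_derivative[OF bounded_linear_inner_left u_deriv[OF assms], of c]
    bounded_linear.has_vector_derivative[OF bounded_linear_inner_left v_deriv[OF assms], of c]
  by (auto simp: has_real_derivative_iff_has_vector_derivative inner_add_left add_divide_distrib)

lemma u_inner_u_deriv:
  assumes "y \<in> ivl"
  shows "((\<lambda>y. u y \<bullet> u y) has_real_derivative 2 * (u y \<bullet> v y)) (at y)"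
  unfolding has_real_derivative_iff_has_vector_derivative
  by (rule has_vector_derivative_eq_rhs[OF bounded_bilinear.has_vector_derivative[OF
          bounded_bilinear_inner u_deriv[OF assms] u_deriv[OF assms]]]) (simp add: inner_commute)

section \<open>Behaviour at the right end point\<close>

lemma P_tail_small:
  assumes "\<eta> > 0"
  obtains y0 where "0 < y0" "y0 < 1" "\<And>y. y0 \<le> y \<Longrightarrow> y < 1 \<Longrightarrow> P y - P y0 \<le> \<eta>"
proof -
  define s where "s = Sup (P ` {0<..<1})"
  have bdd: "bdd_above (P ` {0<..<1})"
    using P_le by (auto intro!: bdd_aboveI[of _ M])
  have "(P ` {0<..<1}) \<noteq> {}" by (auto intro!: exI[of _ "1/2"])
  then obtain y0 where y0: "y0 \<in> {0<..<1}" "s - \<eta> < P y0"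
    using less_cSup_iff[OF _ bdd, of "s - \<eta>"] assms unfolding s_def by auto
  moreover have "P y \<le> s" if "y0 \<le> y" "y < 1" for y
    unfolding s_def using that y0 by (intro cSup_upper bdd) auto
  ultimately show ?thesis
    by (intro that[of y0]) force+
qed

lemma W_tendsto_0: "(W \<longlongrightarrow> 0) (at_left 1)"
proof (rule tendstoI)
  fix e :: real assume e: "e > 0"
  \<comment> \<open>\<open>K\<close> bounds the factor \<open>1 + y\<close> of
    \<open>1 - y\<^sup>2\<close>, raised to the power \<open>a / 2\<close>. The parameters
    \<open>\<delta>\<close> and \<open>\<eta>\<close> below are tuned so that the two parts of the
    majorant \<open>\<psi>\<close> have coefficients \<open>e / (4 * K)\<close> each.\<close>
  define K where "K = 2 powr (a / 2)"
  have K: "K > 0" by (simp add: K_def)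
  define \<delta> where "\<delta> = a * e / (4 * K)"
  have \<delta>: "\<delta> > 0" using e K a_pos by (simp add: \<delta>_def)
  define \<eta> where "\<eta> = \<delta> * e / (2 * K)"
  have \<eta>: "\<eta> > 0" using e K \<delta> by (simp add: \<eta>_def)
  obtain y0 where y0: "0 < y0" "y0 < 1" "\<And>y. y0 \<le> y \<Longrightarrow> y < 1 \<Longrightarrow> P y - P y0 \<le> \<eta>"
    using P_tail_small[OF \<eta>] by blast
  have W_le: "norm (W y) \<le> (1 - y\<^sup>2) powr (a / 2) * norm (u y0) + e / 2" if y: "y0 < y" "y < 1" for y
  proof -
    \<comment> \<open>A scalar majorant with \<open>norm (v s) \<le> \<psi>' s\<close>, so that the
      mean value inequality bounds the increment of \<open>u\<close>. The factor at \<open>P\<close>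
      is frozen at the right end \<open>y\<close>, which makes the second part an increment of
      \<open>P\<close>.\<close>
    define \<psi> where "\<psi> s = \<delta> / a * (1 - s) powr (- (a / 2)) + (1 - y) powr (- (a / 2)) / (2 * \<delta>) * P s" for s
    define \<psi>' where "\<psi>' s = \<delta> / 2 * (1 - s) powr (- (a / 2) - 1)
        + (1 - y) powr (- (a / 2)) / (2 * \<delta>) * ((norm (v s))\<^sup>2 * (1 - s\<^sup>2) powr (a + 1))" for s
    have sub: "s \<in> ivl" if "y0 \<le> s" "s \<le> y" for s using that y y0 by auto
    have \<psi>_deriv: "(\<psi> has_real_derivative \<psi>' s) (at s)" if "y0 \<le> s" "s \<le> y" for s
      unfolding \<psi>_def \<psi>'_def using that y a_pos \<delta>
      by (auto intro!: derivative_eq_intros P_deriv sub simp: field_simps)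
    have "norm (u y - u y0) \<le> \<psi> y - \<psi> y0"
    proof (rule differentiable_bound_general[OF y(1)])
      show "continuous_on {y0..y} u"
        using u_deriv sub by (intro continuous_at_imp_continuous_on ballI has_vector_derivative_continuous) auto
      show "continuous_on {y0..y} \<psi>"
        using \<psi>_deriv by (intro continuous_at_imp_continuous_on ballI DERIV_isCont) auto
      fix s assume s: "y0 < s" "s < y"
      show "(u has_vector_derivative v s) (at s)" using s sub u_deriv by auto
      show "(\<psi> has_vector_derivative \<psi>' s) (at s)"
        using s \<psi>_deriv by (auto simp: has_real_derivative_iff_has_vector_derivative)
      define A where "A = (1 - s) powr (- (a / 2) - 1)"
      have A: "A > 0" using s y by (simp add: A_def)
      \<comment> \<open>Converts the weight in Young's inequality into the one in the derivative of
        \<open>P\<close>; the exponents match because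
        \<open>a / 2 + 1 = - a / 2 + (a + 1)\<close>.\<close>
      have "1 / A \<le> (1 - y) powr (- (a / 2)) * (1 - s\<^sup>2) powr (a + 1)"
      proof -
        have "1 / A = (1 - s) powr (a / 2 + 1)"
          using powr_minus_divide[of "1 - s" "- (a / 2) - 1"] by (simp add: A_def add.commute)
        also have "\<dots> = (1 - s) powr (- (a / 2)) * (1 - s) powr (a + 1)"
          by (simp add: powr_add[symmetric])
        also have "\<dots> \<le> (1 - y) powr (- (a / 2)) * (1 - s\<^sup>2) powr (a + 1)"
        proof (rule mult_mono)
          show "(1 - s) powr (- (a / 2)) \<le> (1 - y) powr (- (a / 2))"
            using s y a_pos by (intro powr_mono2') auto
          show "(1 - s) powr (a + 1) \<le> (1 - s\<^sup>2) powr (a + 1)"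
            using s y y0 a_pos by (intro powr_mono2) (auto simp: power2_eq_square)
        qed auto
        finally show ?thesis .
      qed
      then have "(norm (v s))\<^sup>2 / (2 * \<delta> * A)
          \<le> (1 - y) powr (- (a / 2)) / (2 * \<delta>) * ((norm (v s))\<^sup>2 * (1 - s\<^sup>2) powr (a + 1))"
        using mult_left_mono[of "1 / A" "(1 - y) powr (- (a / 2)) * (1 - s\<^sup>2) powr (a + 1)" "(norm (v s))\<^sup>2 / (2 * \<delta>)"] \<delta>
        by (simp add: mult_ac)
      moreover have "norm (v s) \<le> \<delta> / 2 * A + (norm (v s))\<^sup>2 / (2 * \<delta> * A)"
      proof -
        have "0 \<le> (\<delta> * A - norm (v s))\<^sup>2 / (2 * \<delta> * A)" using \<delta> A by simp
        also have "\<dots> = \<delta> / 2 * A + (norm (v s))\<^sup>2 / (2 * \<delta> * A) - norm (v s)"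
          using \<delta> A by (simp add: power2_eq_square field_simps)
        finally show ?thesis by simp
      qed
      ultimately show "norm (v s) \<le> \<psi>' s" by (simp add: \<psi>'_def A_def)
    qed
    also have "\<psi> y - \<psi> y0 \<le> \<delta> / a * (1 - y) powr (- (a / 2)) + (1 - y) powr (- (a / 2)) / (2 * \<delta>) * \<eta>"
    proof -
      have "0 \<le> \<delta> / a * (1 - y0) powr (- (a / 2))" using \<delta> a_pos by simp
      moreover have "(1 - y) powr (- (a / 2)) / (2 * \<delta>) * (P y - P y0) \<le> (1 - y) powr (- (a / 2)) / (2 * \<delta>) * \<eta>"
        using y0(3)[of y] y \<delta> by (intro mult_left_mono) auto
      ultimately show ?thesis by (simp add: \<psi>_def right_diff_distrib)
    qed
    also have "\<dots> = (1 - y) powr (- (a / 2)) * (e / (2 * K))"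
      using \<delta> a_pos K e by (simp add: \<eta>_def \<delta>_def field_simps)
    finally have "norm (u y) \<le> norm (u y0) + (1 - y) powr (- (a / 2)) * (e / (2 * K))"
      using norm_triangle_ineq2[of "u y" "u y0"] by linarith
    then have "(1 - y\<^sup>2) powr (a / 2) * norm (u y)
        \<le> (1 - y\<^sup>2) powr (a / 2) * (norm (u y0) + (1 - y) powr (- (a / 2)) * (e / (2 * K)))"
      by (intro mult_left_mono) auto
    also have "\<dots> = (1 - y\<^sup>2) powr (a / 2) * norm (u y0)
        + ((1 - y\<^sup>2) powr (a / 2) * (1 - y) powr (- (a / 2))) * (e / (2 * K))"
      by (simp add: algebra_simps)
    also have "(1 - y\<^sup>2) powr (a / 2) * (1 - y) powr (- (a / 2)) = (1 + y) powr (a / 2)"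
    proof -
      have "1 - y\<^sup>2 = (1 - y) * (1 + y)" by (simp add: power2_eq_square algebra_simps)
      then have "(1 - y\<^sup>2) powr (a / 2) = (1 - y) powr (a / 2) * (1 + y) powr (a / 2)"
        using y y0 by (simp add: powr_mult)
      then show ?thesis using y by (simp add: powr_minus)
    qed
    also have "(1 + y) powr (a / 2) * (e / (2 * K)) \<le> K * (e / (2 * K))"
      unfolding K_def using y y0 a_pos e by (intro mult_right_mono powr_mono2) auto
    also have "K * (e / (2 * K)) = e / 2" using K by simp
    finally show ?thesis by (simp add: W_def)
  qed
  have "((\<lambda>y. (1 - y\<^sup>2) powr (a / 2) * norm (u y0)) \<longlongrightarrow> (1 - 1\<^sup>2) powr (a / 2) * norm (u y0)) (at_left 1)"
  proof (intro tendsto_mult tendsto_const tendsto_powr')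
    have "\<forall>\<^sub>F y in at_left (1::real). y \<in> {0<..<1}"
      by (intro eventually_at_left_real) simp
    then show "1 - 1\<^sup>2 \<noteq> (0::real) \<or> 0 < a / 2 \<and> (\<forall>\<^sub>F y::real in at_left 1. 0 \<le> 1 - y\<^sup>2)"
      using a_pos by (auto elim!: eventually_mono simp: abs_square_le_1)
    show "((\<lambda>y::real. 1 - y\<^sup>2) \<longlongrightarrow> 1 - 1\<^sup>2) (at_left 1)" by (intro tendsto_intros)
  qed
  then have "\<forall>\<^sub>F y in at_left 1. (1 - y\<^sup>2) powr (a / 2) * norm (u y0) < e / 2"
    by (rule order_tendstoD) (use e a_pos in auto)
  moreover have "\<forall>\<^sub>F y in at_left 1. y \<in> {y0<..<1}"
    using y0 by (intro eventually_at_left_real) simp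
  ultimately show "\<forall>\<^sub>F y in at_left 1. dist (W y) 0 < e"
  proof eventually_elim
    case (elim y)
    then show ?case using W_le[of y] by (simp add: dist_norm)
  qed
qed

text \<open>If \<open>|Z|\<close> stayed above \<open>e\<close> near the end point, \<open>P\<close>
  would grow at least like \<open>e\<^sup>2 / 2\<close> times \<open>- ln (1 - y)\<close>,
  contradicting its bound. The factor one half comes from
  \<open>1 - s\<^sup>2 \<le> 2 (1 - s)\<close>.\<close>

lemma Z_frequently_small:
  assumes "e > 0" "x < 1"
  shows "\<exists>y\<in>{x<..<1}. y \<in> ivl \<and> norm (Z y) \<le> e"
proof (rule ccontr)
  assume neg: "\<not> ?thesis"
  define x0 where "x0 = max 0 ((x + 1) / 2)"
  have x0: "0 \<le> x0" "x < x0" "x0 < 1" using assms by (auto simp: x0_def max_def)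
  have Z_gt: "norm (Z y) > e" if "x0 \<le> y" "y < 1" for y
  proof -
    have "y \<in> {x<..<1}" "y \<in> ivl" using that x0 by auto
    then show ?thesis using neg by force
  qed
  have growth: "e\<^sup>2 / 2 * (ln (1 - x0) - ln (1 - y)) \<le> P y - P x0" if y: "x0 \<le> y" "y < 1" for y
  proof -
    define Q where "Q s = P s + e\<^sup>2 / 2 * ln (1 - s)" for s
    have "Q x0 \<le> Q y"
    proof (rule DERIV_nonneg_imp_nondecreasing[OF y(1)])
      fix s assume s: "x0 \<le> s" "s \<le> y"
      then have s_ivl: "s \<in> ivl" using x0 y by auto
      have pos: "0 < 1 - s\<^sup>2" using one_minus_sq_pos[OF s_ivl] .
      have Qd: "(Q has_real_derivative (norm (v s))\<^sup>2 * (1 - s\<^sup>2) powr (a + 1) - e\<^sup>2 / 2 / (1 - s)) (at s)"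
      proof -
        have "((\<lambda>s. ln (1 - s)) has_real_derivative - 1 / (1 - s)) (at s)"
          using s y by (auto intro!: derivative_eq_intros)
        then show ?thesis
          unfolding Q_def[abs_def]
          by (rule DERIV_cong[OF DERIV_add[OF P_deriv[OF s_ivl] DERIV_cmult]]) simp
      qed
      have "(norm (Z s))\<^sup>2 = (norm (v s))\<^sup>2 * (1 - s\<^sup>2) powr (a + 1) * (1 - s\<^sup>2)"
      proof -
        have "((1 - s\<^sup>2) powr (a / 2 + 1))\<^sup>2 = (1 - s\<^sup>2) powr (a + 1) * (1 - s\<^sup>2)"
        proof -
          have "((1 - s\<^sup>2) powr (a / 2 + 1))\<^sup>2 = (1 - s\<^sup>2) powr (a + 1 + 1)"
            by (simp add: power2_eq_square[of "_ powr _"] powr_add[symmetric] add.commute)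
          then show ?thesis using pos by (simp only: powr_add powr_one)
        qed
        then show ?thesis by (simp add: Z_def power_mult_distrib)
      qed
      then have "(norm (v s))\<^sup>2 * (1 - s\<^sup>2) powr (a + 1) = (norm (Z s))\<^sup>2 / (1 - s\<^sup>2)"
        using pos by simp
      also have "\<dots> \<ge> e\<^sup>2 / (2 * (1 - s))"
      proof (rule frac_le)
        show "e\<^sup>2 \<le> (norm (Z s))\<^sup>2"
          using Z_gt[of s] s y assms by (intro power_mono) auto
        have "(1 - s) * (1 + s) \<le> (1 - s) * 2" using s y by (intro mult_left_mono) auto
        then show "1 - s\<^sup>2 \<le> 2 * (1 - s)" by (simp add: power2_eq_square algebra_simps)
      qed (use pos s in auto)
      finally have "0 \<le> (norm (v s))\<^sup>2 * (1 - s\<^sup>2) powr (a + 1) - e\<^sup>2 / 2 / (1 - s)" by simp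
      with Qd show "\<exists>d. (Q has_real_derivative d) (at s) \<and> 0 \<le> d" by blast
    qed
    then show ?thesis by (simp add: Q_def right_diff_distrib)
  qed
  \<comment> \<open>The logarithmic gain at which \<open>P\<close> must exceed \<open>M\<close> by
    at least one; the point \<open>y\<close> below realises it exactly.\<close>
  define R where "R = (M - P x0 + 1) * 2 / e\<^sup>2"
  have "P x0 \<le> M" using x0 by (intro P_le) auto
  then have R: "R > 0" using assms by (simp add: R_def)
  define y where "y = 1 - (1 - x0) * exp (- R)"
  have "(1 - x0) * exp (- R) \<le> 1 - x0"
    using x0 R by (intro mult_left_le) auto
  from diff_left_mono[OF this, of 1] have "x0 \<le> y"
    unfolding y_def by (simp only: diff_diff_eq2 add_diff_cancel_left')
  moreover have "y < 1" using x0 by (simp add: y_def)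
  ultimately have y: "x0 \<le> y" "y < 1" by auto
  have "ln (1 - x0) - ln (1 - y) = R" using x0 by (simp add: y_def ln_mult)
  then have "M - P x0 + 1 \<le> P y - P x0"
    using growth[OF y] assms by (simp add: R_def)
  moreover have "P y \<le> M" using x0 y by (intro P_le) auto
  ultimately show False by simp
qed

lemma W_Z_small:
  assumes "e > 0"
  obtains y where "y \<in> ivl" "norm (W y) \<le> e" "norm (Z y) \<le> e"
proof -
  have "\<forall>\<^sub>F y in at_left 1. dist (W y) 0 < e"
    using W_tendsto_0 assms by (rule tendstoD)
  then obtain x where "x < 1" "\<forall>y>x. y < 1 \<longrightarrow> dist (W y) 0 < e"
    unfolding eventually_at_left_field by blast
  with Z_frequently_small[OF assms \<open>x < 1\<close>] show ?thesis
    by (force intro: that)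
qed

section \<open>Conserved quantities and their vanishing\<close>

definition energy :: "real \<Rightarrow> real"
  where "energy y = (1 - y\<^sup>2) powr (a + 1) * ((1 - y\<^sup>2) / 2 * (v y \<bullet> v y) - a * y * (u y \<bullet> v y)
    - a\<^sup>2 / 2 * (u y \<bullet> u y) + norm (u y) powr (p + 1) / (p + 1))"

lemma norm_powr_add_2: "norm (x :: 'a) powr (p + 1) = norm x powr (p - 1) * (x \<bullet> x)"
proof (cases "x = 0")
  case False
  have "norm x powr (p + 1) = norm x powr (p - 1) * norm x powr 2"
    using powr_add[of "norm x" "p - 1" 2] by (simp add: add.commute)
  moreover have "norm x powr 2 = x \<bullet> x"
    using False by (simp add: dot_square_norm)
  ultimately show ?thesis by simp
qed simp

lemma energy_has_derivative_0:
  assumes y: "y \<in> ivl"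
  shows "(energy has_real_derivative 0) (at y)"
proof -
  define T where "T = 1 - y\<^sup>2"
  define U where "U = u y \<bullet> u y"
  define V where "V = v y \<bullet> v y"
  define X where "X = u y \<bullet> v y"
  define N where "N = norm (u y) powr (p - 1)"
  have T: "T > 0" using one_minus_sq_pos[OF y] by (simp add: T_def)
  note inner_deriv = bounded_bilinear.has_vector_derivative[OF bounded_bilinear_inner]
  have dU: "((\<lambda>y. u y \<bullet> u y) has_real_derivative 2 * X) (at y)"
    using u_inner_u_deriv[OF y] by (simp add: X_def)
  have dV: "((\<lambda>y. v y \<bullet> v y) has_real_derivative
      2 * (2 * (a + 1) * y * V + (a * (a + 1) - N) * X) / T) (at y)"
    unfolding has_real_derivative_iff_has_vector_derivative
    by (rule has_vector_derivative_eq_rhs[OF inner_deriv[OF v_deriv[OF y] v_deriv[OF y]]])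
      (simp add: X_def V_def N_def T_def inner_commute inner_add_right inner_add_left add_divide_distrib mult_ac)
  have dX: "((\<lambda>y. u y \<bullet> v y) has_real_derivative
      V + (2 * (a + 1) * y * X + (a * (a + 1) - N) * U) / T) (at y)"
    unfolding has_real_derivative_iff_has_vector_derivative
    by (rule has_vector_derivative_eq_rhs[OF inner_deriv[OF u_deriv[OF y] v_deriv[OF y]]])
      (simp add: X_def V_def U_def N_def T_def inner_commute inner_add_right inner_add_left add_divide_distrib mult_ac)
  have dN: "((\<lambda>y. norm (u y) powr (p + 1)) has_real_derivative (p + 1) * N * X) (at y)"
    unfolding N_def X_def by (rule norm_powr_has_real_derivative[OF p_gt_1 u_deriv[OF y]])
  have dT: "((\<lambda>y. (1 - y\<^sup>2) powr (a + 1)) has_real_derivative - (2 * (a + 1) * y) * T powr a) (at y)"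
    using one_minus_sq_powr_has_real_derivative[OF y, of "a + 1"] by (simp add: T_def)
  have dT1: "((\<lambda>y. (1 - y\<^sup>2) / 2) has_real_derivative - y) (at y)"
    by (auto intro!: derivative_eq_intros)
  have day: "((\<lambda>y. a * y) has_real_derivative a) (at y)"
    by (auto intro!: derivative_eq_intros)
  have "(energy has_real_derivative
      - (2 * (a + 1) * y) * T powr a * (T / 2 * V - a * y * X - a\<^sup>2 / 2 * U + N * U / (p + 1))
      + (- y * V + 2 * (2 * (a + 1) * y * V + (a * (a + 1) - N) * X) / T * (T / 2)
         - (a * X + (V + (2 * (a + 1) * y * X + (a * (a + 1) - N) * U) / T) * (a * y))
         - a\<^sup>2 / 2 * (2 * X) + (p + 1) * N * X / (p + 1)) * T powr (a + 1)) (at y)"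
    unfolding energy_def[abs_def]
    by (rule DERIV_cong[OF DERIV_mult[OF dT DERIV_add[OF DERIV_diff[OF DERIV_diff[OF
          DERIV_mult[OF dT1 dV] DERIV_mult[OF day dX]] DERIV_cmult[OF dU]] DERIV_cdivide[OF dN]]]])
      (simp add: T_def U_def V_def X_def N_def norm_powr_add_2)
  moreover have "- (2 * (a + 1) * y) * T powr a * (T / 2 * V - a * y * X - a\<^sup>2 / 2 * U + N * U / (p + 1))
      + (- y * V + 2 * (2 * (a + 1) * y * V + (a * (a + 1) - N) * X) / T * (T / 2)
         - (a * X + (V + (2 * (a + 1) * y * X + (a * (a + 1) - N) * U) / T) * (a * y))
         - a\<^sup>2 / 2 * (2 * X) + (p + 1) * N * X / (p + 1)) * T powr (a + 1) = 0"
  proof -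
    \<comment> \<open>Once the factor \<open>T powr a\<close> is taken out and \<open>p + 1\<close>
      is expressed by \<open>a\<close>, only a rational identity in \<open>y\<close>,
      \<open>U\<close>, \<open>V\<close>, \<open>X\<close>, \<open>N\<close> remains.\<close>
    have T_powr: "T powr (a + 1) = T powr a * T" using T by (simp add: powr_add)
    have p1: "p + 1 = 2 * (a + 1) / a" using a_pos by (simp add: p_eq field_simps)
    have "- (2 * (a + 1) * y) * (T / 2 * V - a * y * X - a\<^sup>2 / 2 * U + N * U * (a / (2 * (a + 1))))
      + (- y * V + (2 * (a + 1) * y * V + (a * (a + 1) - N) * X)
         - (a * X + (V + (2 * (a + 1) * y * X + (a * (a + 1) - N) * U) / T) * (a * y))
         - a\<^sup>2 / 2 * (2 * X) + N * X) * T = 0"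
      using T a_pos by (simp add: field_simps power2_eq_square)
    moreover have "N * U / (p + 1) = N * U * (a / (2 * (a + 1)))"
      using a_pos by (simp add: p1)
    moreover have "(p + 1) * N * X / (p + 1) = N * X" using p_gt_1 by simp
    moreover have "2 * (2 * (a + 1) * y * V + (a * (a + 1) - N) * X) / T * (T / 2)
        = 2 * (a + 1) * y * V + (a * (a + 1) - N) * X" using T by simp
    ultimately show ?thesis
      unfolding T_powr by (simp only:) algebra
  qed
  ultimately show ?thesis by simp
qed

text \<open>The component of the bivector of \<open>W\<close> and \<open>W'\<close> in the
  directions \<open>b\<close>, \<open>c\<close>. Since \<open>Z\<close> and \<open>W'\<close> differ
  by a multiple of \<open>W\<close>, antisymmetry permits \<open>Z\<close> in place of
  \<open>W'\<close>. Components make sense in every dimension.\<close>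

definition angular_momentum :: "'a \<Rightarrow> 'a \<Rightarrow> real \<Rightarrow> real"
  where "angular_momentum b c y =
    (1 - y\<^sup>2) powr (a + 1) * ((u y \<bullet> b) * (v y \<bullet> c) - (u y \<bullet> c) * (v y \<bullet> b))"

text \<open>The force is central: the part of \<open>v'\<close> along \<open>u\<close> drops out by
  antisymmetry, and the part along \<open>v\<close> is compensated by the derivative of the
  weight.\<close>

lemma angular_momentum_has_derivative_0:
  assumes y: "y \<in> ivl"
  shows "(angular_momentum b c has_real_derivative 0) (at y)"
proof -
  have T: "1 - y\<^sup>2 > 0" using one_minus_sq_pos[OF y] .
  have "(angular_momentum b c has_real_derivative
      - (2 * (a + 1) * y) * (1 - y\<^sup>2) powr (a + 1 - 1) * ((u y \<bullet> b) * (v y \<bullet> c) - (u y \<bullet> c) * (v y \<bullet> b))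
      + ((v y \<bullet> b) * (v y \<bullet> c)
        + (2 * (a + 1) * y * (v y \<bullet> c) + (a * (a + 1) - norm (u y) powr (p - 1)) * (u y \<bullet> c)) / (1 - y\<^sup>2) * (u y \<bullet> b)
        - ((v y \<bullet> c) * (v y \<bullet> b)
        + (2 * (a + 1) * y * (v y \<bullet> b) + (a * (a + 1) - norm (u y) powr (p - 1)) * (u y \<bullet> b)) / (1 - y\<^sup>2) * (u y \<bullet> c)))
        * (1 - y\<^sup>2) powr (a + 1)) (at y)"
    unfolding angular_momentum_def[abs_def]
    by (intro DERIV_mult DERIV_diff u_inner_v_deriv[OF y] one_minus_sq_powr_has_real_derivative[OF y])
  then show ?thesis
  proof (rule DERIV_cong)
    have eq: "- (2 * (a + 1) * y) * s * (ub * vc - uc * vb)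
        + (vb * vc + (2 * (a + 1) * y * vc + n * uc) / t * ub
          - (vc * vb + (2 * (a + 1) * y * vb + n * ub) / t * uc)) * (s * t) = 0"
      if "t \<noteq> 0" for s t n ub uc vb vc :: real
      using that by (simp add: field_simps)
    have T_powr: "(1 - y\<^sup>2) powr (a + 1) = (1 - y\<^sup>2) powr (a + 1 - 1) * (1 - y\<^sup>2)"
      using T by (simp add: powr_add)
    show "- (2 * (a + 1) * y) * (1 - y\<^sup>2) powr (a + 1 - 1) * ((u y \<bullet> b) * (v y \<bullet> c) - (u y \<bullet> c) * (v y \<bullet> b))
      + ((v y \<bullet> b) * (v y \<bullet> c)
        + (2 * (a + 1) * y * (v y \<bullet> c) + (a * (a + 1) - norm (u y) powr (p - 1)) * (u y \<bullet> c)) / (1 - y\<^sup>2) * (u y \<bullet> b)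
        - ((v y \<bullet> c) * (v y \<bullet> b)
        + (2 * (a + 1) * y * (v y \<bullet> b) + (a * (a + 1) - norm (u y) powr (p - 1)) * (u y \<bullet> b)) / (1 - y\<^sup>2) * (u y \<bullet> c)))
        * (1 - y\<^sup>2) powr (a + 1) = 0"
      unfolding T_powr by (rule eq) (use T in simp)
  qed
qed

text \<open>The exponent \<open>a + 1\<close> splits into \<open>a / 2\<close> for \<open>u\<close>
  and \<open>a / 2 + 1\<close> for \<open>v\<close>. For the power term it is right because
  \<open>a / 2 * (p + 1) = a + 1\<close>.\<close>

lemma weighted_inner:
  assumes "y \<in> ivl"
  shows "(1 - y\<^sup>2) powr (a + 1) * (u y \<bullet> v y) = W y \<bullet> Z y"
    and "(1 - y\<^sup>2) powr (a + 1) * ((1 - y\<^sup>2) * (v y \<bullet> v y)) = Z y \<bullet> Z y"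
    and "(1 - y\<^sup>2) powr (a + 1) * (u y \<bullet> u y) = (1 - y\<^sup>2) * (W y \<bullet> W y)"
    and "(1 - y\<^sup>2) powr (a + 1) * norm (u y) powr (p + 1) = norm (W y) powr (p + 1)"
    and "angular_momentum b c y = (W y \<bullet> b) * (Z y \<bullet> c) - (W y \<bullet> c) * (Z y \<bullet> b)"
proof -
  have T: "1 - y\<^sup>2 > 0" using one_minus_sq_pos[OF assms] .
  have e1: "(1 - y\<^sup>2) powr (a + 1) = (1 - y\<^sup>2) powr (a / 2) * (1 - y\<^sup>2) powr (a / 2 + 1)"
    by (simp add: powr_add[symmetric])
  have e2: "(1 - y\<^sup>2) powr (a / 2 + 1) = (1 - y\<^sup>2) powr (a / 2) * (1 - y\<^sup>2)"
    using T by (simp add: powr_add)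
  show "(1 - y\<^sup>2) powr (a + 1) * (u y \<bullet> v y) = W y \<bullet> Z y"
    "(1 - y\<^sup>2) powr (a + 1) * ((1 - y\<^sup>2) * (v y \<bullet> v y)) = Z y \<bullet> Z y"
    "(1 - y\<^sup>2) powr (a + 1) * (u y \<bullet> u y) = (1 - y\<^sup>2) * (W y \<bullet> W y)"
    "angular_momentum b c y = (W y \<bullet> b) * (Z y \<bullet> c) - (W y \<bullet> c) * (Z y \<bullet> b)"
    unfolding W_def Z_def angular_momentum_def inner_scaleR_left inner_scaleR_right e1 e2 by algebra+
  have "a / 2 * (p + 1) = a + 1" using a_pos by (simp add: p_eq field_simps)
  then show "(1 - y\<^sup>2) powr (a + 1) * norm (u y) powr (p + 1) = norm (W y) powr (p + 1)"
    using T by (simp only: W_def norm_scaleR powr_mult powr_powr abs_of_nonneg powr_ge_zero)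
qed

lemma energy_eq_0:
  assumes "y \<in> ivl"
  shows "(1 - y\<^sup>2) * (v y \<bullet> v y) - 2 * a * y * (u y \<bullet> v y) - a\<^sup>2 * (u y \<bullet> u y)
    + 2 / (p + 1) * norm (u y) powr (p + 1) = 0"
proof -
  have const: "energy x = energy y" if "x \<in> ivl" "y \<in> ivl" for x y
    using energy_has_derivative_0
    by (intro constant_on_ivl that) (auto simp: has_real_derivative_iff_has_vector_derivative)
  have energy_WZ: "energy y = Z y \<bullet> Z y / 2 - a * y * (W y \<bullet> Z y)
      - a\<^sup>2 / 2 * (1 - y\<^sup>2) * (W y \<bullet> W y) + norm (W y) powr (p + 1) / (p + 1)" if "y \<in> ivl" for y
  proof -
    have "energy y = (1 - y\<^sup>2) powr (a + 1) * ((1 - y\<^sup>2) * (v y \<bullet> v y)) / 2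
        - a * y * ((1 - y\<^sup>2) powr (a + 1) * (u y \<bullet> v y))
        - a\<^sup>2 / 2 * ((1 - y\<^sup>2) powr (a + 1) * (u y \<bullet> u y))
        + (1 - y\<^sup>2) powr (a + 1) * norm (u y) powr (p + 1) / (p + 1)"
      unfolding energy_def by (simp add: distrib_left right_diff_distrib)
    then show ?thesis
      unfolding weighted_inner(1-4)[OF that] by simp
  qed
  \<comment> \<open>One summand for each term of the energy in \<open>W\<close> and
    \<open>Z\<close>, evaluated where both have norm at most \<open>e \<le> 1\<close>; every product
    or power of them is then at most \<open>e\<close>.\<close>
  define C where "C = 1 / 2 + a + a\<^sup>2 / 2 + 1"
  have C: "C > 0" using a_pos by (simp add: C_def add_pos_nonneg)
  have bound: "\<bar>energy y\<bar> \<le> C * e" if e: "0 < e" "e \<le> 1" for e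
  proof -
    obtain x where x: "x \<in> ivl" "norm (W x) \<le> e" "norm (Z x) \<le> e"
      using W_Z_small[OF e(1)] .
    have inner_le: "\<bar>s \<bullet> t\<bar> \<le> e" if "norm s \<le> e" "norm t \<le> e" for s t :: 'a
    proof -
      have "\<bar>s \<bullet> t\<bar> \<le> norm s * norm t" by (rule Cauchy_Schwarz_ineq2)
      also have "\<dots> \<le> e * 1" using that e by (intro mult_mono) auto
      finally show ?thesis by simp
    qed
    have "\<bar>x * (W x \<bullet> Z x)\<bar> \<le> 1 * e"
      unfolding abs_mult using x inner_le by (intro mult_mono) auto
    then have 1: "\<bar>a * x * (W x \<bullet> Z x)\<bar> \<le> a * e"
      using a_pos by (simp add: abs_mult mult.assoc)
    have "\<bar>(1 - x\<^sup>2) * (W x \<bullet> W x)\<bar> \<le> 1 * e"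
      unfolding abs_mult using x inner_le[of "W x" "W x"] one_minus_sq_pos[OF x(1)] by (intro mult_mono) auto
    then have 2: "\<bar>a\<^sup>2 / 2 * (1 - x\<^sup>2) * (W x \<bullet> W x)\<bar> \<le> a\<^sup>2 / 2 * e"
      using a_pos by (simp add: abs_mult mult.assoc)
    have "norm (W x) powr (p + 1) \<le> e powr (p + 1)"
      using x p_gt_1 by (intro powr_mono2) auto
    also have "\<dots> \<le> e powr 1"
      using e p_gt_1 by (intro powr_mono') auto
    finally have "norm (W x) powr (p + 1) \<le> e" using e by simp
    then have "norm (W x) powr (p + 1) / (p + 1) \<le> e / 1"
      using p_gt_1 e by (intro frac_le) auto
    then have 3: "\<bar>norm (W x) powr (p + 1) / (p + 1)\<bar> \<le> e" using p_gt_1 by simp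
    have 4: "\<bar>Z x \<bullet> Z x / 2\<bar> \<le> 1 / 2 * e" using inner_le[of "Z x" "Z x"] x by simp
    have "\<bar>energy x\<bar> \<le> 1 / 2 * e + a * e + a\<^sup>2 / 2 * e + e"
      unfolding energy_WZ[OF x(1)] using 1 2 3 4 by linarith
    then show ?thesis
      unfolding const[OF assms x(1)] C_def by (simp add: algebra_simps)
  qed
  have "energy y = 0"
  proof (rule ccontr)
    assume "energy y \<noteq> 0"
    then have pos: "\<bar>energy y\<bar> > 0" by simp
    define e where "e = min 1 (\<bar>energy y\<bar> / (2 * C))"
    have "C * e \<le> C * (\<bar>energy y\<bar> / (2 * C))"
      unfolding e_def using C by (intro mult_left_mono) auto
    also have "\<dots> = \<bar>energy y\<bar> / 2" using C by simp
    finally show False using bound[of e] pos C by (simp add: e_def)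
  qed
  moreover have "(1 - y\<^sup>2) powr (a + 1) \<noteq> 0" using one_minus_sq_pos[OF assms] by simp
  ultimately have "(1 - y\<^sup>2) / 2 * (v y \<bullet> v y) - a * y * (u y \<bullet> v y)
      - a\<^sup>2 / 2 * (u y \<bullet> u y) + norm (u y) powr (p + 1) / (p + 1) = 0"
    by (simp add: energy_def)
  then have "2 * ((1 - y\<^sup>2) / 2 * (v y \<bullet> v y) - a * y * (u y \<bullet> v y)
      - a\<^sup>2 / 2 * (u y \<bullet> u y) + norm (u y) powr (p + 1) / (p + 1)) = 2 * 0"
    by (simp only:)
  then show ?thesis by (simp add: field_simps)
qed

lemma angular_momentum_eq_0:
  assumes "y \<in> ivl"
  shows "(u y \<bullet> b) * (v y \<bullet> c) = (u y \<bullet> c) * (v y \<bullet> b)"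
proof -
  define C where "C = 2 * norm b * norm c"
  have C: "C \<ge> 0" by (simp add: C_def)
  have bound: "\<bar>angular_momentum b c y\<bar> \<le> C * e" if e: "0 < e" "e \<le> 1" for e
  proof -
    obtain x where x: "x \<in> ivl" "norm (W x) \<le> e" "norm (Z x) \<le> e"
      using W_Z_small[OF e(1)] .
    have le: "\<bar>(W x \<bullet> b) * (Z x \<bullet> c)\<bar> \<le> norm b * norm c * e" for b c
    proof -
      have "\<bar>W x \<bullet> b\<bar> \<le> e * norm b"
        using Cauchy_Schwarz_ineq2[of "W x" b] x(2) by (meson mult_right_mono norm_ge_zero order_trans)
      moreover have "\<bar>Z x \<bullet> c\<bar> \<le> 1 * norm c"
        using Cauchy_Schwarz_ineq2[of "Z x" c] x(3) e(2) by (meson mult_right_mono norm_ge_zero order_trans)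
      ultimately have "\<bar>W x \<bullet> b\<bar> * \<bar>Z x \<bullet> c\<bar> \<le> (e * norm b) * (1 * norm c)"
        by (intro mult_mono) (use e in auto)
      then show ?thesis by (simp add: abs_mult mult_ac)
    qed
    have "\<bar>angular_momentum b c x\<bar> \<le> C * e"
      unfolding weighted_inner(5)[OF x(1)] C_def using le[of b c] le[of c b]
      by (simp add: mult_ac)
    moreover have "angular_momentum b c y = angular_momentum b c x"
      using angular_momentum_has_derivative_0 assms x(1)
      by (intro constant_on_ivl) (auto simp: has_real_derivative_iff_has_vector_derivative)
    ultimately show ?thesis by simp
  qed
  have "angular_momentum b c y = 0"
  proof (rule ccontr)
    assume "angular_momentum b c y \<noteq> 0"
    then have pos: "\<bar>angular_momentum b c y\<bar> > 0" by simp
    \<comment> \<open>\<open>C\<close> vanishes if \<open>b\<close> or \<open>c\<close> does, hence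
      \<open>C + 1\<close> in the denominator.\<close>
    define e where "e = min 1 (\<bar>angular_momentum b c y\<bar> / (2 * (C + 1)))"
    have e: "0 < e" "e \<le> 1" using pos C by (auto simp: e_def)
    have "C * e \<le> (C + 1) * (\<bar>angular_momentum b c y\<bar> / (2 * (C + 1)))"
      using C e pos by (intro mult_mono) (auto simp: e_def)
    also have "\<dots> = \<bar>angular_momentum b c y\<bar> / 2" using C by (simp add: field_simps)
    finally show False using bound[OF e] pos by simp
  qed
  moreover have "(1 - y\<^sup>2) powr (a + 1) \<noteq> 0" using one_minus_sq_pos[OF assms] by simp
  ultimately show ?thesis by (simp add: angular_momentum_def)
qed

section \<open>Absence of zeros, constant direction and the explicit form\<close>

lemma logarithmic_derivative_bounds:
  assumes "y \<in> ivl"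
  shows "0 \<le> a * (u y \<bullet> u y) + (1 + y) * (u y \<bullet> v y)"
    and "(1 - y) * (u y \<bullet> v y) \<le> a * (u y \<bullet> u y)"
proof -
  \<comment> \<open>This is \<open>W'\<close> without the weight of \<open>W\<close>. Dropping the
    nonnegative power term from the energy identity leaves
    \<open>norm s \<le> a * norm (u y)\<close>.\<close>
  define s where "s = (1 - y\<^sup>2) *\<^sub>R v y - (a * y) *\<^sub>R u y"
  have T: "1 - y\<^sup>2 > 0" using one_minus_sq_pos[OF assms] .
  have "s \<bullet> s = (1 - y\<^sup>2) * ((1 - y\<^sup>2) * (v y \<bullet> v y) - 2 * a * y * (u y \<bullet> v y)) + a\<^sup>2 * y\<^sup>2 * (u y \<bullet> u y)"
    by (simp add: s_def inner_diff_left inner_diff_right inner_commute algebra_simps power2_eq_square)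
  also have "\<dots> \<le> (1 - y\<^sup>2) * (a\<^sup>2 * (u y \<bullet> u y)) + a\<^sup>2 * y\<^sup>2 * (u y \<bullet> u y)"
  proof (intro add_right_mono mult_left_mono)
    have "0 \<le> 2 / (p + 1) * norm (u y) powr (p + 1)" using p_gt_1 by simp
    then show "(1 - y\<^sup>2) * (v y \<bullet> v y) - 2 * a * y * (u y \<bullet> v y) \<le> a\<^sup>2 * (u y \<bullet> u y)"
      using energy_eq_0[OF assms] by linarith
  qed (use T in simp)
  also have "\<dots> = a\<^sup>2 * (u y \<bullet> u y)" by (simp add: algebra_simps)
  finally have "(norm s)\<^sup>2 \<le> (a * norm (u y))\<^sup>2"
    by (simp add: power2_norm_eq_inner power_mult_distrib)
  then have "norm s \<le> a * norm (u y)"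
    by (rule power2_le_imp_le) (use a_pos in simp)
  then have "norm (u y) * norm s \<le> norm (u y) * (a * norm (u y))"
    by (intro mult_left_mono) auto
  then have "\<bar>u y \<bullet> s\<bar> \<le> a * (u y \<bullet> u y)"
    using Cauchy_Schwarz_ineq2[of "u y" s]
    by (simp add: power2_norm_eq_inner[symmetric] power2_eq_square mult_ac)
  moreover have "u y \<bullet> s = (1 - y) * (1 + y) * (u y \<bullet> v y) - a * y * (u y \<bullet> u y)"
    by (simp add: s_def inner_diff_right power2_eq_square algebra_simps)
  \<comment> \<open>In each of the two inequalities for \<open>u y \<bullet> s\<close> one factor of
    \<open>1 - y\<^sup>2\<close> splits off and can be cancelled.\<close>
  ultimately have 1: "0 \<le> (1 - y) * (a * (u y \<bullet> u y) + (1 + y) * (u y \<bullet> v y))"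
    and 2: "0 \<le> (1 + y) * (a * (u y \<bullet> u y) - (1 - y) * (u y \<bullet> v y))"
    by (auto simp: abs_le_iff algebra_simps)
  show "0 \<le> a * (u y \<bullet> u y) + (1 + y) * (u y \<bullet> v y)"
    using 1 assms by (simp add: zero_le_mult_iff)
  show "(1 - y) * (u y \<bullet> v y) \<le> a * (u y \<bullet> u y)"
    using 2 assms by (simp add: zero_le_mult_iff)
qed

lemma zero_everywhere_if_somewhere:
  assumes x: "x \<in> ivl" "u x = 0" and y: "y \<in> ivl"
  shows "u y = 0"
proof -
  show ?thesis
  proof (cases "y \<le> x")
    case True
    have "(1 + y) powr (2 * a) * (u y \<bullet> u y) \<le> (1 + x) powr (2 * a) * (u x \<bullet> u x)"
    proof (rule DERIV_nonneg_imp_nondecreasing[OF True])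
      fix z assume "y \<le> z" "z \<le> x"
      then have z: "z \<in> ivl" using x y by auto
      have "((\<lambda>y. (1 + y) powr (2 * a) * (u y \<bullet> u y)) has_real_derivative
          2 * a * (1 + z) powr (2 * a - 1) * (u z \<bullet> u z) + 2 * (u z \<bullet> v z) * (1 + z) powr (2 * a)) (at z)"
        using z by (intro DERIV_mult u_inner_u_deriv) (auto intro!: derivative_eq_intros)
      moreover have "2 * a * (1 + z) powr (2 * a - 1) * (u z \<bullet> u z) + 2 * (u z \<bullet> v z) * (1 + z) powr (2 * a)
          = 2 * (1 + z) powr (2 * a - 1) * (a * (u z \<bullet> u z) + (1 + z) * (u z \<bullet> v z))"
        using z by (simp add: powr_diff field_simps)
      ultimately have "((\<lambda>y. (1 + y) powr (2 * a) * (u y \<bullet> u y)) has_real_derivative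
          2 * (1 + z) powr (2 * a - 1) * (a * (u z \<bullet> u z) + (1 + z) * (u z \<bullet> v z))) (at z)"
        by (rule DERIV_cong)
      moreover have "0 \<le> 2 * (1 + z) powr (2 * a - 1) * (a * (u z \<bullet> u z) + (1 + z) * (u z \<bullet> v z))"
        using logarithmic_derivative_bounds(1)[OF z] by simp
      ultimately show "\<exists>d. ((\<lambda>y. (1 + y) powr (2 * a) * (u y \<bullet> u y)) has_real_derivative d) (at z) \<and> 0 \<le> d"
        by blast
    qed
    then have "(1 + y) powr (2 * a) * (u y \<bullet> u y) \<le> 0" using x by simp
    then have "u y \<bullet> u y \<le> 0" using y by (simp add: mult_le_0_iff)
    then show ?thesis by (metis inner_ge_zero inner_eq_zero_iff order_antisym)
  next
    case False
    then have "x \<le> y" by simp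
    have "(1 - x) powr (2 * a) * (u x \<bullet> u x) \<ge> (1 - y) powr (2 * a) * (u y \<bullet> u y)"
    proof (rule DERIV_nonpos_imp_nonincreasing[OF \<open>x \<le> y\<close>])
      fix z assume "x \<le> z" "z \<le> y"
      then have z: "z \<in> ivl" using x y by auto
      have "((\<lambda>y. (1 - y) powr (2 * a) * (u y \<bullet> u y)) has_real_derivative
          - (2 * a * (1 - z) powr (2 * a - 1)) * (u z \<bullet> u z) + 2 * (u z \<bullet> v z) * (1 - z) powr (2 * a)) (at z)"
        using z by (intro DERIV_mult u_inner_u_deriv) (auto intro!: derivative_eq_intros)
      moreover have "- (2 * a * (1 - z) powr (2 * a - 1)) * (u z \<bullet> u z) + 2 * (u z \<bullet> v z) * (1 - z) powr (2 * a)
          = 2 * (1 - z) powr (2 * a - 1) * ((1 - z) * (u z \<bullet> v z) - a * (u z \<bullet> u z))"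
        using z by (simp add: powr_diff field_simps)
      ultimately have "((\<lambda>y. (1 - y) powr (2 * a) * (u y \<bullet> u y)) has_real_derivative
          2 * (1 - z) powr (2 * a - 1) * ((1 - z) * (u z \<bullet> v z) - a * (u z \<bullet> u z))) (at z)"
        by (rule DERIV_cong)
      moreover have "2 * (1 - z) powr (2 * a - 1) * ((1 - z) * (u z \<bullet> v z) - a * (u z \<bullet> u z)) \<le> 0"
        using logarithmic_derivative_bounds(2)[OF z] by (simp add: mult_nonneg_nonpos)
      ultimately show "\<exists>d. ((\<lambda>y. (1 - y) powr (2 * a) * (u y \<bullet> u y)) has_real_derivative d) (at z) \<and> d \<le> 0"
        by blast
    qed
    then have "(1 - y) powr (2 * a) * (u y \<bullet> u y) \<le> 0" using x by simp
    then have "u y \<bullet> u y \<le> 0" using y by (simp add: mult_le_0_iff)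
    then show ?thesis by (metis inner_ge_zero inner_eq_zero_iff order_antisym)
  qed
qed

text \<open>Each component of \<open>u / |u|\<close> has derivative zero, because its numerator is
  an angular momentum component with one direction taken to be \<open>u\<close> itself.\<close>

lemma constant_direction:
  assumes nz: "\<And>y. y \<in> ivl \<Longrightarrow> u y \<noteq> 0" and y: "y \<in> ivl"
  shows "u y = norm (u y) *\<^sub>R (u 0 /\<^sub>R norm (u 0))"
proof -
  have comp: "(u y \<bullet> c) / norm (u y) = (u 0 \<bullet> c) / norm (u 0)" for c
  proof -
    have "((\<lambda>y. (u y \<bullet> c) / norm (u y)) has_real_derivative 0) (at x)" if x: "x \<in> ivl" for x
    proof -
      have "((\<lambda>y. norm (u y)) has_real_derivative (u x \<bullet> v x) / norm (u x)) (at x)"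
      proof -
        have "0 < u x \<bullet> u x" using nz[OF x] by simp
        from DERIV_chain2[OF DERIV_real_sqrt[OF this] u_inner_u_deriv[OF x]]
        have "((\<lambda>y. norm (u y)) has_real_derivative inverse (norm (u x)) / 2 * (2 * (u x \<bullet> v x))) (at x)"
          by (simp only: norm_eq_sqrt_inner)
        then show ?thesis by (rule DERIV_cong) (simp add: field_simps)
      qed
      then have "((\<lambda>y. (u y \<bullet> c) / norm (u y)) has_real_derivative
          ((v x \<bullet> c) * norm (u x) - (u x \<bullet> c) * ((u x \<bullet> v x) / norm (u x))) / (norm (u x) * norm (u x))) (at x)"
        by (intro DERIV_divide u_inner_v_deriv[OF x]) (use nz[OF x] in auto)
      moreover have "(v x \<bullet> c) * norm (u x) - (u x \<bullet> c) * ((u x \<bullet> v x) / norm (u x)) = 0"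
      proof -
        \<comment> \<open>The first direction is the fixed vector \<open>u x\<close>, so the law
          holding for all fixed \<open>b\<close> applies at this point.\<close>
        have "norm (u x) * norm (u x) * (v x \<bullet> c) = (u x \<bullet> c) * (u x \<bullet> v x)"
          using angular_momentum_eq_0[OF x, of "u x" c]
          by (simp add: power2_norm_eq_inner[symmetric] power2_eq_square inner_commute)
        then show ?thesis using nz[OF x] by (simp add: field_simps)
      qed
      ultimately show ?thesis by simp
    qed
    then show ?thesis
      using y by (intro constant_on_ivl[where f = "\<lambda>y. (u y \<bullet> c) / norm (u y)"])
        (auto simp: has_real_derivative_iff_has_vector_derivative)
  qed
  have "u y \<bullet> c = (norm (u y) *\<^sub>R (u 0 /\<^sub>R norm (u 0))) \<bullet> c" for c
    using comp[of c] nz[OF y] nz[of 0] by (simp add: field_simps)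
  then show ?thesis
    by (rule vector_eq_rdot[THEN iffD1, OF allI])
qed

text \<open>Along the fixed direction the profile is a positive scalar \<open>f\<close> whose power
  \<open>-1/a\<close> is affine, \<open>A + B y\<close>. The energy identity links \<open>A\<close>
  and \<open>B\<close>, leaving the single parameter \<open>d = B / A\<close>.\<close>

theorem classification:
  "(\<forall>y\<in>ivl. u y = 0) \<or> (\<exists>d\<in>ivl. \<exists>\<Omega>\<in>sphere 0 1. \<forall>y\<in>ivl. u y = kappa p d y *\<^sub>R \<Omega>)"
proof (cases "\<exists>x\<in>ivl. u x = 0")
  case True
  then show ?thesis using zero_everywhere_if_somewhere by blast
next
  case False
  then have nz: "u y \<noteq> 0" if "y \<in> ivl" for y using that by blast
  define \<Omega> where "\<Omega> = u 0 /\<^sub>R norm (u 0)"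
  define f where "f y = u y \<bullet> \<Omega>" for y
  define h where "h y = v y \<bullet> \<Omega>" for y
  have \<Omega>: "norm \<Omega> = 1" "\<Omega> \<bullet> \<Omega> = 1"
    using nz[of 0] by (auto simp: \<Omega>_def dot_square_norm)
  have u_norm: "u y = norm (u y) *\<^sub>R \<Omega>" if "y \<in> ivl" for y
    unfolding \<Omega>_def by (rule constant_direction[OF nz that])
  have f_norm: "f y = norm (u y)" if "y \<in> ivl" for y
    unfolding f_def by (subst u_norm[OF that]) (simp add: \<Omega>)
  have f_pos: "f y > 0" if "y \<in> ivl" for y
    using nz[OF that] by (simp add: f_norm[OF that])
  have u_eq: "u y = f y *\<^sub>R \<Omega>" if "y \<in> ivl" for y
    using u_norm[OF that] by (simp add: f_norm[OF that])
  \<comment> \<open>The angular momentum law with \<open>\<Omega>\<close> as one direction; the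
    positive factor \<open>f y\<close> cancels.\<close>
  have v_eq: "v y = h y *\<^sub>R \<Omega>" if y: "y \<in> ivl" for y
  proof -
    have "v y \<bullet> c = (h y *\<^sub>R \<Omega>) \<bullet> c" for c
      using angular_momentum_eq_0[OF y, of \<Omega> c] f_pos[OF y] \<Omega>(2)
      by (simp add: u_eq[OF y] h_def)
    then show ?thesis by (rule vector_eq_rdot[THEN iffD1, OF allI])
  qed
  have f_deriv: "(f has_real_derivative h y) (at y)" if "y \<in> ivl" for y
    unfolding f_def[abs_def] h_def by (rule u_inner_v_deriv(1)[OF that])
  have h_deriv: "(h has_real_derivative
      (2 * (a + 1) * y * h y + (a * (a + 1) - f y powr (p - 1)) * f y) / (1 - y\<^sup>2)) (at y)"
    if "y \<in> ivl" for y
    using u_inner_v_deriv(2)[OF that, of \<Omega>]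
    by (simp add: f_norm[OF that, symmetric] h_def[abs_def] flip: f_def)
  have energy_f: "(1 - y\<^sup>2) * (h y)\<^sup>2 - 2 * a * y * (f y * h y) - a\<^sup>2 * (f y)\<^sup>2
      + a / (a + 1) * f y powr (p - 1) * (f y)\<^sup>2 = 0" if y: "y \<in> ivl" for y
  proof -
    have "2 / (p + 1) = a / (a + 1)" using a_pos by (simp add: p_eq field_simps)
    then show ?thesis
      using energy_eq_0[OF y] f_pos[OF y] \<Omega>(2)
      unfolding norm_powr_add_2 by (simp add: u_eq[OF y] v_eq[OF y] \<Omega>(1) power2_eq_square mult_ac)
  qed
  define g where "g y = f y powr (- (1 / a))" for y
  define g' where "g' y = - (1 / a) * f y powr (- (1 / a) - 1) * h y" for y
  have g_deriv: "(g has_real_derivative g' y) (at y)" if "y \<in> ivl" for y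
    unfolding g_def[abs_def] g'_def using f_deriv[OF that] f_pos[OF that]
    by (auto intro!: derivative_eq_intros)
  have g'_deriv: "(g' has_real_derivative 0) (at y)" if y: "y \<in> ivl" for y
  proof -
    define h' where "h' = (2 * (a + 1) * y * h y + (a * (a + 1) - f y powr (p - 1)) * f y) / (1 - y\<^sup>2)"
    have T: "1 - y\<^sup>2 > 0" using one_minus_sq_pos[OF y] .
    have "(h has_real_derivative h') (at y)" using h_deriv[OF y] by (simp add: h'_def)
    then have "(g' has_real_derivative
        1 / a * f y powr (- (1 / a) - 2) * ((1 / a + 1) * (h y)\<^sup>2 - f y * h')) (at y)"
    proof -
      assume hd: "(h has_real_derivative h') (at y)"
      have eq: "f y powr (- (1 / a) - 1) = f y powr (- (1 / a) - 2) * f y"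
        using f_pos[OF y] by (simp add: powr_mult_base[symmetric] powr_diff power2_eq_square)
      have df: "((\<lambda>y. f y powr (- (1 / a) - 1)) has_real_derivative
          (- (1 / a) - 1) * f y powr (- (1 / a) - 2) * h y) (at y)"
        by (rule DERIV_cong[OF DERIV_fun_powr[OF f_deriv[OF y] f_pos[OF y]]]) (simp add: algebra_simps)
      show ?thesis
        unfolding g'_def[abs_def]
        by (rule DERIV_cong[OF DERIV_mult[OF DERIV_cmult[OF df] hd]])
          (unfold eq, use a_pos in \<open>simp add: field_simps power2_eq_square\<close>)
    qed
    moreover have "(1 / a + 1) * (h y)\<^sup>2 - f y * h' = 0"
    proof -
      \<comment> \<open>The bracket governing the second derivative of \<open>g\<close> is, up to
        the positive factor \<open>(1 - y\<^sup>2)\<close>, a multiple of the left side of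
        \<open>energy_f\<close>; the second-order equation enters through \<open>h'\<close>.\<close>
      have "(1 - y\<^sup>2) * ((1 / a + 1) * (h y)\<^sup>2 - f y * h') = (a + 1) / a *
          ((1 - y\<^sup>2) * (h y)\<^sup>2 - 2 * a * y * (f y * h y) - a\<^sup>2 * (f y)\<^sup>2 + a / (a + 1) * f y powr (p - 1) * (f y)\<^sup>2)"
      proof -
        have "(1 - y\<^sup>2) * h' = 2 * (a + 1) * y * h y + (a * (a + 1) - f y powr (p - 1)) * f y"
          using T by (simp add: h'_def)
        moreover have "(1 - y\<^sup>2) * ((1 / a + 1) * (h y)\<^sup>2 - f y * h')
            = (1 / a + 1) * (1 - y\<^sup>2) * (h y)\<^sup>2 - f y * ((1 - y\<^sup>2) * h')"
          by algebra
        ultimately have "(1 - y\<^sup>2) * ((1 / a + 1) * (h y)\<^sup>2 - f y * h') = (1 / a + 1) * (1 - y\<^sup>2) * (h y)\<^sup>2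
            - f y * (2 * (a + 1) * y * h y + (a * (a + 1) - f y powr (p - 1)) * f y)"
          by (simp only:)
        also have "\<dots> = (a + 1) / a *
          ((1 - y\<^sup>2) * (h y)\<^sup>2 - 2 * a * y * (f y * h y) - a\<^sup>2 * (f y)\<^sup>2 + a / (a + 1) * f y powr (p - 1) * (f y)\<^sup>2)"
        proof -
          have c: "1 / a + 1 = (a + 1) / a" "(a + 1) / a * a = a + 1" "(a + 1) / a * (a / (a + 1)) = 1"
            using a_pos by (auto simp: field_simps add_pos_pos less_imp_neq[symmetric])
          show ?thesis unfolding c(1) using c(2,3) by algebra
        qed
        finally show ?thesis .
      qed
      then show ?thesis using T energy_f[OF y] by simp
    qed
    ultimately show ?thesis by simp
  qed
  define A where "A = g 0"
  define B where "B = g' 0"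
  have g'_eq: "g' y = B" if "y \<in> ivl" for y
    unfolding B_def using that g'_deriv
    by (intro constant_on_ivl) (auto simp: has_real_derivative_iff_has_vector_derivative)
  have g_eq: "g y = A + B * y" if y: "y \<in> ivl" for y
  proof -
    have "((\<lambda>y. g y - B * y) has_real_derivative 0) (at x)" if "x \<in> ivl" for x
      using g_deriv[OF that] g'_eq[OF that] by (auto intro!: derivative_eq_intros)
    then have "g y - B * y = g 0 - B * 0"
      using y by (intro constant_on_ivl[where f = "\<lambda>y. g y - B * y"])
        (auto simp: has_real_derivative_iff_has_vector_derivative)
    then show ?thesis by (simp add: A_def)
  qed
  \<comment> \<open>The power \<open>p - 1\<close> of \<open>kappa0 p\<close> is
    \<open>a * (a + 1)\<close>, so \<open>k\<close> is what later turns the amplitude into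
    \<open>kappa0 p\<close>.\<close>
  define k where "k = 1 / (a * (a + 1))"
  have k: "k > 0" using a_pos by (simp add: k_def)
  have A: "A > 0" using f_pos[of 0] by (simp add: A_def g_def)
  \<comment> \<open>The energy identity at \<open>y = 0\<close> multiplied by
    \<open>F\<^sup>2 / a\<^sup>2\<close>. In the power term all exponents of \<open>f 0\<close>
    cancel, since \<open>p - 1 = 2 / a\<close>. Positivity of \<open>k\<close> then yields
    \<open>|B| < A\<close>.\<close>
  have AB: "A\<^sup>2 - B\<^sup>2 = k"
  proof -
    have f0: "f 0 > 0" using f_pos by simp
    define F where "F = f 0 powr (- (1 / a) - 1)"
    have A_F: "A = F * f 0"
      using f0 by (simp add: A_def g_def F_def powr_diff)
    have "F\<^sup>2 * (f 0 powr (p - 1) * (f 0)\<^sup>2) = f 0 powr ((- (1 / a) - 1) + (- (1 / a) - 1) + (p - 1) + 2)"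
      using f0 by (simp only: powr_add) (simp add: F_def power2_eq_square)
    also have "\<dots> = 1" using f0 by (simp add: p_eq)
    finally have *: "F\<^sup>2 * (f 0 powr (p - 1) * (f 0)\<^sup>2) = 1" .
    have "(h 0)\<^sup>2 = a\<^sup>2 * (f 0)\<^sup>2 - a / (a + 1) * f 0 powr (p - 1) * (f 0)\<^sup>2"
      using energy_f[of 0] by simp
    then have "B\<^sup>2 = F\<^sup>2 / a\<^sup>2 * (a\<^sup>2 * (f 0)\<^sup>2 - a / (a + 1) * f 0 powr (p - 1) * (f 0)\<^sup>2)"
      by (simp add: B_def g'_def F_def power_mult_distrib power_divide)
    also have "\<dots> = (F * f 0)\<^sup>2 - k * (F\<^sup>2 * (f 0 powr (p - 1) * (f 0)\<^sup>2))"
    proof -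
      have "1 / a\<^sup>2 * a\<^sup>2 = 1" "1 / a\<^sup>2 * (a / (a + 1)) = k"
        using a_pos by (auto simp: k_def power2_eq_square)
      moreover have "F\<^sup>2 / a\<^sup>2 = F\<^sup>2 * (1 / a\<^sup>2)" by simp
      ultimately show ?thesis by algebra
    qed
    finally show ?thesis by (simp add: * A_F)
  qed
  define d where "d = B / A"
  have kd: "1 - d\<^sup>2 = k / A\<^sup>2"
    unfolding AB[symmetric] using A by (simp add: d_def power_divide diff_divide_distrib)
  then have "d\<^sup>2 < 1" using k A by (smt (verit) divide_pos_pos zero_less_power)
  then have d: "d \<in> ivl" by (simp add: abs_square_less_1 abs_less_iff)
  have "u y = kappa p d y *\<^sub>R \<Omega>" if y: "y \<in> ivl" for y
  proof -
    have "\<bar>d * y\<bar> < 1" using d y abs_mult_less[of d 1 y 1] by (simp add: abs_less_iff abs_mult)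
    then have dy: "1 + d * y > 0" by linarith
    have "f y = g y powr (- a)"
      using f_pos[OF y] a_pos by (simp add: g_def powr_powr)
    also have "g y = A * (1 + d * y)"
      using A by (simp add: g_eq[OF y] d_def field_simps)
    also have "(A * (1 + d * y)) powr (- a) = A powr (- a) * (1 + d * y) powr (- a)"
      using A dy by (simp add: powr_mult)
    also have "A powr (- a) = kappa0 p * (1 - d\<^sup>2) powr (1 / (p - 1))"
    proof -
      have e: "1 / (p - 1) = a / 2" using p_gt_1 by (simp add: a_def field_simps)
      have "2 * (p + 1) / (p - 1)\<^sup>2 = 1 / k"
        using p_gt_1 by (simp add: k_def a_def power2_eq_square field_simps)
      then have "kappa0 p * (1 - d\<^sup>2) powr (1 / (p - 1)) = (1 / k) powr (a / 2) * (k / A\<^sup>2) powr (a / 2)"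
        by (simp add: kappa0_def e kd)
      also have "\<dots> = (1 / A\<^sup>2) powr (a / 2)"
        using k A by (simp add: powr_mult[symmetric])
      also have "1 / A\<^sup>2 = A powr (- 2)" using A by (simp add: powr_neg_numeral)
      finally show ?thesis using A by (simp add: powr_powr)
    qed
    finally have "f y = kappa p d y"
      by (simp add: kappa_def a_def powr_minus_divide)
    then show ?thesis using u_eq[OF y] by simp
  qed
  then show ?thesis using d \<Omega>(1) by (intro disjI2 bexI[of _ d] bexI[of _ \<Omega>]) auto
qed

end

section \<open>The energy of the profiles\<close>

lemma AE_lebesgue_on_ivl: "(AE y in lebesgue_on ivl. Q y) \<longleftrightarrow> (AE y in lebesgue. y \<in> ivl \<longrightarrow> Q y)"
  by (simp add: AE_restrict_space_iff)

text \<open>The integrand of \<open>E\<close> is determined only almost everywhere, through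
  \<open>weak_deriv\<close>. This trades it for a continuous integrand on the closed
  interval.\<close>

lemma set_lebesgue_integral_ivl_eq_integral_AE:
  fixes f g :: "real \<Rightarrow> real"
  assumes f: "continuous_on {-1..1} f" and "AE y in lebesgue_on ivl. g y = f y"
  shows "(LINT y:ivl|lebesgue. g y) = integral {-1..1} f"
proof -
  have AE: "AE y in lebesgue. indicator ivl y *\<^sub>R f y = indicator ivl y *\<^sub>R g y"
    using assms(2) unfolding AE_lebesgue_on_ivl by eventually_elim (auto simp: indicator_def)
  have int: "set_integrable lebesgue ivl f"
    using absolutely_integrable_continuous_real[OF f] by (rule set_integrable_subset) auto
  then have meas: "(\<lambda>y. indicator ivl y *\<^sub>R f y) \<in> borel_measurable lebesgue"
    unfolding set_integrable_def by (rule borel_measurable_integrable)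
  have "(LINT y:ivl|lebesgue. g y) = (LINT y:ivl|lebesgue. f y)"
    unfolding set_lebesgue_integral_def
    using AE by (intro integral_cong_AE[symmetric] meas borel_measurable_AE[OF meas])
  also have "\<dots> = integral {-1<..<1} f"
    by (rule set_lebesgue_integral_eq_integral(2)[OF int])
  also have "\<dots> = integral {-1..1} f"
    using integral_open_interval[of "-1" 1 f] by simp
  finally show ?thesis .
qed

lemma E_zero: "E p (\<lambda>_. 0 :: 'a::euclidean_space) (\<lambda>_. 0 :: 'a) = 0"
proof -
  have "has_weak_deriv (\<lambda>_. 0 :: 'a) (\<lambda>_. 0)"
    by (rule C1_has_weak_deriv) auto
  from weak_deriv_AE_eq[OF this]
  show ?thesis
    unfolding AE_lebesgue_on_ivl E_def set_lebesgue_integral_def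
    by (intro integral_eq_zero_AE) (auto elim!: eventually_mono simp: indicator_def)
qed

lemma one_plus_mult_pos:
  fixes d y :: real
  assumes "d \<in> ivl" "y \<in> {-1..1}"
  shows "1 + d * y > 0"
proof -
  have "\<bar>d * y\<bar> \<le> \<bar>d\<bar> * 1"
    unfolding abs_mult using assms by (intro mult_left_mono) auto
  then show ?thesis using assms by auto
qed

lemma kappa_has_derivative:
  assumes "d \<in> ivl" "y \<in> {-1..1}"
  shows "(kappa p d has_real_derivative - (2 / (p - 1) * d / (1 + d * y)) * kappa p d y) (at y)"
proof -
  define a where "a = 2 / (p - 1)"
  define K where "K = kappa0 p * (1 - d\<^sup>2) powr (1 / (p - 1))"
  have pos: "1 + d * y > 0" using one_plus_mult_pos[OF assms] .
  have eq: "kappa p d = (\<lambda>y. K * (1 + d * y) powr (- a))"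
    by (auto simp: kappa_def K_def a_def powr_minus_divide)
  have "((\<lambda>y. 1 + d * y) has_real_derivative d) (at y)"
    by (auto intro!: derivative_eq_intros)
  from DERIV_cmult[OF DERIV_fun_powr[OF this pos, of "- a"], of K]
  have "(kappa p d has_real_derivative K * (- a * (1 + d * y) powr (- a - 1) * d)) (at y)"
    unfolding eq by simp
  moreover have "(1 + d * y) powr (- a - 1) = (1 + d * y) powr (- a) / (1 + d * y)"
    using pos by (simp add: powr_diff)
  ultimately show ?thesis
    unfolding eq a_def[symmetric] by (simp add: mult_ac)
qed

lemma moebius_image:
  fixes d y :: real
  assumes d: "d \<in> ivl" and y: "y \<in> {-1..1}"
  shows "(y + d) / (1 + d * y) \<in> {-1..1}"
    and "1 - ((y + d) / (1 + d * y))\<^sup>2 = (1 - y\<^sup>2) * (1 - d\<^sup>2) / (1 + d * y)\<^sup>2"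
proof -
  have pos: "1 + d * y > 0" using one_plus_mult_pos[OF assms] .
  have "0 \<le> (1 - y) * (1 - d)" "0 \<le> (1 + y) * (1 + d)" using d y by auto
  then show "(y + d) / (1 + d * y) \<in> {-1..1}"
    using pos by (simp add: field_simps)
  show "1 - ((y + d) / (1 + d * y))\<^sup>2 = (1 - y\<^sup>2) * (1 - d\<^sup>2) / (1 + d * y)\<^sup>2"
    using pos by (simp add: power_divide field_simps) (simp add: power2_eq_square algebra_simps)
qed

lemma continuous_on_one_minus_sq_powr:
  assumes "b > 0"
  shows "continuous_on {-1..1} (\<lambda>y::real. (1 - y\<^sup>2) powr b)"
  using assms by (intro continuous_on_powr' continuous_intros) (auto simp: abs_square_le_1)

text \<open>The integrand of the energy has the antiderivative
  \<open>C F(Y(y)) + (1 - y\<^sup>2)\<^sup>a\<^sup>+\<^sup>1 \<kappa> \<kappa>' / 2\<close>, where \<open>F' = (1 - y\<^sup>2)\<^sup>a\<close> and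
  \<open>Y(y) = (y + d) / (1 + d y)\<close> fixes both end points.\<close>

lemma E_kappa:
  fixes \<Omega> :: "'a::euclidean_space"
  assumes p: "p > 1" and d: "d \<in> ivl" and \<Omega>: "norm \<Omega> = 1"
  shows "E p (\<lambda>y. kappa p d y *\<^sub>R \<Omega>) (\<lambda>_. 0)
    = (1 / 2 - 1 / (p + 1)) * kappa0 p powr (p + 1) * integral {-1..1} (rho p)"
proof -
  define a where "a = 2 / (p - 1)"
  have a: "a > 0" using p by (simp add: a_def)
  have p_eq: "p = 1 + 2 / a" using p by (simp add: a_def field_simps)
  have a_half: "1 / (p - 1) = a / 2" using p by (simp add: a_def field_simps)
  have rho: "rho p = (\<lambda>y. (1 - y\<^sup>2) powr a)" by (auto simp: rho_def a_def)
  define \<kappa> where "\<kappa> = kappa p d"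
  define \<kappa>' where "\<kappa>' y = - (a * d / (1 + d * y)) * \<kappa> y" for y
  have pos: "1 + d * y > 0" if "y \<in> {-1..1}" for y
    using one_plus_mult_pos[OF d that] .
  have d_pos: "1 - d\<^sup>2 > 0" using one_minus_sq_pos[OF d] .
  have \<kappa>_deriv: "(\<kappa> has_real_derivative \<kappa>' y) (at y)" if "y \<in> {-1..1}" for y
    using kappa_has_derivative[OF d that, of p] by (simp add: \<kappa>_def \<kappa>'_def a_def)
  have \<kappa>_cont: "continuous_on {-1..1} \<kappa>"
    using \<kappa>_deriv by (meson DERIV_isCont continuous_at_imp_continuous_on)
  have \<kappa>'_cont: "continuous_on {-1..1} \<kappa>'"
    unfolding \<kappa>'_def using pos by (intro continuous_intros \<kappa>_cont) (auto simp: less_imp_neq[symmetric])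
  have \<kappa>_pos: "\<kappa> y > 0" if "y \<in> {-1..1}" for y
  proof -
    have "kappa0 p > 0" using p by (simp add: kappa0_def)
    then show ?thesis using pos[OF that] d_pos by (simp add: \<kappa>_def kappa_def)
  qed
  define I where "I y = (1 / 2 * (\<kappa>' y)\<^sup>2 * (1 - y\<^sup>2) + (p + 1) / (p - 1)\<^sup>2 * (\<kappa> y)\<^sup>2
      - 1 / (p + 1) * \<kappa> y powr (p + 1)) * rho p y" for y
  have rho_cont: "continuous_on {-1..1} (rho p)"
    unfolding rho by (rule continuous_on_one_minus_sq_powr[OF a])
  have powr_cont: "continuous_on {-1..1} (\<lambda>y. \<kappa> y powr (p + 1))"
    using \<kappa>_pos by (intro continuous_on_powr \<kappa>_cont continuous_intros) (auto simp: less_imp_neq[symmetric])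
  have I_cont: "continuous_on {-1..1} I"
    unfolding I_def by (intro powr_cont continuous_intros \<kappa>_cont \<kappa>'_cont rho_cont)
  have "has_weak_deriv (\<lambda>y. \<kappa> y *\<^sub>R \<Omega>) (\<lambda>y. \<kappa>' y *\<^sub>R \<Omega>)"
  proof (rule C1_has_weak_deriv)
    show "((\<lambda>y. \<kappa> y *\<^sub>R \<Omega>) has_vector_derivative \<kappa>' y *\<^sub>R \<Omega>) (at y)" if "y \<in> ivl" for y
      using \<kappa>_deriv[of y] that by (auto intro!: derivative_eq_intros)
    show "continuous_on ivl (\<lambda>y. \<kappa>' y *\<^sub>R \<Omega>)"
      by (intro continuous_intros continuous_on_subset[OF \<kappa>'_cont]) auto
  qed
  from weak_deriv_AE_eq[OF this]
  have "AE y in lebesgue. y \<in> ivl \<longrightarrow> weak_deriv (\<lambda>y. \<kappa> y *\<^sub>R \<Omega>) y = \<kappa>' y *\<^sub>R \<Omega>"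
    unfolding AE_lebesgue_on_ivl .
  then have "AE y in lebesgue_on ivl. (1 / 2 * (norm (0::'a))\<^sup>2 + 1 / 2 * (norm (weak_deriv (\<lambda>y. \<kappa> y *\<^sub>R \<Omega>) y))\<^sup>2 * (1 - y\<^sup>2)
        + (p + 1) / (p - 1)\<^sup>2 * (norm (\<kappa> y *\<^sub>R \<Omega>))\<^sup>2
        - 1 / (p + 1) * norm (\<kappa> y *\<^sub>R \<Omega>) powr (p + 1)) * rho p y = I y"
    unfolding AE_lebesgue_on_ivl
  proof eventually_elim
    case (elim y)
    then show ?case using \<kappa>_pos[of y] \<Omega> by (auto simp: I_def)
  qed
  from set_lebesgue_integral_ivl_eq_integral_AE[OF I_cont this]
  have E_eq: "E p (\<lambda>y. kappa p d y *\<^sub>R \<Omega>) (\<lambda>_. 0) = integral {-1..1} I"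
    by (simp add: E_def \<kappa>_def)
  define C where "C = (1 / 2 - 1 / (p + 1)) * kappa0 p powr (p + 1)"
  define F where "F x = integral {-1..x} (rho p)" for x
  define Y where "Y y = (y + d) / (1 + d * y)" for y
  \<comment> \<open>The second summand comes from multiplying the stationary equation by
    \<open>\<kappa> / 2\<close> and vanishes at both ends. What it leaves of the energy density is a
    multiple of \<open>\<rho>\<close> times the power \<open>p + 1\<close> of
    \<open>\<kappa>\<close>, and the substitution \<open>Y\<close> integrates that.\<close>
  define H where "H y = C * F (Y y) + 1 / 2 * ((1 - y\<^sup>2) powr (a + 1) * (\<kappa> y * \<kappa>' y))" for y
  have Y_cont: "continuous_on {-1..1} Y"
    unfolding Y_def using pos by (intro continuous_intros) (auto simp: less_imp_neq[symmetric])
  have "continuous_on {-1..1} F"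
    unfolding F_def by (intro indefinite_integral_continuous_1 integrable_continuous_real rho_cont)
  then have "continuous_on {-1..1} (\<lambda>y. F (Y y))"
    by (rule continuous_on_compose2[OF _ Y_cont]) (use moebius_image(1)[OF d] in \<open>auto simp: Y_def\<close>)
  then have H_cont: "continuous_on {-1..1} H"
    unfolding H_def using a
    by (intro continuous_intros \<kappa>_cont \<kappa>'_cont continuous_on_one_minus_sq_powr) auto
  have H_deriv: "(H has_real_derivative I y) (at y)" if y: "y \<in> ivl" for y
  proof -
    have y': "y \<in> {-1..1}" using y by auto
    note pos = pos[OF y']
    define T where "T = 1 - y\<^sup>2"
    define D where "D = 1 + d * y"
    have T: "T > 0" using one_minus_sq_pos[OF y] by (simp add: T_def)
    have D: "D > 0" using pos by (simp add: D_def)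
    have Y_sq: "1 - (Y y)\<^sup>2 = T * (1 - d\<^sup>2) / D\<^sup>2"
      using moebius_image(2)[OF d y'] by (simp add: Y_def T_def D_def)
    also have "\<dots> > 0" using T D d_pos by simp
    finally have "Y y \<in> ivl" by (simp add: abs_square_less_1 abs_less_iff)
    then have "(F has_real_derivative rho p (Y y)) (at (Y y))"
    proof -
      assume Yy: "Y y \<in> ivl"
      then have "(F has_real_derivative rho p (Y y)) (at (Y y) within {-1..1})"
        unfolding F_def[abs_def] by (intro integral_has_real_derivative rho_cont) auto
      moreover have "at (Y y) within {-1..1} = at (Y y)"
        using Yy by (intro at_within_interior) auto
      ultimately show ?thesis by simp
    qed
    moreover have "(Y has_real_derivative (1 - d\<^sup>2) / D\<^sup>2) (at y)"
      unfolding Y_def[abs_def] using pos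
      by (auto intro!: derivative_eq_intros simp: D_def power2_eq_square algebra_simps)
    ultimately have dF: "((\<lambda>y. F (Y y)) has_real_derivative rho p (Y y) * ((1 - d\<^sup>2) / D\<^sup>2)) (at y)"
      by (rule DERIV_chain2)
    have d\<kappa>': "(\<kappa>' has_real_derivative (a * (a + 1) * d\<^sup>2 / D\<^sup>2) * \<kappa> y) (at y)"
    proof -
      have "((\<lambda>y. - (a * d / (1 + d * y))) has_real_derivative a * d\<^sup>2 / D\<^sup>2) (at y)"
        using pos by (auto intro!: derivative_eq_intros simp: D_def power2_eq_square)
      from DERIV_mult[OF this \<kappa>_deriv[OF y']] show ?thesis
        unfolding \<kappa>'_def[symmetric]
        by (rule DERIV_cong) (simp add: \<kappa>'_def D_def[symmetric] power2_eq_square algebra_simps add_divide_distrib)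
    qed
    have dT: "((\<lambda>y. (1 - y\<^sup>2) powr (a + 1)) has_real_derivative - (2 * (a + 1) * y) * T powr a) (at y)"
      using one_minus_sq_powr_has_real_derivative[OF y, of "a + 1"] by (simp add: T_def)
    have dH: "(H has_real_derivative C * (rho p (Y y) * ((1 - d\<^sup>2) / D\<^sup>2)) + 1 / 2 *
        (- (2 * (a + 1) * y) * T powr a * (\<kappa> y * \<kappa>' y)
          + (\<kappa>' y * \<kappa>' y + (a * (a + 1) * d\<^sup>2 / D\<^sup>2) * \<kappa> y * \<kappa> y) * (1 - y\<^sup>2) powr (a + 1))) (at y)"
      unfolding H_def[abs_def]
      by (intro DERIV_add DERIV_cmult DERIV_mult dF dT \<kappa>_deriv[OF y'] d\<kappa>')
    have \<kappa>_powr: "\<kappa> y powr (p - 1) = a * (a + 1) * (1 - d\<^sup>2) / D\<^sup>2"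
    proof -
      have k0: "kappa0 p powr (p - 1) = a * (a + 1)"
      proof -
        have "kappa0 p powr (p - 1) = 2 * (p + 1) / (p - 1)\<^sup>2"
          using p by (simp add: kappa0_def powr_powr)
        also have "\<dots> = a * (a + 1)" using p by (simp add: a_def power2_eq_square field_simps)
        finally show ?thesis .
      qed
      have k0_pos: "kappa0 p > 0" using p by (simp add: kappa0_def)
      have "((1 - d\<^sup>2) powr (1 / (p - 1))) powr (p - 1) = 1 - d\<^sup>2"
        "(D powr (2 / (p - 1))) powr (p - 1) = D\<^sup>2"
      proof -
        have "1 / (p - 1) * (p - 1) = 1" "2 / (p - 1) * (p - 1) = 2" using p by (auto simp: field_simps)
        then show "((1 - d\<^sup>2) powr (1 / (p - 1))) powr (p - 1) = 1 - d\<^sup>2"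
          "(D powr (2 / (p - 1))) powr (p - 1) = D\<^sup>2"
          using d_pos D by (simp_all only: powr_powr) simp_all
      qed
      then show ?thesis
        using k0 k0_pos d_pos D
        by (simp add: \<kappa>_def kappa_def D_def[symmetric] powr_mult powr_divide)
    qed
    have \<kappa>_powr2: "\<kappa> y powr (p + 1) = \<kappa> y powr (p - 1) * (\<kappa> y)\<^sup>2"
      using \<kappa>_pos[OF y'] powr_add[of "\<kappa> y" "p - 1" 2] by (simp add: add.commute)
    \<comment> \<open>The change of variables: \<open>(1 - d\<^sup>2) / D\<^sup>2\<close> is the
      Jacobian of \<open>Y\<close>, and \<open>\<kappa>\<close> to the power \<open>p + 1\<close>
      carries precisely the missing factor to the power \<open>a + 1\<close>.\<close>
    have main: "C * (rho p (Y y) * ((1 - d\<^sup>2) / D\<^sup>2)) = (1 / 2 - 1 / (p + 1)) * (\<kappa> y powr (p + 1) * T powr a)"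
    proof -
      have e: "a / 2 * (p + 1) = a + 1" "a * (p + 1) = 2 * a + 2" "(2 * a + 2) / 2 = a + 1" using a by (simp_all add: p_eq field_simps)
      have k0_pos: "kappa0 p > 0" using p by (simp add: kappa0_def)
      have "\<kappa> y powr (p + 1) = kappa0 p powr (p + 1) * ((1 - d\<^sup>2) powr (a + 1) / D powr (2 * a + 2))"
        unfolding \<kappa>_def kappa_def D_def[symmetric] a_half a_def[symmetric]
        using k0_pos d_pos D by (simp add: powr_mult powr_divide powr_powr e)
      also have "(1 - d\<^sup>2) powr (a + 1) = (1 - d\<^sup>2) powr a * (1 - d\<^sup>2)"
        using d_pos by (simp add: powr_add)
      also have "D powr (2 * a + 2) = (D\<^sup>2) powr a * D\<^sup>2"
        using D by (simp add: powr_add powr_powr[symmetric])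
      finally have "\<kappa> y powr (p + 1) * T powr a = kappa0 p powr (p + 1) *
          (T powr a * (1 - d\<^sup>2) powr a / (D\<^sup>2) powr a * ((1 - d\<^sup>2) / D\<^sup>2))"
        by simp
      also have "T powr a * (1 - d\<^sup>2) powr a / (D\<^sup>2) powr a = rho p (Y y)"
        unfolding rho Y_sq using T D d_pos by (simp add: powr_mult powr_divide)
      finally show ?thesis by (simp add: C_def)
    qed
    have T_powr: "(1 - y\<^sup>2) powr (a + 1) = T powr a * T"
      using T by (simp add: powr_add T_def)
    have "2 * (p + 1) / (p - 1)\<^sup>2 = a * (a + 1)"
      using p by (simp add: a_def power2_eq_square field_simps)
    then have coef: "(p + 1) / (p - 1)\<^sup>2 = a * (a + 1) / 2" by linarith
    have "(1 / 2 - 1 / (p + 1)) * (\<kappa> y powr (p + 1) * T powr a) + 1 / 2 *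
        (- (2 * (a + 1) * y) * T powr a * (\<kappa> y * \<kappa>' y)
          + (\<kappa>' y * \<kappa>' y + (a * (a + 1) * d\<^sup>2 / D\<^sup>2) * \<kappa> y * \<kappa> y) * (T powr a * T)) - I y
      = T powr a * (\<kappa> y)\<^sup>2 / 2 * (\<kappa> y powr (p - 1)
          + 2 * a * (a + 1) * d * y / D + a * (a + 1) * d\<^sup>2 / D\<^sup>2 * T - a * (a + 1))"
    proof -
      \<comment> \<open>Stated for arbitrary reals, with \<open>i\<close> for \<open>1 / D\<close>
        and \<open>N\<close> for \<open>\<kappa>\<close> to the power \<open>p - 1\<close>, so that
        only polynomial algebra is involved.\<close>
      have "(1 / 2 - r) * (N * k\<^sup>2 * s) + 1 / 2 * (- (2 * (a + 1) * y) * s * (k * (- (a * d * i) * k))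
          + ((- (a * d * i) * k) * (- (a * d * i) * k) + (a * (a + 1) * d\<^sup>2 * i\<^sup>2) * k * k) * (s * T))
          - (1 / 2 * (- (a * d * i) * k)\<^sup>2 * T + a * (a + 1) / 2 * k\<^sup>2 - r * (N * k\<^sup>2)) * s
        = s * k\<^sup>2 / 2 * (N + 2 * a * (a + 1) * d * y * i + a * (a + 1) * d\<^sup>2 * i\<^sup>2 * T - a * (a + 1))"
        for r N k s i :: real
        by (simp add: field_simps power2_eq_square)
      from this[of "1 / (p + 1)" "\<kappa> y powr (p - 1)" "\<kappa> y" "T powr a" "1 / D"] show ?thesis
        unfolding I_def rho coef \<kappa>_powr2 \<kappa>'_def D_def[symmetric] T_def[symmetric]
        by (simp add: power_one_over)
    qed
    also have "\<kappa> y powr (p - 1) + 2 * a * (a + 1) * d * y / D + a * (a + 1) * d\<^sup>2 / D\<^sup>2 * T - a * (a + 1)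
        = a * (a + 1) * ((1 - d\<^sup>2) + 2 * d * y * D + d\<^sup>2 * T - D\<^sup>2) / D\<^sup>2"
      unfolding \<kappa>_powr using D by (simp add: field_simps power2_eq_square)
    also have "(1 - d\<^sup>2) + 2 * d * y * D + d\<^sup>2 * T - D\<^sup>2 = 0"
      by (simp add: D_def T_def power2_eq_square algebra_simps)
    finally show ?thesis
      using dH unfolding main T_powr by simp
  qed
  \<comment> \<open>The derivative of \<open>H\<close> was obtained only inside the interval, so the
    version of the fundamental theorem with continuity at the ends is used.\<close>
  have "(I has_integral H 1 - H (-1)) {-1..1}"
    using H_deriv by (intro fundamental_theorem_of_calculus_interior H_cont)
      (auto simp: has_real_derivative_iff_has_vector_derivative)
  moreover have "Y 1 = 1" "Y (-1) = -1"
    using pos[of 1] pos[of "-1"] by (auto simp: Y_def field_simps)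
  then have "H 1 - H (-1) = C * integral {-1..1} (rho p)"
    by (simp add: H_def F_def)
  ultimately show ?thesis
    unfolding E_eq C_def by (simp add: integral_unique)
qed

lemma kappa_0: "kappa p 0 y = kappa0 p"
  by (simp add: kappa_def)

text \<open>The constant profile is the case \<open>d = 0\<close> with the unit vector
  \<open>1\<close> of the real line.\<close>

lemma E_kappa0_eq:
  assumes "p > 1"
  shows "E p (\<lambda>_. kappa0 p) (\<lambda>_. 0) = (1 / 2 - 1 / (p + 1)) * kappa0 p powr (p + 1) * integral {-1..1} (rho p)"
  using E_kappa[OF assms, of 0 "1::real"] by (simp add: kappa_0)

lemma E_kappa0_pos:
  assumes p: "p > 1"
  shows "E p (\<lambda>_. kappa0 p) (\<lambda>_. 0) > 0"
proof -
  have a: "2 / (p - 1) > 0" using p by simp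
  have cont: "continuous_on {-1..1} (rho p)"
    unfolding rho_def by (rule continuous_on_one_minus_sq_powr[OF a])
  have nonneg: "0 \<le> rho p y" for y by (simp add: rho_def)
  have "integral {-1..1} (rho p) \<noteq> 0"
  proof
    assume "integral {-1..1} (rho p) = 0"
    then have "(rho p has_integral 0) (cbox (-1) 1)"
      using integrable_continuous_real[OF cont] by (metis box_real(2) integrable_integral)
    then have "rho p 0 = 0"
      by (rule has_integral_0_cbox_imp_0[rotated 2]) (use cont nonneg in auto)
    then show False by (simp add: rho_def)
  qed
  moreover have "0 \<le> integral {-1..1} (rho p)"
    using nonneg by (intro integral_nonneg integrable_continuous_real cont)
  ultimately have "integral {-1..1} (rho p) > 0" by simp
  moreover have "kappa0 p > 0" "1 / 2 - 1 / (p + 1) > 0" using p by (auto simp: kappa0_def field_simps)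
  ultimately show ?thesis unfolding E_kappa0_eq[OF p] by simp
qed

section \<open>Regularity and conclusion\<close>

text \<open>The set where the functions differ is open, and a nonempty open set is not negligible.
  It transfers the classification to every continuous representative.\<close>

lemma continuous_AE_eq_imp_eq:
  fixes f g :: "real \<Rightarrow> 'a::euclidean_space"
  assumes "continuous_on ivl f" "continuous_on ivl g" "AE y in lebesgue_on ivl. f y = g y" "x \<in> ivl"
  shows "f x = g x"
proof (rule ccontr)
  assume "f x \<noteq> g x"
  define U where "U = {y \<in> ivl. f y - g y \<in> - {0}}"
  have "open U"
    unfolding U_def
    using continuous_open_preimage[of ivl "\<lambda>y. f y - g y" "- {0}"] assms(1,2)
    by (simp add: continuous_on_diff open_Compl vimage_def Int_def)
  moreover have "x \<in> U" using \<open>f x \<noteq> g x\<close> assms(4) by (simp add: U_def)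
  ultimately have "\<not> negligible U" using open_not_negligible by blast
  moreover have "negligible U"
  proof -
    obtain N where "N \<in> null_sets lebesgue" "{y. \<not> (y \<in> ivl \<longrightarrow> f y = g y)} \<subseteq> N"
      using assms(3) unfolding AE_lebesgue_on_ivl by (auto simp: eventually_ae_filter)
    then show ?thesis
      unfolding negligible_iff_null_sets[symmetric] by (elim negligible_subset) (auto simp: U_def)
  qed
  ultimately show False by simp
qed

text \<open>Bootstrap: the flux \<open>\<rho> (1 - y\<^sup>2) w'\<close> has a weak derivative,
  hence a continuous representative \<open>q\<close>. As its weight is positive inside the interval,
  \<open>w'\<close> is continuous too, so \<open>u\<close> is \<open>C\<^sup>1\<close>. The equation
  then makes the derivative of the flux continuous, so \<open>q\<close> and \<open>v\<close> are
  \<open>C\<^sup>1\<close>.\<close>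

lemma stationary_solution_is_C2:
  fixes w :: "real \<Rightarrow> 'a::euclidean_space"
  assumes p: "p > 1" and a_def: "a = 2 / (p - 1)" and w: "stationary_solution p w"
  obtains u v where "AE y in lebesgue_on ivl. w y = u y" "has_weak_deriv w v"
    "continuous_on ivl u" "continuous_on ivl v"
    "\<And>y. y \<in> ivl \<Longrightarrow> (u has_vector_derivative v y) (at y)"
    "\<And>y. y \<in> ivl \<Longrightarrow> (v has_vector_derivative
      (1 / (1 - y\<^sup>2)) *\<^sub>R ((2 * (a + 1) * y) *\<^sub>R v y + (a * (a + 1) - norm (u y) powr (p - 1)) *\<^sub>R u y)) (at y)"
proof -
  obtain g h where g: "has_weak_deriv w g"
    and h: "has_weak_deriv (\<lambda>y. (rho p y * (1 - y\<^sup>2)) *\<^sub>R g y) h"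
    and eq: "AE y in lebesgue_on ivl. (1 / rho p y) *\<^sub>R h y - (2 * (p + 1) / (p - 1)\<^sup>2) *\<^sub>R w y
          + (norm (w y) powr (p - 1)) *\<^sub>R w y = 0"
    using w unfolding stationary_solution_def by blast
  have L1: "L1_loc g" "L1_loc h" using g h unfolding has_weak_deriv_def by auto
  obtain k where k: "AE y in lebesgue_on ivl. w y = k + primitive g y"
    using has_weak_deriv_imp_primitive[OF g] .
  obtain l where l: "AE y in lebesgue_on ivl. (rho p y * (1 - y\<^sup>2)) *\<^sub>R g y = l + primitive h y"
    using has_weak_deriv_imp_primitive[OF h] .
  define u where "u y = k + primitive g y" for y
  define q where "q y = l + primitive h y" for y
  define v where "v y = (1 - y\<^sup>2) powr (- (a + 1)) *\<^sub>R q y" for y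
  define H where "H y = ((1 - y\<^sup>2) powr a * (a * (a + 1) - norm (u y) powr (p - 1))) *\<^sub>R u y" for y
  have u_cont: "continuous_on ivl u"
    unfolding u_def by (intro continuous_intros continuous_on_primitive L1)
  have q_cont: "continuous_on ivl q"
    unfolding q_def by (intro continuous_intros continuous_on_primitive L1)
  have v_cont: "continuous_on ivl v"
    unfolding v_def by (intro continuous_on_scaleR continuous_on_ivl_one_minus_sq_powr q_cont)
  have "continuous_on ivl (\<lambda>y. norm (u y) powr (p - 1))"
    using p by (intro continuous_on_powr' continuous_intros u_cont) auto
  then have H_cont: "continuous_on ivl H"
    unfolding H_def by (intro continuous_on_scaleR continuous_on_mult continuous_on_diff continuous_on_const continuous_on_ivl_one_minus_sq_powr u_cont)
  have rho: "rho p y = (1 - y\<^sup>2) powr a" for y by (simp add: rho_def a_def)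
  have coef: "2 * (p + 1) / (p - 1)\<^sup>2 = a * (a + 1)"
    using p by (simp add: a_def power2_eq_square field_simps)
  have h_AE: "AE y in lebesgue_on ivl. h y = H y"
    using eq k unfolding AE_lebesgue_on_ivl
  proof eventually_elim
    case (elim y)
    show ?case
    proof
      assume y: "y \<in> ivl"
      have "rho p y > 0" using one_minus_sq_pos[OF y] by (simp add: rho)
      then have "h y = rho p y *\<^sub>R (1 / rho p y) *\<^sub>R h y" by simp
      also have "(1 / rho p y) *\<^sub>R h y = (a * (a + 1) - norm (u y) powr (p - 1)) *\<^sub>R u y"
      proof -
        have "x = s - t" if "x - s + t = 0" for x s t :: 'a
          using that by (simp add: algebra_simps)
        moreover have "w y = u y" using elim(2) y by (simp add: u_def)
        ultimately show ?thesis
          using elim(1) y unfolding coef scaleR_left_diff_distrib by metis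
      qed
      finally have "h y = rho p y *\<^sub>R (a * (a + 1) - norm (u y) powr (p - 1)) *\<^sub>R u y" .
      then show "h y = H y" by (simp add: H_def rho)
    qed
  qed
  have g_AE: "AE y in lebesgue_on ivl. g y = v y"
    using l unfolding AE_lebesgue_on_ivl
  proof eventually_elim
    case (elim y)
    show ?case
    proof
      assume y: "y \<in> ivl"
      have T: "1 - y\<^sup>2 > 0" using one_minus_sq_pos[OF y] .
      have "rho p y * (1 - y\<^sup>2) = (1 - y\<^sup>2) powr (a + 1)"
        using T by (simp add: rho powr_add)
      then have "(1 - y\<^sup>2) powr (a + 1) *\<^sub>R g y = q y"
        using elim y by (simp add: q_def)
      moreover have "(1 - y\<^sup>2) powr (- (a + 1)) * (1 - y\<^sup>2) powr (a + 1) = 1"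
        using T by (simp only: powr_add[symmetric]) simp
      ultimately show "g y = v y"
        unfolding v_def by (metis scaleR_one scaleR_scaleR)
    qed
  qed
  \<comment> \<open>Under the primitive, \<open>g\<close> may be exchanged for the continuous
    \<open>v\<close>, to which the classical fundamental theorem applies; the same is done below
    with \<open>h\<close> and \<open>H\<close>.\<close>
  have u_deriv: "(u has_vector_derivative v y) (at y)" if y: "y \<in> ivl" for y
  proof -
    have "((\<lambda>y. k + primitive v y) has_vector_derivative v y) (at y)"
      using primitive_has_vector_derivative[OF v_cont y] by (auto intro!: derivative_eq_intros)
    then show ?thesis
    proof (rule has_vector_derivative_transform_within_open[where S = ivl])
      show "k + primitive v x = u x" if "x \<in> ivl" for x
        using primitive_cong_AE[OF g_AE that] by (simp add: u_def)
    qed (use y in auto)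
  qed
  have q_deriv: "(q has_vector_derivative H y) (at y)" if y: "y \<in> ivl" for y
  proof -
    have "((\<lambda>y. l + primitive H y) has_vector_derivative H y) (at y)"
      using primitive_has_vector_derivative[OF H_cont y] by (auto intro!: derivative_eq_intros)
    then show ?thesis
    proof (rule has_vector_derivative_transform_within_open[where S = ivl])
      show "l + primitive H x = q x" if "x \<in> ivl" for x
        using primitive_cong_AE[OF h_AE that] by (simp add: q_def)
    qed (use y in auto)
  qed
  have v_deriv: "(v has_vector_derivative
      (1 / (1 - y\<^sup>2)) *\<^sub>R ((2 * (a + 1) * y) *\<^sub>R v y + (a * (a + 1) - norm (u y) powr (p - 1)) *\<^sub>R u y)) (at y)"
    if y: "y \<in> ivl" for y
  proof -
    have T: "1 - y\<^sup>2 > 0" using one_minus_sq_pos[OF y] .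
    have "(v has_vector_derivative (1 - y\<^sup>2) powr (- (a + 1)) *\<^sub>R H y
        + (- (2 * - (a + 1) * y) * (1 - y\<^sup>2) powr (- (a + 1) - 1)) *\<^sub>R q y) (at y)"
      unfolding v_def[abs_def]
      by (intro has_vector_derivative_scaleR one_minus_sq_powr_has_real_derivative q_deriv y)
    moreover have "(1 - y\<^sup>2) powr (- (a + 1)) * (1 - y\<^sup>2) powr a = 1 / (1 - y\<^sup>2)"
      using T by (simp only: powr_add[symmetric]) (simp add: powr_minus_divide)
    then have "(1 - y\<^sup>2) powr (- (a + 1)) *\<^sub>R H y
        = (1 / (1 - y\<^sup>2)) *\<^sub>R (a * (a + 1) - norm (u y) powr (p - 1)) *\<^sub>R u y"
      by (simp add: H_def mult.assoc[symmetric])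
    moreover have "(- (2 * - (a + 1) * y) * (1 - y\<^sup>2) powr (- (a + 1) - 1)) *\<^sub>R q y
        = (1 / (1 - y\<^sup>2)) *\<^sub>R (2 * (a + 1) * y) *\<^sub>R v y"
    proof -
      have "x powr (b - 1) = 1 / x * x powr b" if "x > 0" for x b :: real
        using that by (simp add: powr_diff)
      note eq = this[OF T, of "- (a + 1)"]
      have "- (2 * - b * y) * (i * z) = i * (2 * b * y * z)" for b i z :: real
        by simp
      then show ?thesis
        unfolding v_def scaleR_scaleR eq by (simp only:)
    qed
    ultimately show ?thesis by (simp only: scaleR_add_right add.commute)
  qed
  have "has_weak_deriv w v"
  proof -
    have wg: "(LINT y:ivl|lebesgue. \<phi> y *\<^sub>R v y) = (LINT y:ivl|lebesgue. \<phi> y *\<^sub>R g y)" if "test_function \<phi>" for \<phi>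
    proof -
      have L1v: "L1_loc v" by (rule continuous_imp_L1_loc[OF v_cont])
      note int = test_function_times_L1_loc_integrable[OF that L1(1)] test_function_times_L1_loc_integrable[OF that L1v]
      show ?thesis
        using int g_AE unfolding set_lebesgue_integral_def set_integrable_def AE_lebesgue_on_ivl
        by (intro integral_cong_AE borel_measurable_integrable) (auto elim!: eventually_mono simp: indicator_def)
    qed
    show ?thesis
      using g wg continuous_imp_L1_loc[OF v_cont] unfolding has_weak_deriv_def by simp
  qed
  moreover have "AE y in lebesgue_on ivl. w y = u y" using k by (simp add: u_def)
  ultimately show ?thesis
    using that u_cont v_cont u_deriv v_deriv by blast
qed

text \<open>For \<open>y \<ge> 0\<close> the density agrees almost everywhere with the gradient part
  of the finite integral defining \<open>H0\<close>, so that integral is a bound. For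
  \<open>y < 0\<close> the primitive is nonpositive.\<close>

lemma H0_primitive_bounded:
  fixes w v :: "real \<Rightarrow> 'a::euclidean_space"
  assumes w: "w \<in> H0 p" and v: "has_weak_deriv w v" "continuous_on ivl v" and a_def: "a = 2 / (p - 1)"
  obtains M where "\<And>y. y \<in> ivl \<Longrightarrow> primitive (\<lambda>y. (norm (v y))\<^sup>2 * (1 - y\<^sup>2) powr (a + 1)) y \<le> M"
proof -
  define G where "G y = (norm (v y))\<^sup>2 * (1 - y\<^sup>2) powr (a + 1)" for y
  define B where "B = (\<integral>\<^sup>+ y \<in> ivl. ennreal (((norm (weak_deriv w y))\<^sup>2 * (1 - y\<^sup>2) + (norm (w y))\<^sup>2) * rho p y) \<partial>lebesgue)"
  have B: "B < \<infinity>" using w unfolding H0_def B_def by blast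
  have G_nonneg: "0 \<le> G y" for y by (simp add: G_def)
  have G_cont: "continuous_on ivl G"
    unfolding G_def
    by (intro continuous_on_mult continuous_on_power continuous_on_norm v(2) continuous_on_ivl_one_minus_sq_powr)
  have G_int: "G integrable_on {c..d}" if "-1 < c" "d < 1" for c d
    using that by (intro integrable_continuous_real continuous_on_subset[OF G_cont]) auto
  have "primitive G y \<le> enn2real B" if y: "y \<in> ivl" for y
  proof (cases "0 \<le> y")
    case True
    have "ennreal (integral {0..y} G) = (\<integral>\<^sup>+ x. ennreal (G x) * indicator {0..y} x \<partial>lborel)"
      using G_nonneg G_int[of 0 y] y
      by (intro nn_integral_has_integral_lebesgue'[symmetric] integrable_integral) auto
    also have "\<dots> = (\<integral>\<^sup>+ x. ennreal (G x) * indicator {0..y} x \<partial>lebesgue)"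
      by (simp add: nn_integral_completion)
    also have "\<dots> \<le> B"
      unfolding B_def
    proof (rule nn_integral_mono_AE)
      show "AE x in lebesgue. ennreal (G x) * indicator {0..y} x
          \<le> ennreal (((norm (weak_deriv w x))\<^sup>2 * (1 - x\<^sup>2) + (norm (w x))\<^sup>2) * rho p x) * indicator ivl x"
        using weak_deriv_AE_eq[OF v(1)] unfolding AE_lebesgue_on_ivl
      proof eventually_elim
        case (elim x)
        show ?case
        proof (cases "x \<in> {0..y}")
          case True
          then have x: "x \<in> ivl" using y by auto
          have T: "1 - x\<^sup>2 > 0" using one_minus_sq_pos[OF x] .
          have "G x = (norm (weak_deriv w x))\<^sup>2 * (1 - x\<^sup>2) * rho p x"
            using elim x T by (simp add: G_def rho_def a_def powr_add)
          also have "\<dots> \<le> ((norm (weak_deriv w x))\<^sup>2 * (1 - x\<^sup>2) + (norm (w x))\<^sup>2) * rho p x"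
            by (intro mult_right_mono) (auto simp: rho_def)
          finally show ?thesis using True x by (simp add: ennreal_leI)
        qed simp
      qed
    qed
    finally have "ennreal (integral {0..y} G) \<le> B" .
    then have "integral {0..y} G \<le> enn2real B"
      using B G_nonneg G_int[of 0 y] y
      by (metis enn2real_ennreal enn2real_mono infinity_ennreal_def integral_nonneg greaterThanLessThan_iff less_minus_one_simps(1))
    then show ?thesis using True by (simp add: primitive_def)
  next
    case False
    have "0 \<le> integral {y..0} G"
      using G_nonneg G_int[of y 0] y by (intro integral_nonneg) auto
    moreover have "primitive G y = - integral {y..0} G" using False by (simp add: primitive_def)
    ultimately show ?thesis using enn2real_nonneg[of B] by linarith
  qed
  then show ?thesis using that unfolding G_def by blast
qed

theorem proposition2:
  fixes p :: real
  assumes "p > 1" and "CARD('m::finite) \<ge> 2"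
  shows "(\<forall>w :: real \<Rightarrow> real ^ 'm. w \<in> H0 p \<and> stationary_solution p w \<longrightarrow>
      (\<exists>u. continuous_representative w u) \<and>
      (\<forall>u. continuous_representative w u \<longrightarrow>
        (\<forall>y\<in>{-1<..<1}. u y = 0) \<or>
        (\<exists>d\<in>{-1<..<1}. \<exists>\<Omega>\<in>sphere 0 1. \<forall>y\<in>{-1<..<1}. u y = kappa p d y *\<^sub>R \<Omega>)))
    \<and> E p (\<lambda>_. 0 :: real ^ 'm) (\<lambda>_. 0) = 0
    \<and> (\<forall>d\<in>{-1<..<1}. \<forall>\<Omega> \<in> sphere (0 :: real ^ 'm) 1.
        E p (\<lambda>y. kappa p d y *\<^sub>R \<Omega>) (\<lambda>_. 0) = E p (\<lambda>_. kappa0 p) (\<lambda>_. 0))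
    \<and> E p (\<lambda>_. kappa0 p) (\<lambda>_. 0) > 0"
proof (intro conjI allI ballI impI)
  fix w :: "real \<Rightarrow> real ^ 'm"
  assume w: "w \<in> H0 p \<and> stationary_solution p w"
  define a where "a = 2 / (p - 1)"
  obtain u v where w_u: "AE y in lebesgue_on ivl. w y = u y" and w_v: "has_weak_deriv w v"
    and cont: "continuous_on ivl u" "continuous_on ivl v"
    and deriv: "\<And>y. y \<in> ivl \<Longrightarrow> (u has_vector_derivative v y) (at y)"
    "\<And>y. y \<in> ivl \<Longrightarrow> (v has_vector_derivative
      (1 / (1 - y\<^sup>2)) *\<^sub>R ((2 * (a + 1) * y) *\<^sub>R v y + (a * (a + 1) - norm (u y) powr (p - 1)) *\<^sub>R u y)) (at y)"
    by (rule stationary_solution_is_C2[OF assms(1) a_def conjunct2[OF w]]) (rule that)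
  show "\<exists>u. continuous_representative w u"
    using w_u cont(1) unfolding continuous_representative_def by blast
  fix u' assume u': "continuous_representative w u'"
  \<comment> \<open>An arbitrary continuous representative has to coincide with the
    \<open>C\<^sup>2\<close> one at every point of the interval.\<close>
  have "AE y in lebesgue_on ivl. u' y = u y"
    using w_u u' unfolding continuous_representative_def by auto
  then have u'_eq: "u' y = u y" if "y \<in> ivl" for y
    using u' cont(1) that unfolding continuous_representative_def
    by (intro continuous_AE_eq_imp_eq[of u' u]) auto
  define G where "G y = (norm (v y))\<^sup>2 * (1 - y\<^sup>2) powr (a + 1)" for y
  obtain M where "\<And>y. y \<in> ivl \<Longrightarrow> primitive (\<lambda>y. (norm (v y))\<^sup>2 * (1 - y\<^sup>2) powr (a + 1)) y \<le> M"
    by (rule H0_primitive_bounded[OF conjunct1[OF w] w_v cont(2) a_def]) (rule that)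
  then have M: "primitive G y \<le> M" if "y \<in> ivl" for y
    using that by (simp only: G_def[abs_def])
  have G_cont: "continuous_on ivl G"
    unfolding G_def
    by (intro continuous_on_mult continuous_on_power continuous_on_norm cont(2) continuous_on_ivl_one_minus_sq_powr)
  have P_deriv: "(primitive G has_real_derivative (norm (v y))\<^sup>2 * (1 - y\<^sup>2) powr (a + 1)) (at y)"
    if "y \<in> ivl" for y
    using primitive_has_vector_derivative[OF G_cont that]
    by (simp only: G_def has_real_derivative_iff_has_vector_derivative)
  interpret stationary_profile p a u v "primitive G" M
    by unfold_locales (fact assms(1) a_def deriv P_deriv M)+
  show "(\<forall>y\<in>{-1<..<1}. u' y = 0) \<or>
      (\<exists>d\<in>{-1<..<1}. \<exists>\<Omega>\<in>sphere 0 1. \<forall>y\<in>{-1<..<1}. u' y = kappa p d y *\<^sub>R \<Omega>)"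
    using classification by (simp add: u'_eq)
next
  show "E p (\<lambda>_. 0 :: real ^ 'm) (\<lambda>_. 0) = 0" by (rule E_zero)
next
  fix d :: real and \<Omega> :: "real ^ 'm"
  assume "d \<in> ivl" "\<Omega> \<in> sphere 0 1"
  then show "E p (\<lambda>y. kappa p d y *\<^sub>R \<Omega>) (\<lambda>_. 0) = E p (\<lambda>_. kappa0 p) (\<lambda>_. 0)"
    using E_kappa[OF assms(1)] E_kappa0_eq[OF assms(1)] by simp
next
  show "E p (\<lambda>_. kappa0 p) (\<lambda>_. 0) > 0" by (rule E_kappa0_pos[OF assms(1)])
qed

end
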